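(* Let $\mathcal D\subseteq\mathbb R^n$ be a domain, $x^*\in\mathcal D$, and let $J\in C^2(\mathcal D;\mathbb R)$ satisfy: (i) $J(x)>J(x^* )$ for all $x\in\mathcal D\setminus\{x^*\}$; (ii) for $x\in\mathcal D$, $\nabla J(x)=0$ if and only if $x=x^*$. Let $\phi_1,\phi_2,\psi_1,\psi_2\in C^2(\mathbb R;\mathbb R)$ satisfy $[\phi_1,\phi_2](y)\equiv-1$ and $[\psi_1,\psi_2](z)\equiv1$, that is, $\phi_1\phi_2'-\phi_1'\phi_2\equiv-1$ and $\psi_1\psi_2'-\psi_1'\psi_2\equiv1$ on $\mathbb R$. Let $\epsilon>0$, $\alpha_i,\beta_i>0$ $(i=1,\dots,n)$. Let $\kappa_i,\varkappa_{i1},\varkappa_{i2}\in\mathbb N$ $(i=1,\dots,n)$, put $\varkappa_{i3}:=\varkappa_{i1}+\varkappa_{i2}$, $\varkappa_{i4}:=\varkappa_{i2}-\varkappa_{i1}$, and assume that $\varkappa_{i4}>0$ for all $i$ and that the following non-resonance assumption holds: (a) the $5n$ natural numbers $\varkappa_{i1},\varkappa_{i2},\varkappa_{i3},\varkappa_{i4},\kappa_i$, $i=1,\dots,n$, are pairwise distinct; (b) there are no third order resonances between the numbers $\varkappa_{i1},\varkappa_{i2},\varkappa_{i3},\varkappa_{i4}$, $i=1,\dots,n$, except those imposed by the definitions of $\varkappa_{i3}$ and $\varkappa_{i4}$ (i.e. except the relations $\varkappa_{i3}=\varkappa_{i1}+\varkappa_{i2}$ and $\varkappa_{i4}=\varkappa_{i2}-\varkappa_{i1}$).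 Put $\sigma_i=\sqrt{4\beta_i(\varkappa_{i2}^2-\varkappa_{i1}^2)}$ and consider, for the frequency parameter $\omega>0$, the system with state $\bar q=(\bar x^\top,\bar v^\top)^\top\in\mathbb R^{2n}$: $$\begin{aligned} \dot{\bar x}_i={}&\sqrt{2\alpha_i\kappa_i\omega}\Big(\phi_1\Big(\tfrac{J(\bar x)}{\sqrt{\bar v_i+\epsilon}}\Big)\cos(\kappa_i\omega t)+\phi_2\Big(\tfrac{J(\bar x)}{\sqrt{\bar v_i+\epsilon}}\Big)\sin(\kappa_i\omega t)\Big)\\ &+\sigma_i\omega^{2/3}\Big(\psi_1(J(\bar x))\cos(\varkappa_{i1}\omega t)+\psi_2(J(\bar x))\sin(\varkappa_{i2}\omega t)\Big),\\ \dot{\bar v}_i={}&-\beta_i\bar v_i+\omega^{2/3}J(\bar x)\cos(\varkappa_{i1}\omega t)\sin(\varkappa_{i2}\omega t),\qquad i=1,\dots,n. \end{aligned}$$ Then the point $q^*=({x^*}^\top,0^\top)^\top$ is practically uniformly asymptotically stable for this system provided that the initial values of the $\bar v$-components satisfy $\bar v_i(0)\ge0$, $i=1,\dots,n$.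
   Context: Notation: $\nabla J$ is the gradient of $J$. For $C^1$ vector fields $f,g$, $[f,g]=\frac{\partial g}{\partial x}f-\frac{\partial f}{\partial x}g$; for scalar functions of one variable this is $[f,g]=fg'-f'g$. The system is considered for $\bar x\in\mathcal D$, $\bar v_i>-\epsilon$. Third order resonance: a relation $\sum_s m_s\lambda_s=0$ between numbers $\lambda_s$ of the family, with integer coefficients $m_s$, not all zero, such that $\sum_s|m_s|=3$. Practical uniform asymptotic stability (the frequency $\omega$ being the parameter, and initial conditions being restricted to $\mathcal S=\{\bar q:\bar v_i\ge0,\ i=1,\dots,n\}$) of $q^*$ means that both of the following hold. (1) Practical uniform stability: for every $\varepsilon>0$ there exist $\delta>0$ and $\omega_0>0$ such that for all $\omega>\omega_0$ and all initial times $t_0\ge 0$, every solution with $\bar q(t_0)\in\mathcal S$ and $\|\bar q(t_0)-q^*\|<\delta$ exists for all $t\ge t_0$ and satisfies $\|\bar q(t)-q^*\|<\varepsilon$ for all $t\ge t_0$. (2) Practical uniform attractivity: there exists $\delta>0$ such that for every $\varepsilon>0$ there exist $t_f\ge0$ and $\omega_0>0$ such that for all $\omega>\omega_0$ and all $t_0\ge0$, every solution with $\bar q(t_0)\in\mathcal S$ and $\|\bar q(t_0)-q^*\|<\delta$ exists for all $t\ge t_0$ and satisfies $\|\bar q(t)-q^*\|<\varepsilon$ for all $t\ge t_0+t_f$. *)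

theory Defs
  imports "HOL-Analysis.Analysis"
begin

text \<open>Twice continuous differentiability, meant for open sets.\<close>

definition C2_on :: "('a::real_normed_vector \<Rightarrow> 'b::real_normed_vector) \<Rightarrow> 'a set \<Rightarrow> bool" where
  "C2_on f S \<longleftrightarrow>
    (\<exists>(f' :: 'a \<Rightarrow> 'a \<Rightarrow>\<^sub>L 'b) (f'' :: 'a \<Rightarrow> 'a \<Rightarrow>\<^sub>L 'a \<Rightarrow>\<^sub>L 'b).
      (\<forall>x\<in>S. (f has_derivative blinfun_apply (f' x)) (at x)) \<and>
      (\<forall>x\<in>S. (f' has_derivative blinfun_apply (f'' x)) (at x)) \<and>
      continuous_on S f'')"

definition lie_bracket :: "(real \<Rightarrow> real) \<Rightarrow> (real \<Rightarrow> real) \<Rightarrow> real \<Rightarrow> real" where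
  "lie_bracket f g y = f y * deriv g y - deriv f y * g y"


definition third_order_resonance :: "'s set \<Rightarrow> ('s \<Rightarrow> nat) \<Rightarrow> ('s \<Rightarrow> int) \<Rightarrow> bool" where
  "third_order_resonance A \<Lambda> m \<longleftrightarrow>
    (\<Sum>s\<in>A. m s * int (\<Lambda> s)) = 0 \<and> (\<exists>s\<in>A. m s \<noteq> 0) \<and> (\<Sum>s\<in>A. \<bar>m s\<bar>) = 3"

text \<open>
  The frequencies are indexed by pairs \<open>(i, s)\<close> with \<open>s \<in> {1..4}\<close>. The coefficients of
  the relations \<open>\<nu> i 3 = \<nu> i 1 + \<nu> i 2\<close> and \<open>\<nu> i 4 = \<nu> i 2 - \<nu> i 1\<close>, with all terms
  brought to one side, are determined up to a common sign \<open>c\<close>.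
\<close>

definition imposed_relation :: "('n \<times> nat \<Rightarrow> int) \<Rightarrow> bool" where
  "imposed_relation m \<longleftrightarrow>
    (\<exists>i. \<exists>c\<in>{1, -1}. \<forall>p \<in> UNIV \<times> {1..4}.
       m p = (if p = (i, 3) then c else if p \<in> {(i, 1), (i, 2)} then - c else 0)) \<or>
    (\<exists>i. \<exists>c\<in>{1, -1}. \<forall>p \<in> UNIV \<times> {1..4}.
       m p = (if p \<in> {(i, 4), (i, 1)} then c else if p = (i, 2) then - c else 0))"

definition non_resonant :: "('n::finite \<Rightarrow> nat) \<Rightarrow> ('n \<Rightarrow> nat \<Rightarrow> nat) \<Rightarrow> bool" where
  "non_resonant \<kappa> \<nu> \<longleftrightarrow>
    inj \<kappa> \<and> inj_on (\<lambda>(i, s). \<nu> i s) (UNIV \<times> {1..4}) \<and>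
    (\<forall>i j. \<forall>s\<in>{1..4}. \<kappa> i \<noteq> \<nu> j s) \<and>
    (\<forall>m. third_order_resonance (UNIV \<times> {1..4}) (\<lambda>(i, s). \<nu> i s) m \<longrightarrow> imposed_relation m)"


definition solves_on ::
    "(real \<Rightarrow> 'a \<Rightarrow> 'a::real_normed_vector) \<Rightarrow> 'a set \<Rightarrow> real set \<Rightarrow> (real \<Rightarrow> 'a) \<Rightarrow> bool" where
  "solves_on F \<Omega> I q \<longleftrightarrow>
    (\<forall>t\<in>I. q t \<in> \<Omega> \<and> (q has_vector_derivative F t (q t)) (at t within I))"

text \<open>
  All solutions through \<open>(t0, q0)\<close> exist for all later times and satisfy \<open>P\<close>: there is a
  solution on \<open>[t0, \<infinity>)\<close>, each solution on some \<open>[t0, T)\<close> extends to one on \<open>[t0, \<infinity>)\<close>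
  (no finite escape time, no exit from \<open>\<Omega>\<close>), and each solution on \<open>[t0, \<infinity>)\<close> satisfies \<open>P\<close>.
\<close>

definition all_solutions ::
    "(real \<Rightarrow> 'a \<Rightarrow> 'a::real_normed_vector) \<Rightarrow> 'a set \<Rightarrow> real \<Rightarrow> 'a \<Rightarrow> ((real \<Rightarrow> 'a) \<Rightarrow> bool) \<Rightarrow> bool"
  where
  "all_solutions F \<Omega> t0 q0 P \<longleftrightarrow>
    (\<exists>q. solves_on F \<Omega> {t0..} q \<and> q t0 = q0) \<and>
    (\<forall>T p. t0 < T \<and> solves_on F \<Omega> {t0..<T} p \<and> p t0 = q0 \<longrightarrow>
       (\<exists>q. solves_on F \<Omega> {t0..} q \<and> (\<forall>t\<in>{t0..<T}. q t = p t))) \<and>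
    (\<forall>q. solves_on F \<Omega> {t0..} q \<and> q t0 = q0 \<longrightarrow> P q)"

text \<open>
  In the following, \<open>F \<omega> t q\<close> is a family of vector fields with parameter \<open>\<omega>\<close>, considered
  for \<open>q \<in> \<Omega>\<close>; initial values are restricted to \<open>S\<close>.
\<close>

definition practically_uniformly_stable ::
    "(real \<Rightarrow> real \<Rightarrow> 'a \<Rightarrow> 'a::real_normed_vector) \<Rightarrow> 'a set \<Rightarrow> 'a set \<Rightarrow> 'a \<Rightarrow> bool" where
  "practically_uniformly_stable F \<Omega> S qs \<longleftrightarrow>
    (\<forall>\<epsilon>>0. \<exists>\<delta>>0. \<exists>\<omega>0>0. \<forall>\<omega>>\<omega>0. \<forall>t0\<ge>0. \<forall>q0 \<in> \<Omega> \<inter> S. norm (q0 - qs) < \<delta> \<longrightarrow>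
       all_solutions (F \<omega>) \<Omega> t0 q0 (\<lambda>q. \<forall>t\<ge>t0. norm (q t - qs) < \<epsilon>))"

definition practically_uniformly_attractive ::
    "(real \<Rightarrow> real \<Rightarrow> 'a \<Rightarrow> 'a::real_normed_vector) \<Rightarrow> 'a set \<Rightarrow> 'a set \<Rightarrow> 'a \<Rightarrow> bool" where
  "practically_uniformly_attractive F \<Omega> S qs \<longleftrightarrow>
    (\<exists>\<delta>>0. \<forall>\<epsilon>>0. \<exists>tf\<ge>0. \<exists>\<omega>0>0. \<forall>\<omega>>\<omega>0. \<forall>t0\<ge>0. \<forall>q0 \<in> \<Omega> \<inter> S. norm (q0 - qs) < \<delta> \<longrightarrow>
       all_solutions (F \<omega>) \<Omega> t0 q0 (\<lambda>q. \<forall>t\<ge>t0 + tf. norm (q t - qs) < \<epsilon>))"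

definition practically_uniformly_asymptotically_stable ::
    "(real \<Rightarrow> real \<Rightarrow> 'a \<Rightarrow> 'a::real_normed_vector) \<Rightarrow> 'a set \<Rightarrow> 'a set \<Rightarrow> 'a \<Rightarrow> bool" where
  "practically_uniformly_asymptotically_stable F \<Omega> S qs \<longleftrightarrow>
    practically_uniformly_stable F \<Omega> S qs \<and> practically_uniformly_attractive F \<Omega> S qs"


definition es_field ::
    "(real^'n \<Rightarrow> real) \<Rightarrow> (real \<Rightarrow> real) \<Rightarrow> (real \<Rightarrow> real) \<Rightarrow> (real \<Rightarrow> real) \<Rightarrow> (real \<Rightarrow> real) \<Rightarrow>
     real \<Rightarrow> ('n \<Rightarrow> real) \<Rightarrow> ('n \<Rightarrow> real) \<Rightarrow> ('n \<Rightarrow> nat) \<Rightarrow> ('n \<Rightarrow> nat \<Rightarrow> nat) \<Rightarrow>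
     real \<Rightarrow> real \<Rightarrow> (real^'n) \<times> (real^'n) \<Rightarrow> (real^'n) \<times> (real^'n)" where
  "es_field J \<phi>1 \<phi>2 \<psi>1 \<psi>2 \<epsilon> \<alpha> \<beta> \<kappa> \<nu> \<omega> t = (\<lambda>(x, v).
    (\<chi> i. sqrt (2 * \<alpha> i * real (\<kappa> i) * \<omega>) *
            (\<phi>1 (J x / sqrt (v $ i + \<epsilon>)) * cos (real (\<kappa> i) * \<omega> * t) +
             \<phi>2 (J x / sqrt (v $ i + \<epsilon>)) * sin (real (\<kappa> i) * \<omega> * t)) +
          sqrt (4 * \<beta> i * ((real (\<nu> i 2))\<^sup>2 - (real (\<nu> i 1))\<^sup>2)) * \<omega> powr (2 / 3) *
            (\<psi>1 (J x) * cos (real (\<nu> i 1) * \<omega> * t) +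
             \<psi>2 (J x) * sin (real (\<nu> i 2) * \<omega> * t)),
     \<chi> i. - \<beta> i * v $ i +
          \<omega> powr (2 / 3) * J x * cos (real (\<nu> i 1) * \<omega> * t) * sin (real (\<nu> i 2) * \<omega> * t)))"

end

theory Submission
  imports Defs
begin

text \<open>
  With \<open>\<mu> = \<omega> powr (- 1 / 6)\<close> and \<open>\<tau> = \<omega> * t\<close> the system becomes
  \<open>z' = (\<Sum>a. \<mu> ^ p a * u a \<tau> *\<^sub>R g a z)\<close> with \<open>p a \<in> {2, 3, 6}\<close> and \<open>2 * pi\<close>-periodic
  trigonometric \<open>u a\<close>. Over one period every coordinate is expanded by repeated integration by parts
  along the solution. Non-resonance makes all terms of order below \<open>\<mu> ^ 6\<close> vanish, and at order
  \<open>\<mu> ^ 6\<close> only the brackets \<open>[\<phi>1, \<phi>2]\<close> and \<open>[\<psi>1, \<psi>2]\<close> survive: up to a \<open>o(\<mu> ^ 6)\<close> error that is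
  uniform on compact sets, the increment over a period is that of
  \<open>x\<^sub>i' = - \<alpha>\<^sub>i * \<partial>\<^sub>iJ / sqrt (v\<^sub>i + \<epsilon>)\<close>, \<open>v\<^sub>i' = - \<beta>\<^sub>i * v\<^sub>i + \<beta>\<^sub>i * (\<partial>\<^sub>iJ)\<^sup>2\<close>. The vector fields are only
  twice differentiable, so the expansion is applied to the coordinates and not to the Lyapunov
  function \<open>M * (J x - J xs) + v \<bullet> v\<close>, which decreases strictly along the averaged field near
  \<open>(xs, 0)\<close> for large \<open>M\<close>; hence it decreases from period to period outside any given
  neighbourhood of \<open>(xs, 0)\<close> when \<open>\<omega>\<close> is large.
\<close>

section \<open>Repeated directional differentiability\<close>

text \<open>The exponent 1/6 makes all rates integer powers: \<open>\<omega> powr (2 / 3)\<close>,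
  \<open>sqrt \<omega>\<close> and 1 are \<open>\<omega>\<close> times \<open>\<mu> ^ 2\<close>,
  \<open>\<mu> ^ 3\<close> and \<open>\<mu> ^ 6\<close>. Power 6 is reached by the drift alone, by
  two fields of power 3, or by three fields of power 2; so a field is differentiated at most twice
  before the observable is frozen by mere continuity, exactly what C2 data permit. The
  \<open>\<psi>\<close> fields act through triples: \<open>J / 2\<close>, the amplitude in the
  \<open>v\<close> equation, is differentiated along both of them. This creates a second derivative
  of \<open>J\<close>, which cancels because the two orders of differentiation get opposite weights;
  what remains is the bracket times the squared partial derivative. In the derivative of the
  Lyapunov function the only term without a sign is \<open>2 * \<beta> * v * p\<^sup>2\<close> with
  \<open>p\<close> a partial derivative of \<open>J\<close>. It is absorbed by the damping of
  \<open>v\<close> and, the gradient being bounded on a ball, by a large multiple \<open>M\<close>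
  of the gradient term. Stability speaks of all solutions in an open set, including their existence.
  The estimates are therefore made for a globally Lipschitz extension of the field and then
  transferred by uniqueness.\<close>

primrec Ck_on :: "nat \<Rightarrow> ('a::real_normed_vector \<Rightarrow> real) \<Rightarrow> 'a set \<Rightarrow> bool" where
  "Ck_on 0 f S \<longleftrightarrow> continuous_on S f"
| "Ck_on (Suc k) f S \<longleftrightarrow>
    (\<exists>f'. (\<forall>x\<in>S. (f has_derivative f' x) (at x)) \<and> (\<forall>v. Ck_on k (\<lambda>x. f' x v) S))"

declare Ck_on.simps(2) [simp del]

lemma Ck_on_SucI:
  assumes "\<And>x. x \<in> S \<Longrightarrow> (f has_derivative f' x) (at x)" "\<And>v. Ck_on k (\<lambda>x. f' x v) S"
  shows "Ck_on (Suc k) f S"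
  using assms by (auto simp: Ck_on.simps(2))

lemma Ck_on_SucE:
  assumes "Ck_on (Suc k) f S"
  obtains f' where "\<And>x. x \<in> S \<Longrightarrow> (f has_derivative f' x) (at x)" "\<And>v. Ck_on k (\<lambda>x. f' x v) S"
  using assms by (auto simp: Ck_on.simps(2))

lemma Ck_on_Suc_imp: "Ck_on (Suc k) f S \<Longrightarrow> Ck_on k f S"
proof (induction k arbitrary: f)
  case 0
  then show ?case
    by (auto intro!: continuous_at_imp_continuous_on has_derivative_continuous elim!: Ck_on_SucE)
next
  case (Suc k)
  from Suc.prems obtain f' where "\<And>x. x \<in> S \<Longrightarrow> (f has_derivative f' x) (at x)"
      "\<And>v. Ck_on (Suc k) (\<lambda>x. f' x v) S"
    by (rule Ck_on_SucE) blast
  then show ?case using Suc.IH by (intro Ck_on_SucI) auto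
qed

lemma Ck_on_imp_continuous_on: "Ck_on k f S \<Longrightarrow> continuous_on S f"
proof (induction k)
  case (Suc k)
  then show ?case using Ck_on_Suc_imp by blast
qed simp

lemma Ck_on_cong:
  assumes "open S" "\<And>x. x \<in> S \<Longrightarrow> f x = g x" "Ck_on k f S"
  shows "Ck_on k g S"
  using assms(2,3)
proof (induction k arbitrary: f g)
  case 0
  then show ?case using continuous_on_cong by (metis Ck_on.simps(1))
next
  case (Suc k)
  from Suc.prems(2) obtain f' where f': "\<And>x. x \<in> S \<Longrightarrow> (f has_derivative f' x) (at x)"
      "\<And>v. Ck_on k (\<lambda>x. f' x v) S"
    by (rule Ck_on_SucE) blast
  show ?case
  proof (rule Ck_on_SucI)
    show "(g has_derivative f' x) (at x)" if "x \<in> S" for x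
      using has_derivative_transform_within_open[OF f'(1)[OF that] assms(1) that] Suc.prems(1) by blast
  qed (use f' in auto)
qed

lemma Ck_on_const: "Ck_on k (\<lambda>x. c) S"
proof (induction k arbitrary: c)
  case (Suc k)
  show ?case by (rule Ck_on_SucI[where f' = "\<lambda>_ _. 0"]) (use Suc in auto)
qed simp

lemma Ck_on_linear: "bounded_linear f \<Longrightarrow> Ck_on k f S"
proof (cases k)
  case (Suc k')
  assume "bounded_linear f"
  then show ?thesis unfolding Suc
    by (intro Ck_on_SucI[where f' = "\<lambda>_. f"]) (auto intro: bounded_linear_imp_has_derivative Ck_on_const)
qed (auto intro: linear_continuous_on)

lemma Ck_on_add: "Ck_on k f S \<Longrightarrow> Ck_on k g S \<Longrightarrow> Ck_on k (\<lambda>x. f x + g x) S"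
proof (induction k arbitrary: f g)
  case (Suc k)
  from Suc.prems(1) obtain f' where f': "\<And>x. x \<in> S \<Longrightarrow> (f has_derivative f' x) (at x)"
      "\<And>v. Ck_on k (\<lambda>x. f' x v) S"
    by (rule Ck_on_SucE) blast
  from Suc.prems(2) obtain g' where g': "\<And>x. x \<in> S \<Longrightarrow> (g has_derivative g' x) (at x)"
      "\<And>v. Ck_on k (\<lambda>x. g' x v) S"
    by (rule Ck_on_SucE) blast
  show ?case
    by (rule Ck_on_SucI[where f' = "\<lambda>x v. f' x v + g' x v"])
      (use f' g' Suc.IH in \<open>auto intro!: has_derivative_add\<close>)
qed (auto intro: continuous_intros)

lemma Ck_on_sum: "(\<And>i. i \<in> I \<Longrightarrow> Ck_on k (f i) S) \<Longrightarrow> Ck_on k (\<lambda>x. \<Sum>i\<in>I. f i x) S"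
  by (induction I rule: infinite_finite_induct) (auto intro: Ck_on_add Ck_on_const)

lemma Ck_on_mult: "Ck_on k f S \<Longrightarrow> Ck_on k g S \<Longrightarrow> Ck_on k (\<lambda>x. f x * g x) S"
proof (induction k arbitrary: f g)
  case (Suc k)
  from Suc.prems(1) obtain f' where f': "\<And>x. x \<in> S \<Longrightarrow> (f has_derivative f' x) (at x)"
      "\<And>v. Ck_on k (\<lambda>x. f' x v) S"
    by (rule Ck_on_SucE) blast
  from Suc.prems(2) obtain g' where g': "\<And>x. x \<in> S \<Longrightarrow> (g has_derivative g' x) (at x)"
      "\<And>v. Ck_on k (\<lambda>x. g' x v) S"
    by (rule Ck_on_SucE) blast
  show ?case
  proof (rule Ck_on_SucI[where f' = "\<lambda>x v. f x * g' x v + f' x v * g x"])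
    show "((\<lambda>x. f x * g x) has_derivative (\<lambda>v. f x * g' x v + f' x v * g x)) (at x)" if "x \<in> S" for x
      using f' g' that by (auto intro!: has_derivative_mult)
    show "Ck_on k (\<lambda>x. f x * g' x v + f' x v * g x) S" for v
      using f' g' Suc Ck_on_Suc_imp by (intro Ck_on_add Suc.IH) auto
  qed
qed (auto intro: continuous_intros)

lemma Ck_on_compose_real:
  fixes \<phi> :: "real \<Rightarrow> real"
  shows "Ck_on k \<phi> U \<Longrightarrow> Ck_on k f S \<Longrightarrow> f ` S \<subseteq> U \<Longrightarrow> Ck_on k (\<lambda>x. \<phi> (f x)) S"
proof (induction k arbitrary: f \<phi>)
  case 0
  then show ?case using continuous_on_compose2[of U \<phi> S f] by simp
next
  case (Suc k)
  from Suc.prems(1) obtain \<phi>' where \<phi>': "\<And>x. x \<in> U \<Longrightarrow> (\<phi> has_derivative \<phi>' x) (at x)"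
      "\<And>v. Ck_on k (\<lambda>x. \<phi>' x v) U"
    by (rule Ck_on_SucE) blast
  from Suc.prems(2) obtain f' where f': "\<And>x. x \<in> S \<Longrightarrow> (f has_derivative f' x) (at x)"
      "\<And>v. Ck_on k (\<lambda>x. f' x v) S"
    by (rule Ck_on_SucE) blast
  show ?case
  \<comment> \<open>By linearity \<open>\<phi>' (f x) (f' x v)\<close> is a multiple of the value in
    direction 1. The direction of the outer derivative is then fixed, as the induction hypothesis
    demands.\<close>
  proof (rule Ck_on_SucI[where f' = "\<lambda>x v. f' x v * \<phi>' (f x) 1"])
    show "((\<lambda>x. \<phi> (f x)) has_derivative (\<lambda>v. f' x v * \<phi>' (f x) 1)) (at x)" if "x \<in> S" for x
    proof -
      have d: "(\<phi> has_derivative \<phi>' (f x)) (at (f x))" using \<phi>' that Suc.prems by auto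
      have "(\<lambda>v. \<phi>' (f x) (f' x v)) = (\<lambda>v. f' x v * \<phi>' (f x) 1)"
        by (rule ext, rule linear_scale[OF has_derivative_linear[OF d], of _ 1,
              unfolded real_scaleR_def mult_1_right])
      then show ?thesis
        by (rule has_derivative_eq_rhs[OF has_derivative_compose[OF f'(1)[OF that] d]])
    qed
    show "Ck_on k (\<lambda>x. f' x v * \<phi>' (f x) 1) S" for v
      by (rule Ck_on_mult[OF f'(2) Suc.IH[OF \<phi>'(2) Ck_on_Suc_imp[OF Suc.prems(2)] Suc.prems(3)]])
  qed
qed

lemma Ck_on_compose_linear:
  shows "Ck_on k f U \<Longrightarrow> bounded_linear L \<Longrightarrow> L ` S \<subseteq> U \<Longrightarrow> Ck_on k (\<lambda>x. f (L x)) S"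
proof (induction k arbitrary: f)
  case 0
  then show ?case using continuous_on_compose2[of U f S L] linear_continuous_on by auto
next
  case (Suc k)
  from Suc.prems(1) obtain f' where f': "\<And>x. x \<in> U \<Longrightarrow> (f has_derivative f' x) (at x)"
      "\<And>v. Ck_on k (\<lambda>x. f' x v) U"
    by (rule Ck_on_SucE) blast
  show ?case
  proof (rule Ck_on_SucI[where f' = "\<lambda>x v. f' (L x) (L v)"])
    show "((\<lambda>x. f (L x)) has_derivative (\<lambda>v. f' (L x) (L v))) (at x)" if "x \<in> S" for x
      using has_derivative_compose[OF bounded_linear_imp_has_derivative[OF Suc.prems(2)] f'(1)]
        that Suc.prems(3) by blast
    show "Ck_on k (\<lambda>x. f' (L x) (L v)) S" for v
      using Suc.IH[OF f'(2)] Suc.prems by blast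
  qed
qed

lemma Ck_on_powr: "Ck_on k (\<lambda>s::real. s powr a) {0<..}"
proof (induction k arbitrary: a)
  case 0
  then show ?case by (auto intro!: continuous_intros)
next
  case (Suc k)
  show ?case
  proof (rule Ck_on_SucI[where f' = "\<lambda>s v. v * (a * s powr (a - 1))"])
    show "((\<lambda>s. s powr a) has_derivative (\<lambda>v. v * (a * s powr (a - 1)))) (at s)" if "s \<in> {0<..}" for s
      using that has_real_derivative_powr[of s a] has_derivative_eq_rhs
      by (fastforce simp: has_field_derivative_def fun_eq_iff)
  qed (intro Ck_on_mult Ck_on_const Suc)
qed

text \<open>Evaluating the operator-valued derivatives at fixed directions leaves scalar functions
  only. In this form sums, products and compositions are handled by plain induction on the
  order.\<close>

lemma C2_on_imp_Ck_on:
  fixes f :: "'a::real_normed_vector \<Rightarrow> real"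
  assumes "C2_on f S"
  shows "Ck_on 2 f S"
proof -
  obtain f' :: "'a \<Rightarrow> 'a \<Rightarrow>\<^sub>L real" and f'' :: "'a \<Rightarrow> 'a \<Rightarrow>\<^sub>L 'a \<Rightarrow>\<^sub>L real"
    where f: "\<And>x. x \<in> S \<Longrightarrow> (f has_derivative blinfun_apply (f' x)) (at x)"
      "\<And>x. x \<in> S \<Longrightarrow> (f' has_derivative blinfun_apply (f'' x)) (at x)" "continuous_on S f''"
    using assms unfolding C2_on_def by blast
  have "Ck_on (Suc (Suc 0)) f S"
  proof (rule Ck_on_SucI[where f' = "\<lambda>x v. blinfun_apply (f' x) v"])
    show "(f has_derivative blinfun_apply (f' x)) (at x)" if "x \<in> S" for x
      by (rule f(1)[OF that])
    fix v
    show "Ck_on (Suc 0) (\<lambda>x. blinfun_apply (f' x) v) S"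
    proof (rule Ck_on_SucI[where f' = "\<lambda>x w. blinfun_apply (blinfun_apply (f'' x) w) v"])
      show "((\<lambda>x. blinfun_apply (f' x) v) has_derivative (\<lambda>w. blinfun_apply (blinfun_apply (f'' x) w) v)) (at x)"
        if "x \<in> S" for x
        using f(2)[OF that] by (auto intro!: derivative_eq_intros)
      show "Ck_on 0 (\<lambda>x. blinfun_apply (blinfun_apply (f'' x) w) v) S" for w
        using f(3) by (auto intro!: continuous_intros)
    qed
  qed
  then show ?thesis by (simp add: numeral_2_eq_2)
qed

section \<open>Derivatives along vector fields\<close>

definition lie :: "('a::real_normed_vector \<Rightarrow> 'a) \<Rightarrow> ('a \<Rightarrow> real) \<Rightarrow> 'a \<Rightarrow> real" where
  "lie g h z = frechet_derivative h (at z) (g z)"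

lemma lie_eq: "(h has_derivative h') (at z) \<Longrightarrow> lie g h z = h' (g z)"
  by (simp add: lie_def frechet_derivative_at[symmetric])

lemma Ck_on_has_derivative:
  "Ck_on (Suc k) h S \<Longrightarrow> z \<in> S \<Longrightarrow> (h has_derivative frechet_derivative h (at z)) (at z)"
  by (metis Ck_on_SucE differentiable_def frechet_derivative_works)

lemma Ck_on_frechet_derivative:
  assumes "open S" "Ck_on (Suc k) h S"
  shows "Ck_on k (\<lambda>z. frechet_derivative h (at z) v) S"
proof -
  from assms(2) obtain h' where h': "\<And>x. x \<in> S \<Longrightarrow> (h has_derivative h' x) (at x)"
      "\<And>v. Ck_on k (\<lambda>x. h' x v) S"
    by (rule Ck_on_SucE) blast
  show ?thesis
    by (rule Ck_on_cong[OF assms(1) _ h'(2)[of v]]) (simp add: frechet_derivative_at[OF h'(1)])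
qed

text \<open>The direction \<open>g z\<close> moves with \<open>z\<close>, so it is expanded in the
  basis: each summand is a component of \<open>g\<close> times a derivative in a fixed direction.
  One order of \<open>h\<close> is lost, none of \<open>g\<close>.\<close>

lemma Ck_on_lie:
  fixes g :: "'a::euclidean_space \<Rightarrow> 'a"
  assumes "open S" "Ck_on (Suc k) h S" "\<And>e. e \<in> Basis \<Longrightarrow> Ck_on k (\<lambda>z. g z \<bullet> e) S"
  shows "Ck_on k (lie g h) S"
proof (rule Ck_on_cong[OF assms(1)])
  show "(\<Sum>e\<in>Basis. (g z \<bullet> e) * frechet_derivative h (at z) e) = lie g h z" if "z \<in> S" for z
  proof -
    interpret linear "frechet_derivative h (at z)"
      using Ck_on_has_derivative[OF assms(2) that] by (rule has_derivative_linear)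
    have "frechet_derivative h (at z) (g z) = frechet_derivative h (at z) (\<Sum>e\<in>Basis. (g z \<bullet> e) *\<^sub>R e)"
      by (simp add: euclidean_representation)
    then show ?thesis by (simp add: lie_def sum scale)
  qed
qed (intro Ck_on_sum Ck_on_mult assms Ck_on_frechet_derivative)

lemma Ck_on_imp_lipschitz:
  fixes h :: "'a::euclidean_space \<Rightarrow> real"
  assumes "open S" "Ck_on (Suc k) h S" "compact K" "convex K" "K \<subseteq> S"
  obtains L where "0 \<le> L" "\<And>x y. x \<in> K \<Longrightarrow> y \<in> K \<Longrightarrow> \<bar>h x - h y\<bar> \<le> L * norm (x - y)"
proof -
  \<comment> \<open>The sum of the absolute partial derivatives is continuous, hence bounded on
    \<open>K\<close>, and it dominates the operator norm.\<close>
  define B where "B z = (\<Sum>e\<in>Basis. \<bar>frechet_derivative h (at z) e\<bar>)" for z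
  have "continuous_on K B"
    unfolding B_def using Ck_on_imp_continuous_on[OF Ck_on_frechet_derivative[OF assms(1,2)]]
    by (intro continuous_intros continuous_on_subset[OF _ assms(5)])
  then have "bounded (B ` K)" using assms(3) compact_continuous_image compact_imp_bounded by blast
  then obtain L where L: "L > 0" "\<And>z. z \<in> K \<Longrightarrow> B z \<le> L"
    unfolding bounded_pos by (force simp: abs_le_iff)
  have *: "onorm (frechet_derivative h (at z)) \<le> L" if "z \<in> K" for z
  proof (rule onorm_bound)
    fix v
    interpret linear "frechet_derivative h (at z)"
      using Ck_on_has_derivative[OF assms(2)] that assms(5) by (blast intro: has_derivative_linear)
    have "frechet_derivative h (at z) v = frechet_derivative h (at z) (\<Sum>e\<in>Basis. (v \<bullet> e) *\<^sub>R e)"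
      by (simp add: euclidean_representation)
    also have "\<dots> = (\<Sum>e\<in>Basis. (v \<bullet> e) * frechet_derivative h (at z) e)"
      by (simp add: sum scale)
    also have "\<bar>\<dots>\<bar> \<le> (\<Sum>e\<in>Basis. norm v * \<bar>frechet_derivative h (at z) e\<bar>)"
      by (rule order_trans[OF sum_abs], rule sum_mono)
        (auto simp: abs_mult Basis_le_norm intro!: mult_right_mono)
    also have "\<dots> = B z * norm v" by (simp add: B_def sum_distrib_left mult.commute)
    also have "\<dots> \<le> L * norm v" using L that by (intro mult_right_mono) auto
    finally show "norm (frechet_derivative h (at z) v) \<le> L * norm v" by simp
  qed (use L in auto)
  have "\<bar>h x - h y\<bar> \<le> L * norm (x - y)" if "x \<in> K" "y \<in> K" for x y
  proof -
    have "norm (h x - h y) \<le> L * norm (x - y)"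
      using assms(5) that Ck_on_has_derivative[OF assms(2)]
      by (intro differentiable_bound[where f' = "\<lambda>z. frechet_derivative h (at z)", OF assms(4) _ * that])
        (auto intro: has_derivative_at_withinI)
    then show ?thesis by simp
  qed
  then show thesis using L(1) by (intro that[of L]) auto
qed

section \<open>Averaging over one period\<close>

definition mean :: "(real \<Rightarrow> real \<Rightarrow> real) \<Rightarrow> real \<Rightarrow> real" where
  "mean w \<tau>0 = integral {\<tau>0..\<tau>0 + 2 * pi} (w \<tau>0)"

definition prim :: "(real \<Rightarrow> real \<Rightarrow> real) \<Rightarrow> real \<Rightarrow> real \<Rightarrow> real" where
  "prim w \<tau>0 \<tau> = integral {\<tau>0..\<tau>} (w \<tau>0)"

text \<open>The first argument is the start of the period. Primitives are normalised to vanish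
  there, so iterated weights depend on it; the bound is uniform in it because all limits have to be
  uniform in the initial time.\<close>

definition weight :: "(real \<Rightarrow> real \<Rightarrow> real) \<Rightarrow> bool" where
  "weight w \<longleftrightarrow> (\<forall>\<tau>0. continuous_on {\<tau>0..\<tau>0 + 2 * pi} (w \<tau>0)) \<and>
     (\<exists>M\<ge>0. \<forall>\<tau>0. \<forall>\<tau>\<in>{\<tau>0..\<tau>0 + 2 * pi}. \<bar>w \<tau>0 \<tau>\<bar> \<le> M)"

lemma weightE:
  assumes "weight w"
  obtains M where "M \<ge> 0" "\<And>\<tau>0 \<tau>. \<tau> \<in> {\<tau>0..\<tau>0 + 2 * pi} \<Longrightarrow> \<bar>w \<tau>0 \<tau>\<bar> \<le> M"
  using assms by (auto simp: weight_def)

lemma weight_continuous: "weight w \<Longrightarrow> continuous_on {\<tau>0..\<tau>0 + 2 * pi} (w \<tau>0)"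
  by (simp add: weight_def)

lemma weight_mult:
  assumes "weight w" "weight v"
  shows "weight (\<lambda>\<tau>0 \<tau>. w \<tau>0 \<tau> * v \<tau>0 \<tau>)"
proof -
  obtain M where M: "M \<ge> 0" "\<And>\<tau>0 \<tau>. \<tau> \<in> {\<tau>0..\<tau>0 + 2 * pi} \<Longrightarrow> \<bar>w \<tau>0 \<tau>\<bar> \<le> M"
    by (rule weightE[OF assms(1)]) blast
  obtain N where N: "N \<ge> 0" "\<And>\<tau>0 \<tau>. \<tau> \<in> {\<tau>0..\<tau>0 + 2 * pi} \<Longrightarrow> \<bar>v \<tau>0 \<tau>\<bar> \<le> N"
    by (rule weightE[OF assms(2)]) blast
  have "\<bar>w \<tau>0 \<tau> * v \<tau>0 \<tau>\<bar> \<le> M * N" if "\<tau> \<in> {\<tau>0..\<tau>0 + 2 * pi}" for \<tau>0 \<tau>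
    unfolding abs_mult using M N that by (intro mult_mono) auto
  moreover have "0 \<le> M * N" using M N by simp
  ultimately show ?thesis
    unfolding weight_def using assms by (blast intro: continuous_on_mult weight_continuous)
qed

lemma prim_has_derivative:
  assumes "weight w" "\<tau> \<in> {\<tau>0..\<tau>0 + 2 * pi}"
  shows "(prim w \<tau>0 has_real_derivative w \<tau>0 \<tau>) (at \<tau> within {\<tau>0..\<tau>0 + 2 * pi})"
  unfolding prim_def
  using integral_has_real_derivative[OF weight_continuous[OF assms(1)] assms(2)] .

lemma weight_prim:
  assumes "weight w"
  shows "weight (prim w)"
  unfolding weight_def
proof (intro conjI allI)
  show "continuous_on {\<tau>0..\<tau>0 + 2 * pi} (prim w \<tau>0)" for \<tau>0
    using prim_has_derivative[OF assms] by (blast intro: DERIV_continuous_on)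
  obtain M where M: "M \<ge> 0" "\<And>\<tau>0 \<tau>. \<tau> \<in> {\<tau>0..\<tau>0 + 2 * pi} \<Longrightarrow> \<bar>w \<tau>0 \<tau>\<bar> \<le> M"
    by (rule weightE[OF assms]) blast
  have "\<bar>prim w \<tau>0 \<tau>\<bar> \<le> M * (2 * pi)" if "\<tau> \<in> {\<tau>0..\<tau>0 + 2 * pi}" for \<tau>0 \<tau>
  proof -
    have "norm (integral {\<tau>0..\<tau>} (w \<tau>0)) \<le> M * (\<tau> - \<tau>0)"
      using that M by (intro integral_bound continuous_on_subset[OF weight_continuous[OF assms]]) auto
    also have "\<dots> \<le> M * (2 * pi)" using that M by (intro mult_left_mono) auto
    finally show ?thesis by (simp add: prim_def)
  qed
  then show "\<exists>N\<ge>0. \<forall>\<tau>0. \<forall>\<tau>\<in>{\<tau>0..\<tau>0 + 2 * pi}. \<bar>prim w \<tau>0 \<tau>\<bar> \<le> N"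
    using M(1) by (intro exI[of _ "M * (2 * pi)"]) auto
qed

lemma prim_start [simp]: "prim w \<tau>0 \<tau>0 = 0"
  by (simp add: prim_def)

lemma prim_end: "prim w \<tau>0 (\<tau>0 + 2 * pi) = mean w \<tau>0"
  by (simp add: prim_def mean_def)

section \<open>Systems with oscillating coefficients in fast time\<close>

locale oscillating_system =
  fixes I :: "'i set" and p :: "'i \<Rightarrow> nat" and u :: "'i \<Rightarrow> real \<Rightarrow> real"
    and g :: "'i \<Rightarrow> 'a::euclidean_space \<Rightarrow> 'a" and \<Omega> K :: "'a set"
  assumes finite_I: "finite I" and open_\<Omega>: "open \<Omega>" and compact_K: "compact K" and K_sub: "K \<subseteq> \<Omega>"
    and p: "\<And>a. a \<in> I \<Longrightarrow> p a \<in> {2, 3, 6}"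
    and u_cont: "\<And>a. a \<in> I \<Longrightarrow> continuous_on UNIV (u a)"
    and u_le: "\<And>a t. a \<in> I \<Longrightarrow> \<bar>u a t\<bar> \<le> 1"
    and g_Ck: "\<And>a e. a \<in> I \<Longrightarrow> e \<in> Basis \<Longrightarrow> Ck_on 2 (\<lambda>z. g a z \<bullet> e) \<Omega>"
begin

definition osc_field :: "real \<Rightarrow> real \<Rightarrow> 'a \<Rightarrow> 'a" where
  "osc_field \<mu> \<tau> z = (\<Sum>a\<in>I. (\<mu> ^ p a * u a \<tau>) *\<^sub>R g a z)"

definition sol :: "real \<Rightarrow> real \<Rightarrow> (real \<Rightarrow> 'a) \<Rightarrow> bool" where
  "sol \<mu> \<tau>0 z \<longleftrightarrow> solves_on (osc_field \<mu>) K {\<tau>0..\<tau>0 + 2 * pi} z"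

text \<open>The limit of slow motion, uniformly in the initial time and in the solution.\<close>

definition slow :: "(real \<times> real \<times> (real \<Rightarrow> 'a)) filter" where
  "slow = inf (filtercomap fst (at_right 0)) (principal {(\<mu>, \<tau>0, z). sol \<mu> \<tau>0 z})"

lemma eventually_slow:
  "eventually P slow \<longleftrightarrow>
    (\<exists>\<mu>0>0. \<forall>\<mu> \<tau>0 z. 0 < \<mu> \<and> \<mu> < \<mu>0 \<and> sol \<mu> \<tau>0 z \<longrightarrow> P (\<mu>, \<tau>0, z))"
proof
  assume "eventually P slow"
  then obtain Q where Q: "eventually Q (at_right 0)" "\<And>x. Q (fst x) \<Longrightarrow> x \<in> {(\<mu>, \<tau>0, z). sol \<mu> \<tau>0 z} \<Longrightarrow> P x"
    unfolding slow_def eventually_inf_principal eventually_filtercomap by blast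
  then obtain \<mu>0 where "\<mu>0 > 0" "\<And>\<mu>. 0 < \<mu> \<Longrightarrow> \<mu> < \<mu>0 \<Longrightarrow> Q \<mu>"
    unfolding eventually_at_right_field by blast
  then show "\<exists>\<mu>0>0. \<forall>\<mu> \<tau>0 z. 0 < \<mu> \<and> \<mu> < \<mu>0 \<and> sol \<mu> \<tau>0 z \<longrightarrow> P (\<mu>, \<tau>0, z)"
    using Q(2) by (intro exI[of _ \<mu>0]) auto
next
  assume "\<exists>\<mu>0>0. \<forall>\<mu> \<tau>0 z. 0 < \<mu> \<and> \<mu> < \<mu>0 \<and> sol \<mu> \<tau>0 z \<longrightarrow> P (\<mu>, \<tau>0, z)"
  then obtain \<mu>0 where \<mu>0: "\<mu>0 > 0" "\<And>\<mu> \<tau>0 z. 0 < \<mu> \<Longrightarrow> \<mu> < \<mu>0 \<Longrightarrow> sol \<mu> \<tau>0 z \<Longrightarrow> P (\<mu>, \<tau>0, z)"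
    by blast
  have "eventually (\<lambda>\<mu>. 0 < \<mu> \<and> \<mu> < \<mu>0) (at_right 0)"
    using \<mu>0(1) unfolding eventually_at_right_field by blast
  then show "eventually P slow"
    unfolding slow_def eventually_inf_principal eventually_filtercomap
    using \<mu>0(2) by (intro exI[of _ "\<lambda>\<mu>. 0 < \<mu> \<and> \<mu> < \<mu>0"]) auto
qed

lemma solD:
  assumes "sol \<mu> \<tau>0 z" "\<tau> \<in> {\<tau>0..\<tau>0 + 2 * pi}"
  shows "z \<tau> \<in> K"
    "(z has_vector_derivative osc_field \<mu> \<tau> (z \<tau>)) (at \<tau> within {\<tau>0..\<tau>0 + 2 * pi})"
  using assms by (auto simp: sol_def solves_on_def)

lemma sol_continuous: "sol \<mu> \<tau>0 z \<Longrightarrow> continuous_on {\<tau>0..\<tau>0 + 2 * pi} z"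
  by (meson continuous_on_vector_derivative solD(2))

lemma weight_u: "a \<in> I \<Longrightarrow> weight (\<lambda>_. u a)"
  unfolding weight_def using u_le u_cont by (blast intro: continuous_on_subset zero_le_one)

lemma g_continuous: "a \<in> I \<Longrightarrow> continuous_on \<Omega> (g a)"
proof -
  assume a: "a \<in> I"
  have "continuous_on \<Omega> (\<lambda>z. \<Sum>e\<in>Basis. (g a z \<bullet> e) *\<^sub>R e)"
    using Ck_on_imp_continuous_on[OF g_Ck[OF a]]
    by (intro continuous_on_sum continuous_on_scaleR continuous_on_const) auto
  then show ?thesis by (simp add: euclidean_representation)
qed

lemma osc_field_bound:
  obtains C where "C > 0"
    "\<And>\<mu> \<tau> z. 0 \<le> \<mu> \<Longrightarrow> \<mu> \<le> 1 \<Longrightarrow> z \<in> K \<Longrightarrow> norm (osc_field \<mu> \<tau> z) \<le> C * \<mu>\<^sup>2"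
proof -
  have "continuous_on K (\<lambda>z. \<Sum>a\<in>I. norm (g a z))"
    using g_continuous K_sub by (intro continuous_intros) (auto intro: continuous_on_subset)
  then have "bounded ((\<lambda>z. \<Sum>a\<in>I. norm (g a z)) ` K)"
    using compact_K compact_continuous_image compact_imp_bounded by blast
  then obtain C where C: "C > 0" "\<And>z. z \<in> K \<Longrightarrow> norm (\<Sum>a\<in>I. norm (g a z)) \<le> C"
    unfolding bounded_pos by blast
  have "norm (osc_field \<mu> \<tau> z) \<le> C * \<mu>\<^sup>2" if \<mu>: "0 \<le> \<mu>" "\<mu> \<le> 1" and z: "z \<in> K" for \<mu> \<tau> z
  proof -
    have "norm (osc_field \<mu> \<tau> z) \<le> (\<Sum>a\<in>I. \<mu>\<^sup>2 * norm (g a z))"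
      unfolding osc_field_def
    proof (rule sum_norm_le)
      fix a assume a: "a \<in> I"
      have "2 \<le> p a" using p[OF a] by auto
      then have "\<mu> ^ p a * \<bar>u a \<tau>\<bar> \<le> \<mu>\<^sup>2 * 1"
        using \<mu> u_le[OF a] by (intro mult_mono power_decreasing) auto
      then show "norm ((\<mu> ^ p a * u a \<tau>) *\<^sub>R g a z) \<le> \<mu>\<^sup>2 * norm (g a z)"
        using \<mu> by (simp add: abs_mult mult_right_mono)
    qed
    also have "\<dots> \<le> \<mu>\<^sup>2 * C"
      using C(2)[OF z] by (simp add: sum_distrib_left[symmetric] mult_left_mono)
    finally show ?thesis by (simp add: mult.commute)
  qed
  then show thesis using C(1) that by blast
qed

text \<open>All exponents are at least 2, so for \<open>\<mu> \<le> 1\<close> the speed, and with it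
  the displacement over one period, is of order \<open>\<mu>\<^sup>2\<close>.\<close>

lemma sol_displacement:
  obtains C where "C > 0"
    "\<And>\<mu> \<tau>0 z \<tau>. 0 \<le> \<mu> \<Longrightarrow> \<mu> \<le> 1 \<Longrightarrow> sol \<mu> \<tau>0 z \<Longrightarrow> \<tau> \<in> {\<tau>0..\<tau>0 + 2 * pi} \<Longrightarrow>
      norm (z \<tau> - z \<tau>0) \<le> C * \<mu>\<^sup>2"
proof -
  obtain C where C: "C > 0"
    "\<And>\<mu> \<tau> z. 0 \<le> \<mu> \<Longrightarrow> \<mu> \<le> 1 \<Longrightarrow> z \<in> K \<Longrightarrow> norm (osc_field \<mu> \<tau> z) \<le> C * \<mu>\<^sup>2"
    using osc_field_bound by blast
  have "norm (z \<tau> - z \<tau>0) \<le> (C * (2 * pi)) * \<mu>\<^sup>2"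
    if \<mu>: "0 \<le> \<mu>" "\<mu> \<le> 1" and s: "sol \<mu> \<tau>0 z" and \<tau>: "\<tau> \<in> {\<tau>0..\<tau>0 + 2 * pi}" for \<mu> \<tau>0 z \<tau>
  proof -
    have "norm (z \<tau> - z \<tau>0) \<le> (C * \<mu>\<^sup>2) * norm (\<tau> - \<tau>0)"
    proof (rule differentiable_bound[where f' = "\<lambda>\<tau> h. h *\<^sub>R osc_field \<mu> \<tau> (z \<tau>)"])
      show "(z has_derivative (\<lambda>h. h *\<^sub>R osc_field \<mu> x (z x))) (at x within {\<tau>0..\<tau>0 + 2 * pi})"
        if "x \<in> {\<tau>0..\<tau>0 + 2 * pi}" for x
        using solD(2)[OF s that] by (simp add: has_vector_derivative_def)
      show "onorm (\<lambda>h. h *\<^sub>R osc_field \<mu> x (z x)) \<le> C * \<mu>\<^sup>2" if "x \<in> {\<tau>0..\<tau>0 + 2 * pi}" for x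
        using C(2)[OF \<mu> solD(1)[OF s that], of x] mult_right_mono C(1)
        by (intro onorm_bound) (auto simp: mult.commute[of _ "\<bar>_\<bar>"] intro!: mult_left_mono)
    qed (use \<tau> in auto)
    also have "\<dots> \<le> (C * \<mu>\<^sup>2) * (2 * pi)" using \<tau> C(1) by (intro mult_left_mono) auto
    finally show ?thesis by (simp add: mult_ac)
  qed
  then show thesis using C(1) that[of "C * (2 * pi)"] by simp
qed

definition obs :: "(real \<Rightarrow> real \<Rightarrow> real) \<Rightarrow> ('a \<Rightarrow> real) \<Rightarrow> real \<Rightarrow> (real \<Rightarrow> 'a) \<Rightarrow> real" where
  "obs w h \<tau>0 z = integral {\<tau>0..\<tau>0 + 2 * pi} (\<lambda>\<tau>. w \<tau>0 \<tau> * h (z \<tau>))"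

lemma obs_continuous:
  assumes "weight w" "continuous_on K h" "sol \<mu> \<tau>0 z"
  shows "continuous_on {\<tau>0..\<tau>0 + 2 * pi} (\<lambda>\<tau>. w \<tau>0 \<tau> * h (z \<tau>))"
  using assms
  by (intro continuous_on_mult weight_continuous continuous_on_compose2[OF _ sol_continuous[OF assms(3)]])
    (auto dest: solD)

text \<open>Over a period the solution hardly moves and \<open>h\<close> is uniformly continuous on
  the compact set \<open>K\<close>, so \<open>h\<close> may be frozen at the start. Continuity of
  \<open>h\<close> suffices, which lets the lemma handle fields that have already been
  differentiated twice.\<close>

lemma obs_approx:
  assumes w: "weight w" and h: "continuous_on K h"
  shows "((\<lambda>(\<mu>, \<tau>0, z). obs w h \<tau>0 z - mean w \<tau>0 * h (z \<tau>0)) \<longlongrightarrow> 0) slow"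
proof (rule tendstoI)
  fix \<eta> :: real assume "\<eta> > 0"
  obtain M where M: "M \<ge> 0" "\<And>\<tau>0 \<tau>. \<tau> \<in> {\<tau>0..\<tau>0 + 2 * pi} \<Longrightarrow> \<bar>w \<tau>0 \<tau>\<bar> \<le> M"
    by (rule weightE[OF w]) blast
  \<comment> \<open>The added 1 covers \<open>M = 0\<close> and makes the final inequality
    strict.\<close>
  define \<eta>' where "\<eta>' = \<eta> / (M * (2 * pi) + 1)"
  have den: "M * (2 * pi) + 1 > 0" using M by (simp add: add_nonneg_pos)
  then have "\<eta>' > 0" using \<open>\<eta> > 0\<close> by (simp add: \<eta>'_def)
  then obtain d where d: "d > 0" "\<And>x y. x \<in> K \<Longrightarrow> y \<in> K \<Longrightarrow> dist y x < d \<Longrightarrow> dist (h y) (h x) < \<eta>'"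
    using compact_uniformly_continuous[OF h compact_K] unfolding uniformly_continuous_on_def by metis
  obtain C where C: "C > 0" "\<And>\<mu> \<tau>0 z \<tau>. 0 \<le> \<mu> \<Longrightarrow> \<mu> \<le> 1 \<Longrightarrow> sol \<mu> \<tau>0 z \<Longrightarrow>
      \<tau> \<in> {\<tau>0..\<tau>0 + 2 * pi} \<Longrightarrow> norm (z \<tau> - z \<tau>0) \<le> C * \<mu>\<^sup>2"
    using sol_displacement by blast
  define \<mu>0 where "\<mu>0 = min 1 (d / C)"
  have "\<mu>0 > 0" using d C by (simp add: \<mu>0_def)
  moreover have "\<bar>obs w h \<tau>0 z - mean w \<tau>0 * h (z \<tau>0)\<bar> < \<eta>"
    if \<mu>: "0 < \<mu>" "\<mu> < \<mu>0" and s: "sol \<mu> \<tau>0 z" for \<mu> \<tau>0 z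
  proof -
    let ?T = "{\<tau>0..\<tau>0 + 2 * pi}"
    have c: "continuous_on ?T (w \<tau>0)" using w by (rule weight_continuous)
    have "\<mu> < 1" and "C * \<mu> < d" using \<mu> C by (auto simp: \<mu>0_def field_simps)
    have "C * \<mu>\<^sup>2 \<le> C * \<mu>" using \<mu> C \<open>\<mu> < 1\<close> by (simp add: power2_eq_square mult_left_le)
    with \<open>C * \<mu> < d\<close> have "C * \<mu>\<^sup>2 < d" by linarith
    have near: "\<bar>h (z \<tau>) - h (z \<tau>0)\<bar> \<le> \<eta>'" if "\<tau> \<in> ?T" for \<tau>
    proof -
      have "norm (z \<tau> - z \<tau>0) < d"
        using C(2)[OF _ _ s that] \<mu> \<open>\<mu> < 1\<close> \<open>C * \<mu>\<^sup>2 < d\<close> by force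
      then show ?thesis using d(2)[of "z \<tau>0" "z \<tau>"] solD(1)[OF s] that
        by (auto simp: dist_norm)
    qed
    have "obs w h \<tau>0 z - mean w \<tau>0 * h (z \<tau>0)
        = integral ?T (\<lambda>\<tau>. w \<tau>0 \<tau> * h (z \<tau>)) - integral ?T (\<lambda>\<tau>. w \<tau>0 \<tau> * h (z \<tau>0))"
      by (simp add: obs_def mean_def)
    also have "\<dots> = integral ?T (\<lambda>\<tau>. w \<tau>0 \<tau> * h (z \<tau>) - w \<tau>0 \<tau> * h (z \<tau>0))"
      using obs_continuous[OF w h s] continuous_on_mult_right[OF c]
      by (intro integral_diff[symmetric] integrable_continuous_real) auto
    also have "norm \<dots> \<le> (M * \<eta>') * (\<tau>0 + 2 * pi - \<tau>0)"
    proof (rule integral_bound)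
      show "continuous_on ?T (\<lambda>\<tau>. w \<tau>0 \<tau> * h (z \<tau>) - w \<tau>0 \<tau> * h (z \<tau>0))"
        by (intro continuous_on_diff obs_continuous[OF w h s] continuous_on_mult_right c)
      show "norm (w \<tau>0 \<tau> * h (z \<tau>) - w \<tau>0 \<tau> * h (z \<tau>0)) \<le> M * \<eta>'" if "\<tau> \<in> ?T" for \<tau>
        using M(1) M(2)[OF that] near[OF that]
        by (simp add: right_diff_distrib[symmetric] abs_mult mult_mono)
    qed auto
    also have "\<dots> < \<eta>" using den \<open>\<eta> > 0\<close> M(1) by (simp add: \<eta>'_def field_simps)
    finally show ?thesis by simp
  qed
  ultimately show "\<forall>\<^sub>F x in slow. dist (case x of (\<mu>, \<tau>0, z) \<Rightarrow> obs w h \<tau>0 z - mean w \<tau>0 * h (z \<tau>0)) 0 < \<eta>"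
    unfolding eventually_slow by (intro exI[of _ \<mu>0]) (auto simp: dist_norm)
qed

lemma obs_bound:
  assumes w: "weight w" and h: "continuous_on K h"
  obtains B where "\<And>\<mu> \<tau>0 z. sol \<mu> \<tau>0 z \<Longrightarrow> \<bar>obs w h \<tau>0 z\<bar> \<le> B"
proof -
  obtain M where M: "M \<ge> 0" "\<And>\<tau>0 \<tau>. \<tau> \<in> {\<tau>0..\<tau>0 + 2 * pi} \<Longrightarrow> \<bar>w \<tau>0 \<tau>\<bar> \<le> M"
    by (rule weightE[OF w]) blast
  have "bounded (h ` K)"
    using h compact_K compact_continuous_image compact_imp_bounded by blast
  then obtain H where H: "H > 0" "\<And>x. x \<in> K \<Longrightarrow> \<bar>h x\<bar> \<le> H"
    unfolding bounded_pos by auto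
  have "\<bar>obs w h \<tau>0 z\<bar> \<le> (M * H) * (2 * pi)" if s: "sol \<mu> \<tau>0 z" for \<mu> \<tau>0 z
  proof -
    have "norm (obs w h \<tau>0 z) \<le> (M * H) * (\<tau>0 + 2 * pi - \<tau>0)"
      unfolding obs_def using M H s
      by (intro integral_bound obs_continuous[OF w h s]) (auto simp: abs_mult dest: solD intro!: mult_mono)
    then show ?thesis by simp
  qed
  then show thesis using that by blast
qed

text \<open>The product of \<open>prim w\<close> and \<open>h\<close> along the solution vanishes at
  both ends: at the start by normalisation, at the end because the mean is zero. Its derivative is
  the integrand on the left plus the Lie derivatives of \<open>h\<close> along the fields, each with
  its power of \<open>\<mu>\<close>.\<close>

lemma obs_by_parts:
  assumes w: "weight w" "mean w \<tau>0 = 0" and h: "Ck_on (Suc k) h \<Omega>" and s: "sol \<mu> \<tau>0 z"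
  shows "obs w h \<tau>0 z = - (\<Sum>b\<in>I. \<mu> ^ p b * obs (\<lambda>\<tau>0 \<tau>. prim w \<tau>0 \<tau> * u b \<tau>) (lie (g b) h) \<tau>0 z)"
proof -
  let ?T = "{\<tau>0..\<tau>0 + 2 * pi}" and ?W = "prim w \<tau>0"
  have hc: "continuous_on K h" using Ck_on_imp_continuous_on[OF h] K_sub continuous_on_subset by blast
  have g0: "Ck_on 0 (\<lambda>z. g b z \<bullet> e) \<Omega>" if "b \<in> I" "e \<in> Basis" for b e
    using Ck_on_imp_continuous_on[OF g_Ck[OF that]] by simp
  have h1: "Ck_on (Suc 0) h \<Omega>" using h
  proof (induction k)
    case (Suc k) then show ?case using Ck_on_Suc_imp by blast
  qed
  have lc: "continuous_on K (lie (g b) h)" if "b \<in> I" for b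
    using Ck_on_lie[OF open_\<Omega> h1 g0[OF that]] K_sub continuous_on_subset by auto
  have wu: "weight (\<lambda>\<tau>0 \<tau>. prim w \<tau>0 \<tau> * u b \<tau>)" if "b \<in> I" for b
    by (rule weight_mult[OF weight_prim[OF w(1)] weight_u[OF that]])
  let ?R = "\<lambda>\<tau>. \<Sum>b\<in>I. \<mu> ^ p b * ((?W \<tau> * u b \<tau>) * lie (g b) h (z \<tau>))"
  have "((\<lambda>\<tau>. w \<tau>0 \<tau> * h (z \<tau>) + ?R \<tau>) has_integral
      ?W (\<tau>0 + 2 * pi) * h (z (\<tau>0 + 2 * pi)) - ?W \<tau>0 * h (z \<tau>0)) ?T"
  proof (rule fundamental_theorem_of_calculus)
    fix \<tau> assume \<tau>: "\<tau> \<in> ?T"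
    define h' where "h' = frechet_derivative h (at (z \<tau>))"
    have dh: "(h has_derivative h') (at (z \<tau>))"
      using Ck_on_has_derivative[OF h] solD(1)[OF s \<tau>] K_sub by (auto simp: h'_def)
    have "((\<lambda>\<tau>. h (z \<tau>)) has_derivative (\<lambda>t. h' (t *\<^sub>R osc_field \<mu> \<tau> (z \<tau>)))) (at \<tau> within ?T)"
      using has_derivative_compose[OF solD(2)[OF s \<tau>, unfolded has_vector_derivative_def] dh] .
    moreover have "h' (osc_field \<mu> \<tau> (z \<tau>)) = (\<Sum>b\<in>I. (\<mu> ^ p b * u b \<tau>) * lie (g b) h (z \<tau>))"
    proof -
      interpret linear h' using dh by (rule has_derivative_linear)
      show ?thesis unfolding osc_field_def sum scale lie_def h'_def[symmetric] by simp
    qed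
    ultimately have "((\<lambda>\<tau>. h (z \<tau>)) has_real_derivative
        (\<Sum>b\<in>I. (\<mu> ^ p b * u b \<tau>) * lie (g b) h (z \<tau>))) (at \<tau> within ?T)"
      unfolding has_field_derivative_def
      by (elim has_derivative_eq_rhs) (simp add: fun_eq_iff linear_scale[OF has_derivative_linear[OF dh]])
    from DERIV_mult[OF prim_has_derivative[OF w(1) \<tau>] this]
    show "((\<lambda>\<tau>. ?W \<tau> * h (z \<tau>)) has_vector_derivative (w \<tau>0 \<tau> * h (z \<tau>) + ?R \<tau>)) (at \<tau> within ?T)"
      by (simp add: has_real_derivative_iff_has_vector_derivative sum_distrib_left sum_distrib_right mult_ac add.commute)
  qed simp
  then have "integral ?T (\<lambda>\<tau>. w \<tau>0 \<tau> * h (z \<tau>) + ?R \<tau>) = 0"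
    using w(2) by (simp add: prim_end integral_unique)
  moreover have "integral ?T (\<lambda>\<tau>. w \<tau>0 \<tau> * h (z \<tau>) + ?R \<tau>) = obs w h \<tau>0 z + integral ?T ?R"
    unfolding obs_def using obs_continuous[OF w(1) hc s] obs_continuous[OF wu lc s]
    by (intro integral_add integrable_continuous_real continuous_on_sum continuous_on_mult_left) auto
  moreover have "integral ?T ?R =
      (\<Sum>b\<in>I. \<mu> ^ p b * obs (\<lambda>\<tau>0 \<tau>. prim w \<tau>0 \<tau> * u b \<tau>) (lie (g b) h) \<tau>0 z)"
    unfolding obs_def using obs_continuous[OF wu lc s] finite_I
    by (subst integral_sum) (auto intro!: integrable_continuous_real continuous_on_mult_left)
  ultimately show ?thesis by simp
qed

text \<open>\<open>k\<close> counts the powers of \<open>\<mu>\<close> collected so far; division by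
  \<open>\<mu> ^ 6\<close> relates a term to the size of the averaged motion.\<close>

definition scaled :: "nat \<Rightarrow> (real \<Rightarrow> real \<Rightarrow> real) \<Rightarrow> ('a \<Rightarrow> real) \<Rightarrow> real \<times> real \<times> (real \<Rightarrow> 'a) \<Rightarrow> real" where
  "scaled k w h = (\<lambda>(\<mu>, \<tau>0, z). \<mu> ^ k / \<mu> ^ 6 * obs w h \<tau>0 z)"

definition start :: "real \<times> real \<times> (real \<Rightarrow> 'a) \<Rightarrow> 'a" where
  "start = (\<lambda>(\<mu>, \<tau>0, z). z \<tau>0)"

text \<open>These are the terminal cases of the expansion. At power 6 the observable is frozen;
  above it a bounded integral is multiplied by a positive power of \<open>\<mu>\<close>.\<close>

lemma scaled_tendsto:
  assumes w: "weight w" and h: "continuous_on K h" and k: "6 \<le> k" and c: "\<And>\<tau>0. k = 6 \<Longrightarrow> mean w \<tau>0 = c"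
  shows "((\<lambda>x. scaled k w h x - (if k = 6 then c * h (start x) else 0)) \<longlongrightarrow> 0) slow"
proof (cases "k = 6")
  case True
  have "\<forall>\<^sub>F x in slow. (case x of (\<mu>, \<tau>0, z) \<Rightarrow> obs w h \<tau>0 z - mean w \<tau>0 * h (z \<tau>0)) =
      scaled k w h x - (if k = 6 then c * h (start x) else 0)"
    unfolding eventually_slow by (intro exI[of _ 1]) (auto simp: scaled_def start_def True c)
  from Lim_transform_eventually[OF obs_approx[OF w h] this] show ?thesis .
next
  case False
  obtain B where B: "\<And>\<mu> \<tau>0 z. sol \<mu> \<tau>0 z \<Longrightarrow> \<bar>obs w h \<tau>0 z\<bar> \<le> B"
    using obs_bound[OF w h] by blast
  have "((\<lambda>x. fst x * \<bar>B\<bar>) \<longlongrightarrow> 0) slow"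
  proof -
    have "(fst \<longlongrightarrow> 0) (filtercomap fst (at_right (0::real)))"
      by (rule filterlim_mono[OF filterlim_filtercomap at_within_le_nhds order_refl])
    then have "(fst \<longlongrightarrow> 0) slow" unfolding slow_def by (rule tendsto_mono[rotated]) simp
    then show ?thesis by (rule tendsto_mult_left_zero)
  qed
  moreover have "\<forall>\<^sub>F x in slow. norm (scaled k w h x - (if k = 6 then c * h (start x) else 0)) \<le> fst x * \<bar>B\<bar>"
    unfolding eventually_slow
  proof (intro exI[of _ 1] conjI allI impI)
    fix \<mu> \<tau>0 z assume *: "0 < \<mu> \<and> \<mu> < 1 \<and> sol \<mu> \<tau>0 z"
    have "\<mu> ^ k / \<mu> ^ 6 = \<mu> ^ (k - 6)" using * k by (simp add: power_diff)
    also have "\<dots> \<le> \<mu> ^ 1" using * k False by (intro power_decreasing) auto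
    finally have "\<bar>\<mu> ^ k / \<mu> ^ 6 * obs w h \<tau>0 z\<bar> \<le> \<mu> * \<bar>B\<bar>"
      unfolding abs_mult using * B[of \<mu> \<tau>0 z] by (intro mult_mono) auto
    then show "norm (scaled k w h (\<mu>, \<tau>0, z) - (if k = 6 then c * h (start (\<mu>, \<tau>0, z)) else 0))
        \<le> fst (\<mu>, \<tau>0, z) * \<bar>B\<bar>"
      using False by (simp add: scaled_def)
  qed simp
  ultimately show ?thesis by (rule Lim_null_comparison[rotated])
qed

text \<open>The recursive case: \<open>R b\<close> is the limit already known one level deeper,
  where the power has grown by \<open>p b\<close>. The statement compares with \<open>R b\<close>
  through differences, since the \<open>R b\<close> still depend on the start point and are no
  constants.\<close>

lemma scaled_by_parts:
  assumes w: "weight w" and c: "\<And>\<tau>0. mean w \<tau>0 = 0" and h: "Ck_on (Suc k') h \<Omega>"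
    and lim: "\<And>b. b \<in> I \<Longrightarrow>
      ((\<lambda>x. scaled (k + p b) (\<lambda>\<tau>0 \<tau>. prim w \<tau>0 \<tau> * u b \<tau>) (lie (g b) h) x - R b x) \<longlongrightarrow> 0) slow"
  shows "((\<lambda>x. scaled k w h x - - (\<Sum>b\<in>I. R b x)) \<longlongrightarrow> 0) slow"
proof -
  have "((\<lambda>x. - (\<Sum>b\<in>I. scaled (k + p b) (\<lambda>\<tau>0 \<tau>. prim w \<tau>0 \<tau> * u b \<tau>) (lie (g b) h) x - R b x)) \<longlongrightarrow> - (\<Sum>b\<in>I. 0)) slow"
    by (intro tendsto_minus tendsto_sum lim)
  moreover have "- (\<Sum>b\<in>I. scaled (k + p b) (\<lambda>\<tau>0 \<tau>. prim w \<tau>0 \<tau> * u b \<tau>) (lie (g b) h) x - R b x)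
      = scaled k w h x - - (\<Sum>b\<in>I. R b x)" if x: "x = (\<mu>, \<tau>0, z)" and s: "sol \<mu> \<tau>0 z" for x \<mu> \<tau>0 z
  proof -
    have "scaled k w h x = - (\<Sum>b\<in>I. scaled (k + p b) (\<lambda>\<tau>0 \<tau>. prim w \<tau>0 \<tau> * u b \<tau>) (lie (g b) h) x)"
      unfolding scaled_def x prod.case obs_by_parts[OF w c h s]
      by (simp add: power_add sum_distrib_left mult.assoc)
    then show ?thesis by (simp add: sum_subtractf)
  qed
  then have "\<forall>\<^sub>F x in slow. - (\<Sum>b\<in>I. scaled (k + p b) (\<lambda>\<tau>0 \<tau>. prim w \<tau>0 \<tau> * u b \<tau>) (lie (g b) h) x - R b x)
      = scaled k w h x - - (\<Sum>b\<in>I. R b x)"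
    unfolding eventually_slow by (intro exI[of _ 1]) simp
  ultimately show ?thesis by (auto intro: Lim_transform_eventually)
qed

text \<open>An exact identity from which the expansion starts. The coordinate is linear, so its own
  differentiation costs no smoothness and both derivatives of the field remain available.\<close>

lemma sol_increment:
  assumes s: "sol \<mu> \<tau>0 z" and e: "e \<in> Basis"
  shows "(z (\<tau>0 + 2 * pi) - z \<tau>0) \<bullet> e = (\<Sum>a\<in>I. \<mu> ^ p a * obs (\<lambda>_. u a) (\<lambda>z. g a z \<bullet> e) \<tau>0 z)"
proof -
  let ?T = "{\<tau>0..\<tau>0 + 2 * pi}"
  have gc: "continuous_on K (\<lambda>z. g a z \<bullet> e)" if "a \<in> I" for a
    using Ck_on_imp_continuous_on[OF g_Ck[OF that e]] K_sub continuous_on_subset by blast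
  have "((\<lambda>\<tau>. \<Sum>a\<in>I. \<mu> ^ p a * (u a \<tau> * (g a (z \<tau>) \<bullet> e))) has_integral
      z (\<tau>0 + 2 * pi) \<bullet> e - z \<tau>0 \<bullet> e) ?T"
  proof (rule fundamental_theorem_of_calculus)
    fix \<tau> assume "\<tau> \<in> ?T"
    from bounded_linear.has_vector_derivative[OF bounded_linear_inner_left solD(2)[OF s this], of e]
    show "((\<lambda>\<tau>. z \<tau> \<bullet> e) has_vector_derivative (\<Sum>a\<in>I. \<mu> ^ p a * (u a \<tau> * (g a (z \<tau>) \<bullet> e)))) (at \<tau> within ?T)"
      by (simp add: osc_field_def inner_sum_left mult.assoc)
  qed simp
  then have "(z (\<tau>0 + 2 * pi) - z \<tau>0) \<bullet> e =
      integral ?T (\<lambda>\<tau>. \<Sum>a\<in>I. \<mu> ^ p a * (u a \<tau> * (g a (z \<tau>) \<bullet> e)))"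
    by (simp add: integral_unique inner_diff_left)
  also have "\<dots> = (\<Sum>a\<in>I. \<mu> ^ p a * obs (\<lambda>_. u a) (\<lambda>z. g a z \<bullet> e) \<tau>0 z)"
    unfolding obs_def using obs_continuous[OF weight_u gc s] finite_I
    by (subst integral_sum) (auto intro!: integrable_continuous_real continuous_on_mult_left)
  finally show ?thesis .
qed

text \<open>The branching mirrors the point at which the expansion of a term stops, namely as soon
  as the collected power reaches 6; beyond 6 nothing is left in the limit. Each integration by parts
  contributes one minus sign. Since all exponents are at least 2, the third level is always the
  last.\<close>

definition averaged ::
    "('i \<Rightarrow> real) \<Rightarrow> ('i \<Rightarrow> 'i \<Rightarrow> real) \<Rightarrow> ('i \<Rightarrow> 'i \<Rightarrow> 'i \<Rightarrow> real) \<Rightarrow> 'a \<Rightarrow> 'a \<Rightarrow> real" where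
  "averaged c1 c2 c3 e z = (\<Sum>a\<in>I. if p a = 6 then c1 a * (g a z \<bullet> e) else
     - (\<Sum>b\<in>I. if p a + p b \<ge> 6
         then if p a + p b = 6 then c2 a b * lie (g b) (\<lambda>z. g a z \<bullet> e) z else 0
         else - (\<Sum>c\<in>I. if p a + p b + p c = 6
                   then c3 a b c * lie (g c) (lie (g b) (\<lambda>z. g a z \<bullet> e)) z else 0)))"

abbreviation "u2 a b \<equiv> (\<lambda>\<tau>0 \<tau>. prim (\<lambda>_. u a) \<tau>0 \<tau> * u b \<tau>)"
abbreviation "u3 a b c \<equiv> (\<lambda>\<tau>0 \<tau>. prim (u2 a b) \<tau>0 \<tau> * u c \<tau>)"

text \<open>
  Integrating by parts against antiderivatives that vanish at both ends of the period raises the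
  power of \<open>\<mu>\<close> without producing boundary terms; at power 6 the observable is frozen.
\<close>

lemma averaging_tendsto:
  assumes m1: "\<And>a \<tau>0. a \<in> I \<Longrightarrow> mean (\<lambda>_. u a) \<tau>0 = (if p a = 6 then c1 a else 0)"
    and m2: "\<And>a b \<tau>0. a \<in> I \<Longrightarrow> b \<in> I \<Longrightarrow> p a + p b \<le> 6 \<Longrightarrow>
      mean (u2 a b) \<tau>0 = (if p a + p b = 6 then c2 a b else 0)"
    and m3: "\<And>a b c \<tau>0. a \<in> I \<Longrightarrow> b \<in> I \<Longrightarrow> c \<in> I \<Longrightarrow> p a + p b + p c = 6 \<Longrightarrow>
      mean (u3 a b c) \<tau>0 = c3 a b c"
    and e: "e \<in> Basis"
  shows "((\<lambda>(\<mu>, \<tau>0, z). (z (\<tau>0 + 2 * pi) - z \<tau>0) \<bullet> e / \<mu> ^ 6 - averaged c1 c2 c3 e (z \<tau>0)) \<longlongrightarrow> 0) slow"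
proof -
  define h where "h a = (\<lambda>z. g a z \<bullet> e)" for a
  have h2: "Ck_on (Suc 1) (h a) \<Omega>" if "a \<in> I" for a
    using g_Ck[OF that e] unfolding h_def Suc_1 .
  have g1: "Ck_on 1 (\<lambda>z. g a z \<bullet> e) \<Omega>" if "a \<in> I" "e \<in> Basis" for a e
    by (rule Ck_on_Suc_imp) (use g_Ck[OF that] in \<open>unfold Suc_1\<close>)
  have g0: "Ck_on 0 (\<lambda>z. g a z \<bullet> e) \<Omega>" if "a \<in> I" "e \<in> Basis" for a e
    by (rule Ck_on_Suc_imp) (use g1[OF that] in simp)
  have h1: "Ck_on (Suc 0) (lie (g b) (h a)) \<Omega>" if "a \<in> I" "b \<in> I" for a b
    using Ck_on_lie[OF open_\<Omega> h2[OF that(1)] g1[OF that(2)]] by simp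
  have h0: "Ck_on 0 (lie (g c) (lie (g b) (h a))) \<Omega>" if "a \<in> I" "b \<in> I" "c \<in> I" for a b c
    using Ck_on_lie[OF open_\<Omega> h1[OF that(1,2)] g0[OF that(3)]] .
  have cont: "continuous_on K f" if "Ck_on k f \<Omega>" for k f
    using Ck_on_imp_continuous_on[OF that] K_sub continuous_on_subset by blast
  have w2: "weight (u2 a b)" if "a \<in> I" "b \<in> I" for a b
    by (intro weight_mult weight_prim weight_u that)
  have w3: "weight (u3 a b c)" if "a \<in> I" "b \<in> I" "c \<in> I" for a b c
    by (intro weight_mult weight_prim weight_u that)
  \<comment> \<open>\<open>R3\<close>, \<open>R2\<close> and \<open>R1\<close> are the expected
    limits on the three levels. The observables there are of class C0, C1 and C2, so the smoothness
    is used up exactly on the deepest level.\<close>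
  define R3 where "R3 a b c x =
      (if p a + p b + p c = 6 then c3 a b c * lie (g c) (lie (g b) (h a)) (start x) else 0)" for a b c x
  define R2 where "R2 a b x = (if p a + p b \<ge> 6
      then if p a + p b = 6 then c2 a b * lie (g b) (h a) (start x) else 0
      else - (\<Sum>c\<in>I. R3 a b c x))" for a b x
  define R1 where "R1 a x = (if p a = 6 then c1 a * h a (start x) else - (\<Sum>b\<in>I. R2 a b x))" for a x
  have L3: "((\<lambda>x. scaled (p a + p b + p c) (u3 a b c) (lie (g c) (lie (g b) (h a))) x - R3 a b c x) \<longlongrightarrow> 0) slow"
    if "a \<in> I" "b \<in> I" "c \<in> I" for a b c
    unfolding R3_def using p[OF that(1)] p[OF that(2)] p[OF that(3)]
    by (intro scaled_tendsto w3 cont[OF h0] that m3) auto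
  have L2: "((\<lambda>x. scaled (p a + p b) (u2 a b) (lie (g b) (h a)) x - R2 a b x) \<longlongrightarrow> 0) slow"
    if ab: "a \<in> I" "b \<in> I" for a b
  proof (cases "p a + p b \<ge> 6")
    case True
    then show ?thesis unfolding R2_def
      using scaled_tendsto[OF w2[OF ab] cont[OF h1[OF ab]] True, of "c2 a b"] m2[OF ab] by simp
  next
    case False
    then have "R2 a b = (\<lambda>x. - (\<Sum>c\<in>I. R3 a b c x))" by (intro ext) (simp add: R2_def)
    then show ?thesis
      using False m2[OF ab] scaled_by_parts[OF w2[OF ab] _ h1[OF ab] L3[OF ab]] by simp
  qed
  have L1: "((\<lambda>x. scaled (p a) (\<lambda>_. u a) (h a) x - R1 a x) \<longlongrightarrow> 0) slow" if a: "a \<in> I" for a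
  proof (cases "p a = 6")
    case True
    then show ?thesis unfolding R1_def
      using scaled_tendsto[OF weight_u[OF a] cont[OF h2[OF a]], of "p a" "c1 a"] m1[OF a] by simp
  next
    case False
    then have "R1 a = (\<lambda>x. - (\<Sum>b\<in>I. R2 a b x))" by (intro ext) (simp add: R1_def)
    then show ?thesis
      using False m1[OF a] scaled_by_parts[OF weight_u[OF a] _ h2[OF a] L2[OF a]] by simp
  qed
  have "((\<lambda>x. \<Sum>a\<in>I. scaled (p a) (\<lambda>_. u a) (h a) x - R1 a x) \<longlongrightarrow> (\<Sum>a\<in>I. 0)) slow"
    by (intro tendsto_sum L1)
  moreover have "(\<Sum>a\<in>I. scaled (p a) (\<lambda>_. u a) (h a) (\<mu>, \<tau>0, z) - R1 a (\<mu>, \<tau>0, z)) =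
      (z (\<tau>0 + 2 * pi) - z \<tau>0) \<bullet> e / \<mu> ^ 6 - averaged c1 c2 c3 e (z \<tau>0)" if "sol \<mu> \<tau>0 z" for \<mu> \<tau>0 z
    unfolding sol_increment[OF that e] sum_subtractf scaled_def averaged_def R1_def R2_def R3_def h_def start_def prod.case
    by (simp add: sum_divide_distrib)
  then have "\<forall>\<^sub>F x in slow. (\<Sum>a\<in>I. scaled (p a) (\<lambda>_. u a) (h a) x - R1 a x) =
      (case x of (\<mu>, \<tau>0, z) \<Rightarrow> (z (\<tau>0 + 2 * pi) - z \<tau>0) \<bullet> e / \<mu> ^ 6 - averaged c1 c2 c3 e (z \<tau>0))"
    unfolding eventually_slow by (intro exI[of _ 1]) simp
  ultimately show ?thesis by (auto intro: Lim_transform_eventually)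
qed

theorem averaging:
  assumes m1: "\<And>a \<tau>0. a \<in> I \<Longrightarrow> mean (\<lambda>_. u a) \<tau>0 = (if p a = 6 then c1 a else 0)"
    and m2: "\<And>a b \<tau>0. a \<in> I \<Longrightarrow> b \<in> I \<Longrightarrow> p a + p b \<le> 6 \<Longrightarrow>
      mean (u2 a b) \<tau>0 = (if p a + p b = 6 then c2 a b else 0)"
    and m3: "\<And>a b c \<tau>0. a \<in> I \<Longrightarrow> b \<in> I \<Longrightarrow> c \<in> I \<Longrightarrow> p a + p b + p c = 6 \<Longrightarrow>
      mean (u3 a b c) \<tau>0 = c3 a b c"
    and G: "\<And>e z. e \<in> Basis \<Longrightarrow> z \<in> K \<Longrightarrow> G z \<bullet> e = averaged c1 c2 c3 e z"
    and \<eta>: "\<eta> > 0"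
  shows "\<exists>\<mu>0>0. \<forall>\<mu> \<tau>0 z. 0 < \<mu> \<and> \<mu> < \<mu>0 \<and> sol \<mu> \<tau>0 z \<longrightarrow>
    norm (z (\<tau>0 + 2 * pi) - z \<tau>0 - \<mu> ^ 6 *\<^sub>R G (z \<tau>0)) \<le> \<eta> * \<mu> ^ 6"
proof -
  define \<eta>' where "\<eta>' = \<eta> / DIM('a)"
  have "\<eta>' > 0" using \<eta> by (simp add: \<eta>'_def)
  have "\<forall>\<^sub>F x in slow. \<forall>e\<in>Basis. dist (case x of (\<mu>, \<tau>0, z) \<Rightarrow>
      (z (\<tau>0 + 2 * pi) - z \<tau>0) \<bullet> e / \<mu> ^ 6 - averaged c1 c2 c3 e (z \<tau>0)) 0 < \<eta>'"
  proof (intro eventually_ball_finite ballI)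
    fix e :: 'a assume e: "e \<in> Basis"
    show "\<forall>\<^sub>F x in slow. dist (case x of (\<mu>, \<tau>0, z) \<Rightarrow>
        (z (\<tau>0 + 2 * pi) - z \<tau>0) \<bullet> e / \<mu> ^ 6 - averaged c1 c2 c3 e (z \<tau>0)) 0 < \<eta>'"
      by (rule tendstoD[OF averaging_tendsto[OF m1 m2 m3 e] \<open>\<eta>' > 0\<close>])
  qed simp
  then obtain \<mu>1 where \<mu>1: "\<mu>1 > 0" "\<And>\<mu> \<tau>0 z e. 0 < \<mu> \<Longrightarrow> \<mu> < \<mu>1 \<Longrightarrow> sol \<mu> \<tau>0 z \<Longrightarrow> e \<in> Basis \<Longrightarrow>
      \<bar>(z (\<tau>0 + 2 * pi) - z \<tau>0) \<bullet> e / \<mu> ^ 6 - averaged c1 c2 c3 e (z \<tau>0)\<bar> < \<eta>'"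
    unfolding eventually_slow dist_norm by (metis (no_types, lifting) diff_zero prod.case real_norm_def)
  have "norm (z (\<tau>0 + 2 * pi) - z \<tau>0 - \<mu> ^ 6 *\<^sub>R G (z \<tau>0)) \<le> \<eta> * \<mu> ^ 6"
    if \<mu>: "0 < \<mu>" "\<mu> < \<mu>1" and s: "sol \<mu> \<tau>0 z" for \<mu> \<tau>0 z
  proof -
    let ?d = "z (\<tau>0 + 2 * pi) - z \<tau>0 - \<mu> ^ 6 *\<^sub>R G (z \<tau>0)"
    have "norm ?d \<le> (\<Sum>e\<in>Basis. \<bar>?d \<bullet> e\<bar>)" by (rule norm_le_l1)
    also have "\<dots> \<le> (\<Sum>e\<in>(Basis :: 'a set). \<eta>' * \<mu> ^ 6)"
    proof (rule sum_mono)
      fix e :: 'a assume e: "e \<in> Basis"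
      have z: "z \<tau>0 \<in> K" using solD(1)[OF s] by simp
      have "?d \<bullet> e = ((z (\<tau>0 + 2 * pi) - z \<tau>0) \<bullet> e / \<mu> ^ 6 - averaged c1 c2 c3 e (z \<tau>0)) * \<mu> ^ 6"
        using \<mu> G[OF e z] by (simp add: diff_divide_distrib left_diff_distrib inner_diff_left)
      then show "\<bar>?d \<bullet> e\<bar> \<le> \<eta>' * \<mu> ^ 6"
        using \<mu>1(2)[OF \<mu> s e] \<mu> by (simp add: abs_mult mult_right_mono)
    qed
    also have "\<dots> = \<eta> * \<mu> ^ 6" by (simp add: \<eta>'_def)
    finally show ?thesis .
  qed
  then show ?thesis using \<mu>1(1) by blast
qed

end

section \<open>Global solutions of ordinary differential equations\<close>

text \<open>Picard iteration in a weighted norm: the unknown is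
  \<open>y t = exp (- l * (t - t0)) *\<^sub>R (q t - q0)\<close>, and
  \<open>l = 2 * (\<bar>L\<bar> + 1)\<close> makes the integral operator a contraction with factor
  1/2 on the entire half line at once, without continuation of local solutions.\<close>

lemma ode_existence:
  fixes f :: "real \<Rightarrow> 'a::euclidean_space \<Rightarrow> 'a"
  assumes cont: "continuous_on UNIV (\<lambda>(t, x). f t x)"
    and bound: "\<And>t x. norm (f t x) \<le> B"
    and lipschitz: "\<And>t x y. norm (f t x - f t y) \<le> L * norm (x - y)"
  shows "\<exists>q. q t0 = q0 \<and> (\<forall>t\<ge>t0. (q has_vector_derivative f t (q t)) (at t within {t0..}))"
proof -
  define l where "l = 2 * (\<bar>L\<bar> + 1)"
  have l: "l > 0" "\<bar>L\<bar> / l \<le> 1 / 2" by (auto simp: l_def field_simps)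
  have B: "B \<ge> 0" using bound[of 0 0] norm_ge_zero order_trans by blast
  define q where "q y t = q0 + exp (l * (t - t0)) *\<^sub>R y t" for y :: "real \<Rightarrow> 'a" and t
  define \<Psi> where "\<Psi> y t = integral {t0..t} (\<lambda>r. f r (q y r))" for y t
  \<comment> \<open>Bounded continuous functions live on the whole line; the \<open>max\<close>
    makes the iterate zero before \<open>t0\<close>.\<close>
  define \<Phi> where "\<Phi> y t = exp (- l * (max t t0 - t0)) *\<^sub>R \<Psi> y (max t t0)" for y t
  have fc: "continuous_on S (\<lambda>r. f r (x r))" if "continuous_on S x" for S x
    using continuous_on_compose2[OF cont continuous_on_Pair[OF continuous_on_id that]] by simp
  have rc: "continuous_on S (\<lambda>r. f r (q y r))" if "continuous_on S y" for S y
    unfolding q_def by (intro fc continuous_intros that)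
  have \<Psi>_deriv: "(\<Psi> y has_vector_derivative f t (q y t)) (at t within {t0..})"
    if y: "continuous_on UNIV y" and t: "t \<ge> t0" for y t
  proof -
    have "(\<Psi> y has_vector_derivative f t (q y t)) (at t within {t0..t + 1})"
      unfolding \<Psi>_def using t
      by (intro integral_has_vector_derivative rc continuous_on_subset[OF y]) auto
    moreover have "at t within {t0..t + 1} = at t within {t0..}"
      by (rule at_within_nhd[of _ "{..<t + 1}"]) auto
    ultimately show ?thesis by simp
  qed
  have \<Psi>_bound: "norm (\<Psi> y t) \<le> B * (t - t0)" if y: "continuous_on UNIV y" and t: "t \<ge> t0" for y t
    unfolding \<Psi>_def using t bound
    by (intro integral_bound rc continuous_on_subset[OF y]) auto
  \<comment> \<open>The integral of a bounded field grows at most linearly, and the exponential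
    weight brings it back to a bounded function.\<close>
  have exp_bound: "exp (- (l * s)) * (c * s) \<le> c / l" if "s \<ge> 0" "c \<ge> 0" for s c
  proof -
    have "l * s \<le> exp (l * s)" using exp_ge_add_one_self[of "l * s"] by linarith
    then have "exp (- (l * s)) * (l * s) \<le> exp (- (l * s)) * exp (l * s)" by (intro mult_left_mono) auto
    then have "exp (- (l * s)) * (l * s) \<le> 1" by (simp add: mult_exp_exp)
    then have "(c / l) * (exp (- (l * s)) * (l * s)) \<le> (c / l) * 1"
      using that l(1) by (intro mult_left_mono) auto
    moreover have "(c / l) * (exp (- (l * s)) * (l * s)) = exp (- (l * s)) * (c * s)"
      using l(1) by simp
    ultimately show ?thesis by simp
  qed
  have \<Phi>_bcontfun: "\<Phi> y \<in> bcontfun" if y: "continuous_on UNIV y" for y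
  proof (rule bcontfun_normI)
    have "continuous_on {t0..} (\<Psi> y)"
      by (rule continuous_on_vector_derivative) (rule \<Psi>_deriv[OF y], simp)
    then have "continuous_on UNIV (\<lambda>t. \<Psi> y (max t t0))"
      by (rule continuous_on_compose2[of "{t0..}" _ UNIV "\<lambda>t. max t t0"])
        (auto intro!: continuous_on_max continuous_on_id continuous_on_const)
    then show "continuous_on UNIV (\<Phi> y)"
      unfolding \<Phi>_def by (intro continuous_intros)
    fix t
    have "norm (\<Phi> y t) \<le> exp (- (l * (max t t0 - t0))) * (B * (max t t0 - t0))"
      unfolding \<Phi>_def using \<Psi>_bound[OF y, of "max t t0"] by (simp add: mult_left_mono)
    also have "\<dots> \<le> B / l" by (rule exp_bound) (use B in auto)
    finally show "norm (\<Phi> y t) \<le> B / l" .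
  qed
  have contraction: "norm (\<Phi> x t - \<Phi> y t) \<le> 1 / 2 * d"
    if x: "continuous_on UNIV x" and y: "continuous_on UNIV y" and d: "\<And>t. norm (x t - y t) \<le> d" for x y t d
  proof -
    define s where "s = max t t0"
    have s: "s \<ge> t0" by (simp add: s_def)
    have d0: "d \<ge> 0" using d[of 0] norm_ge_zero order_trans by blast
    \<comment> \<open>At time \<open>r\<close> the unweighted functions differ by at most
      \<open>d * exp (l * (r - t0))\<close>. Integrating this exponential gains the factor
      \<open>1 / l\<close>, the source of the contraction.\<close>
    have E: "((\<lambda>r. \<bar>L\<bar> * d * exp (l * (r - t0))) has_integral
        \<bar>L\<bar> * d / l * exp (l * (s - t0)) - \<bar>L\<bar> * d / l * exp (l * (t0 - t0))) {t0..s}"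
      using s l
      by (intro fundamental_theorem_of_calculus)
        (auto intro!: derivative_eq_intros simp: has_real_derivative_iff_has_vector_derivative[symmetric])
    have "\<Psi> x s - \<Psi> y s = integral {t0..s} (\<lambda>r. f r (q x r) - f r (q y r))"
      unfolding \<Psi>_def
      by (intro integral_diff[symmetric] integrable_continuous_real rc
          continuous_on_subset[OF x] continuous_on_subset[OF y]) auto
    also have "norm \<dots> \<le> integral {t0..s} (\<lambda>r. \<bar>L\<bar> * d * exp (l * (r - t0)))"
    proof (rule integral_norm_bound_integral)
      show "(\<lambda>r. f r (q x r) - f r (q y r)) integrable_on {t0..s}"
        by (intro integrable_continuous_real continuous_on_diff rc
            continuous_on_subset[OF x] continuous_on_subset[OF y]) auto
      show "norm (f r (q x r) - f r (q y r)) \<le> \<bar>L\<bar> * d * exp (l * (r - t0))" for r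
      proof -
        have "norm (f r (q x r) - f r (q y r)) \<le> L * norm (q x r - q y r)" by (rule lipschitz)
        also have "\<dots> \<le> \<bar>L\<bar> * norm (q x r - q y r)" by (intro mult_right_mono) auto
        also have "norm (q x r - q y r) = exp (l * (r - t0)) * norm (x r - y r)"
          by (simp add: q_def scaleR_diff_right[symmetric])
        also have "\<bar>L\<bar> * \<dots> \<le> \<bar>L\<bar> * (exp (l * (r - t0)) * d)"
          using d by (intro mult_left_mono) auto
        finally show ?thesis by (simp add: mult_ac)
      qed
    qed (use E in blast)
    also have "\<dots> \<le> \<bar>L\<bar> / l * d * exp (l * (s - t0))"
      using integral_unique[OF E] l d0 by (simp add: mult_ac)
    finally have "norm (\<Psi> x s - \<Psi> y s) \<le> \<bar>L\<bar> / l * d * exp (l * (s - t0))" .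
    then have "exp (- l * (s - t0)) * norm (\<Psi> x s - \<Psi> y s)
        \<le> exp (- l * (s - t0)) * (\<bar>L\<bar> / l * d * exp (l * (s - t0)))"
      by (intro mult_left_mono) auto
    also have "\<dots> = \<bar>L\<bar> / l * d * (exp (- l * (s - t0)) * exp (l * (s - t0)))" by simp
    also have "\<dots> = \<bar>L\<bar> / l * d" by (simp add: mult_exp_exp)
    also have "\<dots> \<le> 1 / 2 * d" by (rule mult_right_mono[OF l(2) d0])
    finally show ?thesis
      by (simp add: \<Phi>_def s_def[symmetric] scaleR_diff_right[symmetric])
  qed
  define T where "T y = Bcontfun (\<Phi> (apply_bcontfun y))" for y :: "real \<Rightarrow>\<^sub>C 'a"
  have T: "apply_bcontfun (T y) = \<Phi> (apply_bcontfun y)" for y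
    unfolding T_def by (rule Bcontfun_inverse[OF \<Phi>_bcontfun]) auto
  have "\<exists>!y. T y = y"
  proof (rule banach_fix_type[of "1 / 2"])
    show "\<forall>x y. dist (T x) (T y) \<le> 1 / 2 * dist x y"
    proof (intro allI dist_bound)
      fix x y :: "real \<Rightarrow>\<^sub>C 'a" and t
      show "dist (apply_bcontfun (T x) t) (apply_bcontfun (T y) t) \<le> 1 / 2 * dist x y"
        unfolding T dist_norm[of "_ :: 'a"]
        using dist_bounded[of x _ y] by (intro contraction) (auto simp: dist_norm)
    qed
  qed auto
  then obtain y where y: "T y = y" by blast
  have yc: "continuous_on UNIV (apply_bcontfun y)" by auto
  have eq: "q (apply_bcontfun y) t = q0 + \<Psi> (apply_bcontfun y) t" if "t \<ge> t0" for t
  proof -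
    have "apply_bcontfun y t = exp (- l * (t - t0)) *\<^sub>R \<Psi> (apply_bcontfun y) t"
      using fun_cong[OF T[of y, unfolded y], of t] that by (simp add: \<Phi>_def max_absorb1)
    then show ?thesis by (simp add: q_def mult_exp_exp)
  qed
  have "(q (apply_bcontfun y) has_vector_derivative f t (q (apply_bcontfun y) t)) (at t within {t0..})"
    if "t \<ge> t0" for t
  proof (rule has_vector_derivative_transform[OF _ _ ])
    show "((\<lambda>t. q0 + \<Psi> (apply_bcontfun y) t) has_vector_derivative f t (q (apply_bcontfun y) t)) (at t within {t0..})"
      using has_vector_derivative_add[OF has_vector_derivative_const \<Psi>_deriv[OF yc that]] by simp
  qed (use that eq in auto)
  moreover have "q (apply_bcontfun y) t0 = q0"
    using eq[of t0] by (simp add: \<Psi>_def)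
  ultimately show ?thesis by blast
qed

text \<open>The squared distance times \<open>exp (- (2 * L * (t - t0)))\<close> has nonpositive
  derivative by Cauchy-Schwarz and the Lipschitz bound. It starts at zero, so it cannot become
  positive.\<close>

lemma ode_unique:
  fixes f :: "real \<Rightarrow> 'a::real_inner \<Rightarrow> 'a"
  assumes p: "solves_on f X {t0..t1} p" and q: "solves_on f X {t0..t1} q" and "p t0 = q t0"
    and lipschitz: "\<And>t x y. x \<in> X \<Longrightarrow> y \<in> X \<Longrightarrow> norm (f t x - f t y) \<le> L * norm (x - y)"
    and "t0 \<le> t1"
  shows "p t1 = q t1"
proof -
  define d where "d t = ((p t - q t) \<bullet> (p t - q t)) * exp (- (2 * L * (t - t0)))" for t
  define d' where "d' t = (2 * ((p t - q t) \<bullet> (f t (p t) - f t (q t))) - 2 * L * ((p t - q t) \<bullet> (p t - q t)))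
      * exp (- (2 * L * (t - t0)))" for t
  have "\<exists>t\<in>{t0..t1}. d t1 - d t0 = (\<lambda>h. h * d' t) (t1 - t0)"
  proof (rule mvt_very_simple[OF \<open>t0 \<le> t1\<close>])
    fix t assume "t0 \<le> t" "t \<le> t1"
    then have t: "t \<in> {t0..t1}" by simp
    have "((\<lambda>t. p t - q t) has_vector_derivative f t (p t) - f t (q t)) (at t within {t0..t1})"
      using p q t unfolding solves_on_def by (intro has_vector_derivative_diff) auto
    then have v: "((\<lambda>t. p t - q t) has_derivative (\<lambda>h. h *\<^sub>R (f t (p t) - f t (q t)))) (at t within {t0..t1})"
      by (simp add: has_vector_derivative_def)
    show "(d has_derivative (\<lambda>h. h * d' t)) (at t within {t0..t1})"
      unfolding d_def
      by (rule has_derivative_eq_rhs, rule has_derivative_mult[OF has_derivative_inner[OF v v]])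
        (auto intro!: derivative_eq_intros simp: d'_def fun_eq_iff algebra_simps inner_commute)
  qed
  then obtain t where t: "t \<in> {t0..t1}" "d t1 - d t0 = (t1 - t0) * d' t" by auto
  have "(p t - q t) \<bullet> (f t (p t) - f t (q t)) \<le> norm (p t - q t) * norm (f t (p t) - f t (q t))"
    by (rule norm_cauchy_schwarz)
  also have "\<dots> \<le> norm (p t - q t) * (L * norm (p t - q t))"
    using p q t(1) by (intro mult_left_mono lipschitz) (auto simp: solves_on_def)
  also have "\<dots> = L * ((p t - q t) \<bullet> (p t - q t))"
    by (simp add: dot_square_norm power2_eq_square)
  finally have "d' t \<le> 0" unfolding d'_def by (intro mult_nonpos_nonneg) auto
  then have "d t1 - d t0 \<le> 0" unfolding t(2) using \<open>t0 \<le> t1\<close> by (intro mult_nonneg_nonpos) auto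
  moreover have "d t0 = 0" using \<open>p t0 = q t0\<close> by (simp add: d_def)
  ultimately have "(p t1 - q t1) \<bullet> (p t1 - q t1) * exp (- (2 * L * (t1 - t0))) \<le> 0"
    by (simp add: d_def)
  then have "(p t1 - q t1) \<bullet> (p t1 - q t1) \<le> 0"
    by (simp add: mult_le_0_iff not_le[symmetric])
  then show ?thesis by (metis eq_iff_diff_eq_0 inner_eq_zero_iff inner_ge_zero order_antisym)
qed

lemma solves_on_subset: "solves_on f X I q \<Longrightarrow> J \<subseteq> I \<Longrightarrow> solves_on f X J q"
  unfolding solves_on_def by (blast intro: has_vector_derivative_within_subset)

text \<open>
  The field is extended from the ball to the whole space by the nearest-point retraction, which
  makes it bounded and globally Lipschitz; its solutions solve the original equation as long as
  they stay in the ball.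
\<close>

definition retracted :: "'a::euclidean_space set \<Rightarrow> (real \<Rightarrow> 'a \<Rightarrow> 'a) \<Rightarrow> real \<Rightarrow> 'a \<Rightarrow> 'a" where
  "retracted K f t x = f t (closest_point K x)"

lemma all_solutions_mono:
  assumes "all_solutions f \<Omega> t0 q0 P" "\<And>q. P q \<Longrightarrow> Q q"
  shows "all_solutions f \<Omega> t0 q0 Q"
  using assms(1) unfolding all_solutions_def
  by (elim conjE, intro conjI) (assumption, assumption, use assms(2) in blast)

text \<open>The extended field has a global solution \<open>q\<close>; by \<open>stay\<close> it
  remains in the open ball, where both fields agree. A solution \<open>p\<close> of the original
  equation equals \<open>q\<close> as long as it stays in the closed ball. At its first contact with
  the sphere it would still equal \<open>q\<close>, which is strictly inside, so \<open>p\<close>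
  never gets there. \<open>P_cong\<close> says that \<open>P\<close> looks only at times from
  \<open>t0\<close> on, where solutions are determined.\<close>

lemma all_solutionsI:
  fixes f :: "real \<Rightarrow> 'a::euclidean_space \<Rightarrow> 'a"
  assumes K: "cball c R \<subseteq> \<Omega>" "R > 0"
    and cont: "continuous_on (UNIV \<times> cball c R) (\<lambda>(t, x). f t x)"
    and bound: "\<And>t x. x \<in> cball c R \<Longrightarrow> norm (f t x) \<le> B"
    and lipschitz: "\<And>t x y. x \<in> cball c R \<Longrightarrow> y \<in> cball c R \<Longrightarrow> norm (f t x - f t y) \<le> L * norm (x - y)"
    and stay: "\<And>q. q t0 = q0 \<Longrightarrow> solves_on (retracted (cball c R) f) UNIV {t0..} q \<Longrightarrow>
        P q \<and> (\<forall>t\<ge>t0. norm (q t - c) < R)"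
    and P_cong: "\<And>p q. P q \<Longrightarrow> (\<And>t. t \<ge> t0 \<Longrightarrow> p t = q t) \<Longrightarrow> P p"
  shows "all_solutions f \<Omega> t0 q0 P"
proof -
  let ?K = "cball c R" and ?f = "retracted (cball c R) f"
  have K_ne: "?K \<noteq> {}" using K by auto
  have cp: "closest_point ?K x \<in> ?K" for x
    using closest_point_in_set[of ?K x] K_ne by blast
  have cp_self: "closest_point ?K x = x" if "x \<in> ?K" for x
    using closest_point_self[OF that] .
  \<comment> \<open>The retraction bounds the distance of the images only from above, so the sign of
    \<open>L\<close> matters when the two bounds are combined. Two points at distance
    \<open>R\<close> settle it.\<close>
  have "L \<ge> 0"
  proof -
    obtain e :: 'a where "e \<in> Basis" using nonempty_Basis by blast
    then have "norm (f 0 (c + R *\<^sub>R e) - f 0 c) \<le> L * R"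
      using lipschitz[of "c + R *\<^sub>R e" c 0] K(2) by (simp add: dist_norm)
    then have "0 \<le> L * R" using norm_ge_zero order_trans by blast
    then show ?thesis using K(2) by (simp add: zero_le_mult_iff)
  qed
  have lip: "norm (?f t x - ?f t y) \<le> L * norm (x - y)" for t x y
  proof -
    have "norm (?f t x - ?f t y) \<le> L * norm (closest_point ?K x - closest_point ?K y)"
      unfolding retracted_def by (intro lipschitz cp)
    also have "\<dots> \<le> L * norm (x - y)"
      using closest_point_lipschitz[OF convex_cball closed_cball K_ne, of x y] \<open>L \<ge> 0\<close>
      by (intro mult_left_mono) (simp_all add: dist_norm)
    finally show ?thesis .
  qed
  have "\<exists>q. q t0 = q0 \<and> (\<forall>t\<ge>t0. (q has_vector_derivative ?f t (q t)) (at t within {t0..}))"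
  proof (rule ode_existence[OF _ _ lip])
    have "continuous_on UNIV (\<lambda>tx. (fst tx, closest_point ?K (snd tx)))"
      by (intro continuous_on_Pair continuous_on_fst[OF continuous_on_id]
          continuous_on_compose2[OF continuous_on_closest_point[OF convex_cball closed_cball K_ne]
            continuous_on_snd[OF continuous_on_id] subset_UNIV])
    from continuous_on_compose2[OF cont this] cp
    have "continuous_on UNIV (\<lambda>tx. case (fst tx, closest_point ?K (snd tx)) of (t, x) \<Rightarrow> f t x)"
      by blast
    then show "continuous_on UNIV (\<lambda>(t, x). ?f t x)"
      by (simp only: retracted_def case_prod_unfold fst_conv snd_conv)
    show "norm (?f t x) \<le> B" for t x
      unfolding retracted_def by (intro bound cp)
  qed
  then obtain q where q: "q t0 = q0" "solves_on ?f UNIV {t0..} q"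
    unfolding solves_on_def by auto
  from stay[OF q] have Pq: "P q" and in_ball: "\<And>t. t \<ge> t0 \<Longrightarrow> norm (q t - c) < R" by auto
  have in_K: "q t \<in> ?K" if "t \<ge> t0" for t
    using in_ball[OF that] by (simp add: dist_norm norm_minus_commute)
  have q_sol: "solves_on f \<Omega> {t0..} q"
    using q(2) in_K K(1) unfolding solves_on_def retracted_def by (auto simp: cp_self)
  have unique: "p t1 = q t1" if p: "solves_on f \<Omega> {t0..t1} p" "p t0 = q0" "t0 \<le> t1" for p t1
  proof -
    have eq: "p s = q s" if s: "t0 \<le> s" "s \<le> t1" and pK: "\<And>r. t0 \<le> r \<Longrightarrow> r \<le> s \<Longrightarrow> p r \<in> ?K" for s
    proof (rule ode_unique[where f = ?f and X = UNIV and L = L and ?t0.0 = t0])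
      show "solves_on ?f UNIV {t0..s} p"
        using solves_on_subset[OF p(1), of "{t0..s}"] s pK
        unfolding solves_on_def retracted_def by (auto simp: cp_self)
      show "solves_on ?f UNIV {t0..s} q"
        using q(2) by (rule solves_on_subset) auto
    qed (use s q p lip in auto)
    let ?n = "\<lambda>t. norm (p t - c)"
    have pc: "continuous_on {t0..t1} ?n"
      using p(1) unfolding solves_on_def
      by (intro continuous_on_norm continuous_on_diff continuous_on_const
          continuous_on_vector_derivative[of _ p "\<lambda>t. f t (p t)"]) auto
    have "?n s < R" if s: "s \<in> {t0..t1}" for s
    proof (rule ccontr)
      assume "\<not> ?n s < R"
      define S where "S = {t \<in> {t0..t1}. R \<le> ?n t}"
      have S_eq: "S = {t0..t1} \<inter> ?n -` {R..}" by (auto simp: S_def)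
      have "closed S"
        unfolding S_eq by (rule continuous_closed_preimage[OF pc]) auto
      moreover have "S \<subseteq> {t0..t1}" by (auto simp: S_def)
      ultimately have "compact S"
        using bounded_subset[OF bounded_closed_interval] compact_eq_bounded_closed by blast
      moreover have "S \<noteq> {}" using s \<open>\<not> ?n s < R\<close> by (auto simp: S_def)
      ultimately obtain \<tau> where \<tau>: "\<tau> \<in> S" "\<And>t. t \<in> S \<Longrightarrow> \<tau> \<le> t"
        using compact_attains_inf[of S] by blast
      have start: "?n t0 < R" using in_ball[of t0] q p by simp
      have "\<exists>x\<ge>t0. x \<le> \<tau> \<and> ?n x = R"
        using \<tau>(1) start by (intro IVT' continuous_on_subset[OF pc]) (auto simp: S_def)
      then have "?n \<tau> = R" using \<tau> by (force simp: S_def)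
      moreover have "?n r < R" if "t0 \<le> r" "r < \<tau>" for r
        using \<tau>(2)[of r] \<tau>(1) that by (force simp: S_def)
      ultimately have "p r \<in> ?K" if "t0 \<le> r" "r \<le> \<tau>" for r
        using that by (cases "r = \<tau>") (auto simp: dist_norm norm_minus_commute less_imp_le)
      then have "p \<tau> = q \<tau>" using \<tau>(1) by (intro eq) (auto simp: S_def)
      then show False using in_ball[of \<tau>] \<open>?n \<tau> = R\<close> \<tau>(1) by (auto simp: S_def)
    qed
    then show ?thesis
      using p(3) by (intro eq) (auto simp: dist_norm norm_minus_commute less_imp_le)
  qed
  show ?thesis
    unfolding all_solutions_def
  proof (intro conjI allI impI)
    show "\<exists>q. solves_on f \<Omega> {t0..} q \<and> q t0 = q0" using q q_sol by blast
    fix T p assume p: "t0 < T \<and> solves_on f \<Omega> {t0..<T} p \<and> p t0 = q0"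
    have "q t = p t" if t: "t \<in> {t0..<T}" for t
    proof -
      have "{t0..t} \<subseteq> {t0..<T}" using t by (auto intro: order_le_less_trans)
      then show ?thesis using t p unique[OF solves_on_subset[of f \<Omega> "{t0..<T}" p "{t0..t}"]] by auto
    qed
    then show "\<exists>q. solves_on f \<Omega> {t0..} q \<and> (\<forall>t\<in>{t0..<T}. q t = p t)" using q_sol by blast
  next
    fix p assume p: "solves_on f \<Omega> {t0..} p \<and> p t0 = q0"
    have "p t = q t" if "t \<ge> t0" for t
      using that p unique[OF solves_on_subset[of f \<Omega> "{t0..}" p "{t0..t}"]] by auto
    then show "P p" using P_cong Pq by blast
  qed
qed

section \<open>Lyapunov functions for the averaged field\<close>

text \<open>\<open>V\<close> has a positive minimum on the compact part of the ball at distance at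
  least \<open>r\<close>, and half of it is a suitable level. If \<open>r\<close> exceeds
  \<open>R\<close>, that part is empty and any level will do.\<close>

lemma sublevel_small:
  fixes V :: "'a::euclidean_space \<Rightarrow> real"
  assumes "continuous_on (cball c R) V" "\<And>x. x \<in> cball c R - {c} \<Longrightarrow> V x > 0" "r > 0"
  obtains m where "m > 0" "\<And>x. x \<in> cball c R \<Longrightarrow> V x \<le> m \<Longrightarrow> norm (x - c) < r"
proof -
  define A where "A = cball c R - ball c r"
  have "compact A" unfolding A_def by (intro compact_diff) auto
  have mem: "x \<in> A" if "x \<in> cball c R" "\<not> norm (x - c) < r" for x
    using that by (auto simp: A_def dist_norm norm_minus_commute)
  show thesis
  proof (cases "A = {}")
    case True
    then show thesis using mem by (intro that[of 1]) auto
  next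
    case False
    have "continuous_on A V" using assms(1) by (rule continuous_on_subset) (auto simp: A_def)
    then obtain y where y: "y \<in> A" "\<And>x. x \<in> A \<Longrightarrow> V y \<le> V x"
      using continuous_attains_inf[OF \<open>compact A\<close> False] by blast
    have "y \<noteq> c" using y(1) assms(3) by (auto simp: A_def)
    then have "V y > 0" using y(1) assms(2) by (auto simp: A_def)
    show thesis
    proof (rule that[of "V y / 2"])
      show "norm (x - c) < r" if "x \<in> cball c R" "V x \<le> V y / 2" for x
        using mem[OF that(1)] y(2)[of x] that(2) \<open>V y > 0\<close> by linarith
    qed (use \<open>V y > 0\<close> in simp)
  qed
qed

lemma grid_point:
  fixes t t0 T :: real
  assumes "t0 \<le> t" "T > 0"
  obtains k :: nat where "t \<in> {t0 + real k * T..t0 + real k * T + T}"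
proof
  define k where "k = nat \<lfloor>(t - t0) / T\<rfloor>"
  have "real k = of_int \<lfloor>(t - t0) / T\<rfloor>" using assms by (simp add: k_def)
  then have "real k \<le> (t - t0) / T" "(t - t0) / T < real k + 1" by linarith+
  then show "t \<in> {t0 + real k * T..t0 + real k * T + T}"
    using assms by (simp add: field_simps)
qed

text \<open>The interface between averaging and stability: a period moves points only a little, and
  its increment is an Euler step of \<open>G\<close> up to a relatively small error, uniformly in
  time and solution. \<open>V\<close> is only C1, because the averaging error is paired with
  \<open>V'\<close> directly.\<close>

locale averaged_lyapunov =
  fixes F :: "real \<Rightarrow> real \<Rightarrow> 'a::euclidean_space \<Rightarrow> 'a" and G :: "'a \<Rightarrow> 'a"
    and V :: "'a \<Rightarrow> real" and V' :: "'a \<Rightarrow> 'a" and c :: 'a and R :: real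
  assumes R: "R > 0"
    and F_cont: "\<And>\<omega>. \<omega> > 0 \<Longrightarrow> continuous_on (UNIV \<times> cball c R) (\<lambda>(t, x). F \<omega> t x)"
    and F_lipschitz: "\<And>\<omega>. \<omega> > 0 \<Longrightarrow>
      \<exists>L. \<forall>t. \<forall>x\<in>cball c R. \<forall>y\<in>cball c R. norm (F \<omega> t x - F \<omega> t y) \<le> L * norm (x - y)"
    and F_small: "\<And>\<eta>. \<eta> > 0 \<Longrightarrow>
      \<exists>\<omega>0>0. \<forall>\<omega>>\<omega>0. \<forall>t. \<forall>x\<in>cball c R. norm (F \<omega> t x) * (2 * pi / \<omega>) \<le> \<eta>"
    and F_averaged: "\<And>\<eta>. \<eta> > 0 \<Longrightarrow>
      \<exists>\<omega>0>0. \<forall>\<omega>>\<omega>0. \<forall>s q. solves_on (F \<omega>) (cball c R) {s..s + 2 * pi / \<omega>} q \<longrightarrow>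
        norm (q (s + 2 * pi / \<omega>) - q s - (2 * pi / \<omega>) *\<^sub>R G (q s)) \<le> \<eta> * (2 * pi / \<omega>)"
    and G_cont: "continuous_on (cball c R) G"
    and V_deriv: "\<And>x. x \<in> cball c R \<Longrightarrow> (V has_derivative (\<lambda>h. V' x \<bullet> h)) (at x)"
    and V'_cont: "continuous_on (cball c R) V'"
    and V_zero: "V c = 0" and V_pos: "\<And>x. x \<in> cball c R - {c} \<Longrightarrow> V x > 0"
    and V_decr: "\<And>x. x \<in> cball c R - {c} \<Longrightarrow> V' x \<bullet> G x < 0"
begin

abbreviation "K \<equiv> cball c R"

lemma V_cont: "continuous_on K V"
  using V_deriv by (meson continuous_at_imp_continuous_on has_derivative_continuous)

lemma mem_K: "x \<in> K \<longleftrightarrow> norm (x - c) \<le> R"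
  by (simp add: dist_norm norm_minus_commute)

lemma displacement:
  assumes "solves_on (retracted K f) UNIV {t0..} q" "t0 \<le> s" "T > 0"
    and bound: "\<And>t x. x \<in> K \<Longrightarrow> norm (f t x) * T \<le> \<rho>" and t: "t \<in> {s..s + T}"
  shows "norm (q t - q s) \<le> \<rho>"
proof -
  have K_ne: "K \<noteq> {}" using R by auto
  have "norm (q t - q s) \<le> (\<rho> / T) * norm (t - s)"
  proof (rule differentiable_bound[where f' = "\<lambda>t h. h *\<^sub>R retracted K f t (q t)"])
    fix x assume x: "x \<in> {s..s + T}"
    have "(q has_vector_derivative retracted K f x (q x)) (at x within {t0..})"
      using assms(1,2) x by (auto simp: solves_on_def)
    then have "(q has_vector_derivative retracted K f x (q x)) (at x within {s..s + T})"
      by (rule has_vector_derivative_within_subset) (use assms(2) in auto)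
    then show "(q has_derivative (\<lambda>h. h *\<^sub>R retracted K f x (q x))) (at x within {s..s + T})"
      by (simp add: has_vector_derivative_def)
    have w: "norm (retracted K f x (q x)) \<le> \<rho> / T"
      using bound[OF closest_point_in_set[OF closed_cball K_ne]] assms(3)
      by (simp add: retracted_def field_simps)
    show "onorm (\<lambda>h. h *\<^sub>R retracted K f x (q x)) \<le> \<rho> / T"
    proof (rule onorm_bound)
      show "norm (h *\<^sub>R retracted K f x (q x)) \<le> \<rho> / T * norm h" for h :: real
        using mult_right_mono[OF w norm_ge_zero[of h]] by (simp add: mult.commute)
      show "0 \<le> \<rho> / T" using order_trans[OF norm_ge_zero w] .
    qed
  qed (use t in auto)
  also have "\<dots> \<le> (\<rho> / T) * T"
    using t assms(3) order_trans[OF mult_nonneg_nonneg[OF norm_ge_zero] bound[of c 0]] R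
    by (intro mult_left_mono) auto
  finally show ?thesis using assms(3) by simp
qed

text \<open>With \<open>V\<close> of class C1 the increment is taken to first order at an
  intermediate point. The bound on its distance from \<open>a\<close> is what later allows
  \<open>V' \<xi>\<close> to be replaced by \<open>V' a\<close>.\<close>

lemma V_mvt:
  assumes "a \<in> K" "b \<in> K"
  obtains \<xi> where "\<xi> \<in> K" "norm (\<xi> - a) \<le> norm (b - a)" "V b - V a = V' \<xi> \<bullet> (b - a)"
proof -
  have in_K: "a + r *\<^sub>R (b - a) \<in> K" if "0 \<le> r" "r \<le> 1" for r
    using convexD_alt[OF convex_cball assms that] by (simp add: algebra_simps)
  have "\<exists>r\<in>{0..1}. V (a + 1 *\<^sub>R (b - a)) - V (a + 0 *\<^sub>R (b - a))
      = (\<lambda>h. V' (a + r *\<^sub>R (b - a)) \<bullet> (h *\<^sub>R (b - a))) (1 - 0)"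
  proof (rule mvt_very_simple)
    fix r :: real assume "0 \<le> r" "r \<le> 1"
    have "((\<lambda>r. a + r *\<^sub>R (b - a)) has_derivative (\<lambda>h. h *\<^sub>R (b - a))) (at r within {0..1})"
      by (auto intro!: derivative_eq_intros)
    from has_derivative_compose[OF this V_deriv[OF in_K[OF \<open>0 \<le> r\<close> \<open>r \<le> 1\<close>]]]
    show "((\<lambda>r. V (a + r *\<^sub>R (b - a))) has_derivative (\<lambda>h. V' (a + r *\<^sub>R (b - a)) \<bullet> (h *\<^sub>R (b - a))))
        (at r within {0..1})" .
  qed simp
  then obtain r where r: "r \<in> {0..1}" "V b - V a = V' (a + r *\<^sub>R (b - a)) \<bullet> (b - a)" by auto
  show thesis
    using r in_K[of r] by (intro that[of "a + r *\<^sub>R (b - a)"]) (auto simp: mult_left_le_one_le)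
qed

text \<open>\<open>T\<close> is the period and \<open>\<gamma>\<close> the guaranteed rate. The
  \<open>max\<close> reflects that descent is guaranteed only away from the equilibrium: low values
  of \<open>V\<close> may grow, but not past \<open>l\<close>. Between grid points only the distance
  to the last one is controlled.\<close>

definition descends :: "real \<Rightarrow> real \<Rightarrow> real \<Rightarrow> real \<Rightarrow> real \<Rightarrow> (real \<Rightarrow> 'a) \<Rightarrow> nat \<Rightarrow> bool" where
  "descends l \<rho> \<gamma> T t0 q k \<longleftrightarrow> q (t0 + real k * T) \<in> K \<and>
     V (q (t0 + real k * T)) \<le> max l (V (q t0) - real k * \<gamma> * T) \<and>
     (\<forall>t\<in>{t0 + real k * T..t0 + real k * T + T}. norm (q t - q (t0 + real k * T)) \<le> \<rho>)"

text \<open>The increment of \<open>V\<close> over a period is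
  \<open>T * (V' a \<bullet> G a)\<close> plus two errors: the averaging error paired with
  \<open>V' \<xi>\<close>, and the change of \<open>V'\<close> between \<open>a\<close> and
  \<open>\<xi>\<close>. Where \<open>V\<close> is at least \<open>l / 2\<close> the main term is at
  most \<open>- 3 * \<gamma> * T\<close> and each error at most \<open>\<gamma> * T\<close>. Below
  \<open>l / 2\<close>, one period is too short to climb above \<open>l\<close>.\<close>

lemma descent:
  assumes l0: "\<And>x. x \<in> K \<Longrightarrow> V x \<le> l0 \<Longrightarrow> norm (x - c) < R / 2" and l: "0 < l" "l \<le> l0" and \<rho>: "\<rho> > 0"
  shows "\<exists>\<gamma>>0. \<exists>\<omega>0>0. \<forall>\<omega>>\<omega>0. \<forall>t0 q. q t0 \<in> K \<longrightarrow> V (q t0) \<le> l0 \<longrightarrow>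
      solves_on (retracted K (F \<omega>)) UNIV {t0..} q \<longrightarrow>
      (\<forall>k. descends l \<rho> \<gamma> (2 * pi / \<omega>) t0 q k)"
proof -
  define A where "A = {x \<in> K. l / 2 \<le> V x}"
  have A_eq: "A = K \<inter> V -` {l / 2..}" by (auto simp: A_def)
  have "closed A" unfolding A_eq by (rule continuous_closed_preimage[OF V_cont]) auto
  moreover have "A \<subseteq> K" by (auto simp: A_def)
  ultimately have "compact A" using bounded_subset[OF bounded_cball] compact_eq_bounded_closed by blast
  have VG: "continuous_on A (\<lambda>x. V' x \<bullet> G x)"
    by (intro continuous_on_inner continuous_on_subset[OF V'_cont] continuous_on_subset[OF G_cont] \<open>A \<subseteq> K\<close>)
  obtain \<gamma> where \<gamma>: "\<gamma> > 0" "\<And>x. x \<in> A \<Longrightarrow> V' x \<bullet> G x \<le> - 3 * \<gamma>"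
  proof (cases "A = {}")
    case True
    then show thesis by (intro that[of 1]) auto
  next
    case False
    obtain y where y: "y \<in> A" "\<And>x. x \<in> A \<Longrightarrow> V' x \<bullet> G x \<le> V' y \<bullet> G y"
      using continuous_attains_sup[OF \<open>compact A\<close> False VG] by blast
    have "y \<noteq> c" using y(1) l V_zero by (auto simp: A_def)
    then have "V' y \<bullet> G y < 0" using V_decr y(1) by (auto simp: A_def)
    then show thesis using y(2) by (intro that[of "- (V' y \<bullet> G y) / 3"]) auto
  qed
  obtain B1 where B1: "B1 > 0" "\<And>x. x \<in> K \<Longrightarrow> norm (V' x) \<le> B1"
    using compact_imp_bounded[OF compact_continuous_image[OF V'_cont compact_cball]]
    unfolding bounded_pos by auto
  obtain B2 where B2: "B2 > 0" "\<And>x. x \<in> K \<Longrightarrow> norm (G x) \<le> B2"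
    using compact_imp_bounded[OF compact_continuous_image[OF G_cont compact_cball]]
    unfolding bounded_pos by auto
  have "\<gamma> / B2 > 0" using \<gamma> B2 by simp
  then obtain d where d: "d > 0" "\<And>x y. x \<in> K \<Longrightarrow> y \<in> K \<Longrightarrow> dist y x < d \<Longrightarrow> dist (V' y) (V' x) < \<gamma> / B2"
    using compact_uniformly_continuous[OF V'_cont compact_cball] unfolding uniformly_continuous_on_def by metis
  \<comment> \<open>In this order the entries give: the claimed bound within a period, confinement
    to the ball for a start within \<open>R / 2\<close>, closeness of \<open>V' \<xi>\<close> to
    \<open>V' a\<close>, and growth of \<open>V\<close> by at most \<open>l / 2\<close>.\<close>
  define \<rho>1 where "\<rho>1 = Min {\<rho>, R / 2, d / 2, l / 2 / B1}"
  have \<rho>1: "\<rho>1 > 0" "\<rho>1 \<le> \<rho>" "\<rho>1 \<le> R / 2" "\<rho>1 \<le> d / 2" "\<rho>1 \<le> l / 2 / B1"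
    using \<rho> R d l B1 by (auto simp: \<rho>1_def)
  obtain \<omega>1 where \<omega>1: "\<omega>1 > 0" "\<And>\<omega> t x. \<omega> > \<omega>1 \<Longrightarrow> x \<in> K \<Longrightarrow> norm (F \<omega> t x) * (2 * pi / \<omega>) \<le> \<rho>1"
    using F_small[OF \<rho>1(1)] by blast
  have "\<gamma> / B1 > 0" using \<gamma> B1 by simp
  then obtain \<omega>2 where \<omega>2: "\<omega>2 > 0" "\<And>\<omega> s q. \<omega> > \<omega>2 \<Longrightarrow> solves_on (F \<omega>) K {s..s + 2 * pi / \<omega>} q \<Longrightarrow>
      norm (q (s + 2 * pi / \<omega>) - q s - (2 * pi / \<omega>) *\<^sub>R G (q s)) \<le> \<gamma> / B1 * (2 * pi / \<omega>)"
    using F_averaged by blast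
  define \<omega>0 where "\<omega>0 = max \<omega>1 \<omega>2"
  have "\<omega>0 > 0" using \<omega>1 by (simp add: \<omega>0_def)
  have main: "descends l \<rho> \<gamma> T t0 q k"
    if \<omega>: "\<omega> > \<omega>0" and q0: "q t0 \<in> K" "V (q t0) \<le> l0"
      and q: "solves_on (retracted K (F \<omega>)) UNIV {t0..} q" and T_def: "T = 2 * pi / \<omega>" for \<omega> t0 q T k
  proof -
    have T: "T > 0" using \<omega> \<open>\<omega>0 > 0\<close> by (simp add: T_def)
    have disp: "norm (q t - q s) \<le> \<rho>1" if "s \<ge> t0" "t \<in> {s..s + T}" for s t
      using displacement[OF q that(1) T _ that(2), of \<rho>1] \<omega>1(2)[of \<omega>] \<omega> by (simp add: T_def \<omega>0_def)
    have step: "q (s + T) \<in> K \<and> V (q (s + T)) \<le> max l (V (q s) - \<gamma> * T)"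
      if s: "s \<ge> t0" and qs: "q s \<in> K" "V (q s) \<le> l0" for s
    proof -
      let ?a = "q s" and ?b = "q (s + T)"
      have a: "norm (?a - c) < R / 2" using l0[OF qs] .
      have in_K: "q t \<in> K" if "t \<in> {s..s + T}" for t
      proof -
        have "norm (q t - c) \<le> norm (q t - ?a) + norm (?a - c)"
          using norm_triangle_ineq[of "q t - ?a" "?a - c"] by simp
        then show ?thesis unfolding mem_K using disp[OF s that] a \<rho>1(3) by linarith
      qed
      have "solves_on (F \<omega>) K {s..s + T} q"
        using solves_on_subset[OF q, of "{s..s + T}"] s in_K
        by (auto simp: solves_on_def retracted_def closest_point_self)
      then have avg: "norm (?b - ?a - T *\<^sub>R G ?a) \<le> \<gamma> / B1 * T"
        using \<omega>2(2)[of \<omega> s q] \<omega> by (simp add: T_def \<omega>0_def)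
      have b: "?b \<in> K" using in_K T by simp
      have ba: "norm (?b - ?a) \<le> \<rho>1" using disp[OF s, of "s + T"] T by simp
      obtain \<xi> where \<xi>: "\<xi> \<in> K" "norm (\<xi> - ?a) \<le> norm (?b - ?a)" "V ?b - V ?a = V' \<xi> \<bullet> (?b - ?a)"
        using V_mvt[OF qs(1) b] .
      show ?thesis
      proof (cases "V ?a \<le> l / 2")
        case True
        have "V ?b - V ?a \<le> norm (V' \<xi>) * norm (?b - ?a)" unfolding \<xi>(3) by (rule norm_cauchy_schwarz)
        also have "\<dots> \<le> B1 * \<rho>1" using B1(1) B1(2)[OF \<xi>(1)] ba by (intro mult_mono) auto
        also have "\<dots> \<le> l / 2" using \<rho>1(5) B1(1) by (simp add: field_simps)
        finally show ?thesis using True b by simp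
      next
        case False
        then have aA: "?a \<in> A" using qs by (simp add: A_def)
        have "V' \<xi> \<bullet> (?b - ?a - T *\<^sub>R G ?a) \<le> norm (V' \<xi>) * norm (?b - ?a - T *\<^sub>R G ?a)"
          by (rule norm_cauchy_schwarz)
        also have "\<dots> \<le> B1 * (\<gamma> / B1 * T)"
          using B1(1) B1(2)[OF \<xi>(1)] avg by (intro mult_mono) auto
        also have "\<dots> = \<gamma> * T" using B1(1) by simp
        finally have 1: "V' \<xi> \<bullet> (?b - ?a - T *\<^sub>R G ?a) \<le> \<gamma> * T" .
        have "(V' \<xi> - V' ?a) \<bullet> G ?a \<le> norm (V' \<xi> - V' ?a) * norm (G ?a)"
          by (rule norm_cauchy_schwarz)
        also have "\<dots> \<le> \<gamma> / B2 * B2"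
        proof (rule mult_mono)
          have "dist \<xi> ?a < d" using \<xi>(2) ba \<rho>1(4) d(1) by (simp add: dist_norm)
          then show "norm (V' \<xi> - V' ?a) \<le> \<gamma> / B2"
            using d(2)[OF qs(1) \<xi>(1)] by (simp add: dist_norm)
        qed (use B2 qs \<gamma> in auto)
        also have "\<dots> = \<gamma>" using B2(1) by simp
        finally have 2: "(V' \<xi> - V' ?a) \<bullet> G ?a \<le> \<gamma>" .
        have "V ?b - V ?a = V' \<xi> \<bullet> (?b - ?a - T *\<^sub>R G ?a) + T * ((V' \<xi> - V' ?a) \<bullet> G ?a + V' ?a \<bullet> G ?a)"
          unfolding \<xi>(3) by (simp add: inner_diff_left inner_diff_right algebra_simps)
        also have "\<dots> \<le> \<gamma> * T + T * (\<gamma> + - 3 * \<gamma>)"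
          using 1 2 \<gamma>(2)[OF aA] T by (intro add_mono mult_left_mono) auto
        finally show ?thesis using b by (simp add: algebra_simps)
      qed
    qed
    have "q (t0 + real k * T) \<in> K \<and> V (q (t0 + real k * T)) \<le> l0 \<and>
        V (q (t0 + real k * T)) \<le> max l (V (q t0) - real k * \<gamma> * T)"
    proof (induction k)
      case 0
      then show ?case using q0 by simp
    next
      case (Suc k)
      have s: "t0 + real k * T \<ge> t0" using T by simp
      have eq: "t0 + real (Suc k) * T = t0 + real k * T + T" by (simp add: algebra_simps)
      have st: "q (t0 + real (Suc k) * T) \<in> K"
          "V (q (t0 + real (Suc k) * T)) \<le> max l (V (q (t0 + real k * T)) - \<gamma> * T)"
        using step[OF s] Suc unfolding eq by auto
      have "\<gamma> * T > 0" using \<gamma> T by simp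
      have k: "real (Suc k) * \<gamma> * T = real k * \<gamma> * T + \<gamma> * T" by (simp add: algebra_simps)
      show ?case
      proof (intro conjI)
        show "V (q (t0 + real (Suc k) * T)) \<le> l0" using st(2) Suc l \<open>\<gamma> * T > 0\<close> by linarith
        show "V (q (t0 + real (Suc k) * T)) \<le> max l (V (q t0) - real (Suc k) * \<gamma> * T)"
          using st(2) Suc \<open>\<gamma> * T > 0\<close> unfolding k by linarith
      qed (rule st)
    qed
    moreover have "norm (q t - q (t0 + real k * T)) \<le> \<rho>" if "t \<in> {t0 + real k * T..t0 + real k * T + T}" for t
      using disp[OF _ that] T \<rho>1(2) by force
    ultimately show ?thesis unfolding descends_def by blast
  qed
  show ?thesis
    using \<gamma>(1) \<open>\<omega>0 > 0\<close> main[OF _ _ _ _ refl] by (intro exI[of _ \<gamma>] exI[of _ \<omega>0] conjI allI impI) blast+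
qed

lemma V_small_near:
  assumes "m > 0"
  obtains \<delta> where "\<delta> > 0" "\<And>x. norm (x - c) < \<delta> \<Longrightarrow> x \<in> K \<and> V x \<le> m"
proof -
  have "isCont V c" using V_deriv[of c] R by (intro has_derivative_continuous) auto
  then obtain d where "d > 0" "\<And>x. dist x c < d \<Longrightarrow> dist (V x) (V c) < m"
    using assms unfolding continuous_at_eps_delta by (metis dist_commute)
  then show thesis
    using R V_zero by (intro that[of "min d R"]) (auto simp: dist_norm norm_minus_commute abs_less_iff intro: less_imp_le)
qed

text \<open>One statement for both halves of the definition: a start below level \<open>l\<close> is
  confined from the beginning, any other start below \<open>l0\<close> after the time
  \<open>tf\<close>.\<close>

lemma confined:
  assumes sub: "cball c R \<subseteq> \<Omega>"
    and l0: "\<And>x. x \<in> K \<Longrightarrow> V x \<le> l0 \<Longrightarrow> norm (x - c) < R / 2" and l: "0 < l" "l \<le> l0"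
    and r: "\<And>x. x \<in> K \<Longrightarrow> V x \<le> l \<Longrightarrow> norm (x - c) < \<epsilon> / 2" and \<epsilon>: "\<epsilon> > 0"
  shows "\<exists>tf\<ge>0. \<exists>\<omega>0>0. \<forall>\<omega>>\<omega>0. \<forall>t0. \<forall>q0\<in>K. V q0 \<le> l0 \<longrightarrow>
      all_solutions (F \<omega>) \<Omega> t0 q0
        (\<lambda>q. \<forall>t\<ge>t0. t \<ge> t0 + tf \<or> V q0 \<le> l \<longrightarrow> norm (q t - c) < \<epsilon>)"
proof -
  define \<rho> where "\<rho> = min (\<epsilon> / 2) (R / 2)"
  have "\<rho> > 0" using \<epsilon> R by (simp add: \<rho>_def)
  from descent[OF l0 l this] obtain \<gamma> \<omega>1 where \<gamma>: "\<gamma> > 0" "\<omega>1 > 0" and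
    desc: "\<And>\<omega> t0 q k. \<omega> > \<omega>1 \<Longrightarrow> q t0 \<in> K \<Longrightarrow> V (q t0) \<le> l0 \<Longrightarrow>
      solves_on (retracted K (F \<omega>)) UNIV {t0..} q \<Longrightarrow>
      descends l \<rho> \<gamma> (2 * pi / \<omega>) t0 q k"
    by blast
  obtain \<omega>2 where \<omega>2: "\<omega>2 > 0" "\<And>\<omega> t x. \<omega> > \<omega>2 \<Longrightarrow> x \<in> K \<Longrightarrow> norm (F \<omega> t x) * (2 * pi / \<omega>) \<le> 1"
    using F_small[of 1] by auto
  \<comment> \<open>The entry \<open>2 * pi\<close> makes the period shorter than 1.\<close>
  define \<omega>0 where "\<omega>0 = Max {\<omega>1, \<omega>2, 2 * pi}"
  \<comment> \<open>At rate \<open>\<gamma>\<close> the height \<open>l0\<close> is consumed in time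
    \<open>l0 / \<gamma>\<close>. The added 1 compensates for the last grid point before
    \<open>t\<close>, which may lie up to one period earlier.\<close>
  define tf where "tf = l0 / \<gamma> + 1"
  have "tf \<ge> 0" using l \<gamma> by (simp add: tf_def)
  have "\<omega>0 > 0" using \<gamma> by (simp add: \<omega>0_def less_max_iff_disj)
  moreover have "all_solutions (F \<omega>) \<Omega> t0 q0
        (\<lambda>q. \<forall>t\<ge>t0. t \<ge> t0 + tf \<or> V q0 \<le> l \<longrightarrow> norm (q t - c) < \<epsilon>)"
    if \<omega>: "\<omega> > \<omega>0" and q0: "q0 \<in> K" "V q0 \<le> l0" for \<omega> t0 q0
  proof -
    have \<omega>': "\<omega> > \<omega>1" "\<omega> > \<omega>2" "\<omega> > 2 * pi" using \<omega> by (auto simp: \<omega>0_def)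
    have "\<omega> > 0" using \<omega>'(1) \<gamma> by simp
    obtain L where L: "\<And>t x y. x \<in> K \<Longrightarrow> y \<in> K \<Longrightarrow> norm (F \<omega> t x - F \<omega> t y) \<le> L * norm (x - y)"
      using F_lipschitz[OF \<open>\<omega> > 0\<close>] by blast
    show ?thesis
    proof (rule all_solutionsI[OF sub R F_cont[OF \<open>\<omega> > 0\<close>] _ L])
      show "norm (F \<omega> t x) \<le> \<omega> / (2 * pi)" if "x \<in> K" for t x
        using \<omega>2(2)[OF \<omega>'(2) that] \<open>\<omega> > 0\<close> by (simp add: field_simps)
      show "\<forall>t\<ge>t0. t \<ge> t0 + tf \<or> V q0 \<le> l \<longrightarrow> norm (p t - c) < \<epsilon>"
        if "\<forall>t\<ge>t0. t \<ge> t0 + tf \<or> V q0 \<le> l \<longrightarrow> norm (q t - c) < \<epsilon>" "\<And>t. t \<ge> t0 \<Longrightarrow> p t = q t" for p q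
        using that by simp
      fix q assume q: "q t0 = q0" "solves_on (retracted K (F \<omega>)) UNIV {t0..} q"
      define T where "T = 2 * pi / \<omega>"
      have T: "T > 0" "T < 1" using \<open>\<omega> > 0\<close> \<omega>'(3) by (auto simp: T_def)
      have "norm (q t - c) < R \<and> (t \<ge> t0 + tf \<or> V q0 \<le> l \<longrightarrow> norm (q t - c) < \<epsilon>)" if t: "t \<ge> t0" for t
      proof -
        obtain k :: nat where k: "t \<in> {t0 + real k * T..t0 + real k * T + T}"
          by (rule grid_point[OF t T(1)])
        let ?s = "t0 + real k * T"
        from desc[OF \<omega>'(1) _ _ q(2), of k] q0 q(1) k
        have d: "q ?s \<in> K" "V (q ?s) \<le> max l (V q0 - real k * \<gamma> * T)" "norm (q t - q ?s) \<le> \<rho>"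
          unfolding T_def[symmetric] descends_def by auto
        have tri: "norm (q t - c) \<le> norm (q t - q ?s) + norm (q ?s - c)"
          using norm_triangle_ineq[of "q t - q ?s" "q ?s - c"] by simp
        have "0 \<le> real k * \<gamma> * T" using \<gamma> T by simp
        then have "V (q ?s) \<le> l0" using d(2) l q0 by linarith
        then have "norm (q t - c) < R" using l0[OF d(1)] d(3) tri by (simp add: \<rho>_def)
        moreover have "norm (q t - c) < \<epsilon>" if "t \<ge> t0 + tf \<or> V q0 \<le> l"
        proof -
          have "V q0 - real k * \<gamma> * T \<le> l" if "t \<ge> t0 + tf"
          proof -
            have "l0 / \<gamma> \<le> real k * T" using that k T by (auto simp: tf_def)
            then have "l0 \<le> real k * \<gamma> * T" using \<gamma> by (simp add: field_simps)
            then show ?thesis using q0 l by linarith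
          qed
          then have "V (q ?s) \<le> l" using that d(2) \<open>0 \<le> real k * \<gamma> * T\<close> by force
          then show ?thesis using r[OF d(1)] d(3) tri by (simp add: \<rho>_def)
        qed
        ultimately show ?thesis by blast
      qed
      then show "(\<forall>t\<ge>t0. t \<ge> t0 + tf \<or> V q0 \<le> l \<longrightarrow> norm (q t - c) < \<epsilon>) \<and> (\<forall>t\<ge>t0. norm (q t - c) < R)"
        by blast
    qed
  qed
  ultimately show ?thesis using \<open>tf \<ge> 0\<close> by blast
qed

text \<open>For stability the level \<open>l\<close> is fitted to \<open>\<epsilon>\<close> and also
  plays the role of \<open>l0\<close>. For attractivity the order of quantifiers matters:
  \<open>l0\<close> and \<open>\<delta>\<close> are fixed before \<open>\<epsilon>\<close>, and only
  \<open>tf\<close> and \<open>\<omega>0\<close> depend on it.\<close>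

theorem practical_asymptotic_stability:
  assumes sub: "cball c R \<subseteq> \<Omega>"
  shows "practically_uniformly_asymptotically_stable F \<Omega> S c"
  unfolding practically_uniformly_asymptotically_stable_def
proof
  show "practically_uniformly_stable F \<Omega> S c"
    unfolding practically_uniformly_stable_def
  proof (intro allI impI)
    fix \<epsilon> :: real assume "\<epsilon> > 0"
    then have "min (\<epsilon> / 2) (R / 2) > 0" using R by simp
    then obtain l where l: "l > 0" "\<And>x. x \<in> K \<Longrightarrow> V x \<le> l \<Longrightarrow> norm (x - c) < min (\<epsilon> / 2) (R / 2)"
      using sublevel_small[OF V_cont V_pos] by blast
    obtain \<delta> where \<delta>: "\<delta> > 0" "\<And>x. norm (x - c) < \<delta> \<Longrightarrow> x \<in> K \<and> V x \<le> l"
      using V_small_near[OF l(1)] by blast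
    have "\<exists>tf\<ge>0. \<exists>\<omega>0>0. \<forall>\<omega>>\<omega>0. \<forall>t0. \<forall>q0\<in>K. V q0 \<le> l \<longrightarrow>
      all_solutions (F \<omega>) \<Omega> t0 q0
        (\<lambda>q. \<forall>t\<ge>t0. t \<ge> t0 + tf \<or> V q0 \<le> l \<longrightarrow> norm (q t - c) < \<epsilon>)"
      by (rule confined[OF sub _ l(1)]) (use l \<open>\<epsilon> > 0\<close> in auto)
    then obtain tf \<omega>0 where \<omega>0: "\<omega>0 > 0" "\<And>\<omega> t0 q0. \<omega> > \<omega>0 \<Longrightarrow> q0 \<in> K \<Longrightarrow> V q0 \<le> l \<Longrightarrow>
      all_solutions (F \<omega>) \<Omega> t0 q0
        (\<lambda>q. \<forall>t\<ge>t0. t \<ge> t0 + tf \<or> V q0 \<le> l \<longrightarrow> norm (q t - c) < \<epsilon>)"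
      by blast
    have "all_solutions (F \<omega>) \<Omega> t0 q0 (\<lambda>q. \<forall>t\<ge>t0. norm (q t - c) < \<epsilon>)"
      if "\<omega> > \<omega>0" "norm (q0 - c) < \<delta>" for \<omega> t0 q0
      by (rule all_solutions_mono[OF \<omega>0(2)[OF that(1)]]) (use \<delta>(2)[OF that(2)] in auto)
    then show "\<exists>\<delta>>0. \<exists>\<omega>0>0. \<forall>\<omega>>\<omega>0. \<forall>t0\<ge>0. \<forall>q0\<in>\<Omega> \<inter> S. norm (q0 - c) < \<delta> \<longrightarrow>
        all_solutions (F \<omega>) \<Omega> t0 q0 (\<lambda>q. \<forall>t\<ge>t0. norm (q t - c) < \<epsilon>)"
      using \<delta>(1) \<omega>0(1) by blast
  qed
  have "R / 2 > 0" using R by simp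
  then obtain l0 where l0: "l0 > 0" "\<And>x. x \<in> K \<Longrightarrow> V x \<le> l0 \<Longrightarrow> norm (x - c) < R / 2"
    using sublevel_small[OF V_cont V_pos] by blast
  obtain \<delta> where \<delta>: "\<delta> > 0" "\<And>x. norm (x - c) < \<delta> \<Longrightarrow> x \<in> K \<and> V x \<le> l0"
    using V_small_near[OF l0(1)] by blast
  show "practically_uniformly_attractive F \<Omega> S c"
    unfolding practically_uniformly_attractive_def
  proof (rule exI[of _ \<delta>], intro conjI allI impI)
    fix \<epsilon> :: real assume "\<epsilon> > 0"
    then have "\<epsilon> / 2 > 0" by simp
    then obtain l where l: "l > 0" "\<And>x. x \<in> K \<Longrightarrow> V x \<le> l \<Longrightarrow> norm (x - c) < \<epsilon> / 2"
      using sublevel_small[OF V_cont V_pos] by blast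
    have "\<exists>tf\<ge>0. \<exists>\<omega>0>0. \<forall>\<omega>>\<omega>0. \<forall>t0. \<forall>q0\<in>K. V q0 \<le> l0 \<longrightarrow>
      all_solutions (F \<omega>) \<Omega> t0 q0
        (\<lambda>q. \<forall>t\<ge>t0. t \<ge> t0 + tf \<or> V q0 \<le> min l l0 \<longrightarrow> norm (q t - c) < \<epsilon>)"
      by (rule confined[OF sub l0(2)]) (use l l0 \<open>\<epsilon> > 0\<close> in auto)
    then obtain tf \<omega>0 where tf: "tf \<ge> 0" and \<omega>0: "\<omega>0 > 0" "\<And>\<omega> t0 q0. \<omega> > \<omega>0 \<Longrightarrow> q0 \<in> K \<Longrightarrow> V q0 \<le> l0 \<Longrightarrow>
      all_solutions (F \<omega>) \<Omega> t0 q0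
        (\<lambda>q. \<forall>t\<ge>t0. t \<ge> t0 + tf \<or> V q0 \<le> min l l0 \<longrightarrow> norm (q t - c) < \<epsilon>)"
      by blast
    have "all_solutions (F \<omega>) \<Omega> t0 q0 (\<lambda>q. \<forall>t\<ge>t0 + tf. norm (q t - c) < \<epsilon>)"
      if "\<omega> > \<omega>0" "norm (q0 - c) < \<delta>" for \<omega> t0 q0
    proof (rule all_solutions_mono[OF \<omega>0(2)[OF that(1)]])
      show "\<forall>t\<ge>t0 + tf. norm (q t - c) < \<epsilon>"
        if "\<forall>t\<ge>t0. t \<ge> t0 + tf \<or> V q0 \<le> min l l0 \<longrightarrow> norm (q t - c) < \<epsilon>" for q
        using that tf by auto
    qed (use \<delta>(2)[OF that(2)] in auto)
    then show "\<exists>tf\<ge>0. \<exists>\<omega>0>0. \<forall>\<omega>>\<omega>0. \<forall>t0\<ge>0. \<forall>q0\<in>\<Omega> \<inter> S. norm (q0 - c) < \<delta> \<longrightarrow>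
        all_solutions (F \<omega>) \<Omega> t0 q0 (\<lambda>q. \<forall>t\<ge>t0 + tf. norm (q t - c) < \<epsilon>)"
      using tf \<omega>0(1) by blast
  qed (rule \<delta>(1))
qed

end

section \<open>Trigonometric weights and resonances\<close>

text \<open>Sines are included through the phase \<open>- (pi / 2)\<close>. One family then covers
  all coefficients, and for \<open>n > 0\<close> also their primitives up to constants.\<close>

definition trig :: "nat \<Rightarrow> real \<Rightarrow> real \<Rightarrow> real" where
  "trig n d \<tau> = cos (real n * \<tau> + d)"

lemma sin_period: "sin (of_int k * (\<tau> + 2 * pi) + d) = sin (of_int k * \<tau> + d)"
proof -
  have "sin (of_int k * (\<tau> + 2 * pi) + d) = sin ((of_int k * \<tau> + d) + 2 * pi * of_int k)"
    by (simp add: algebra_simps)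
  also have "\<dots> = sin (of_int k * \<tau> + d)"
    using cos_int_2pin[of k] sin_int_2pin[of k] by (simp only: sin_add) (simp add: mult.commute)
  finally show ?thesis .
qed

lemma has_integral_cos_period:
  "((\<lambda>\<tau>. cos (of_int k * \<tau> + d)) has_integral (if k = 0 then 2 * pi * cos d else 0)) {s..s + 2 * pi}"
proof (cases "k = 0")
  case True
  then show ?thesis using has_integral_const_real[of "cos d" s "s + 2 * pi"] by simp
next
  case False
  have "((\<lambda>\<tau>. cos (of_int k * \<tau> + d)) has_integral
      sin (of_int k * (s + 2 * pi) + d) / of_int k - sin (of_int k * s + d) / of_int k) {s..s + 2 * pi}"
    using False
    by (intro fundamental_theorem_of_calculus)
      (auto intro!: derivative_eq_intros simp: has_real_derivative_iff_has_vector_derivative[symmetric])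
  then show ?thesis using False by (simp add: sin_period)
qed

text \<open>Integer frequencies, because differences of the given ones may be negative.\<close>

lemma has_integral_cos_cos:
  "((\<lambda>\<tau>. cos (of_int k * \<tau> + d) * cos (of_int l * \<tau> + e)) has_integral
     pi * ((if k + l = 0 then cos (d + e) else 0) + (if k = l then cos (d - e) else 0))) {s..s + 2 * pi}"
proof -
  have "((\<lambda>\<tau>. (cos (of_int (k + l) * \<tau> + (d + e)) + cos (of_int (k - l) * \<tau> + (d - e))) / 2) has_integral
     ((if k + l = 0 then 2 * pi * cos (d + e) else 0) + (if k - l = 0 then 2 * pi * cos (d - e) else 0)) / 2)
     {s..s + 2 * pi}"
    by (intro has_integral_divide has_integral_add has_integral_cos_period)
  moreover have "(cos (of_int (k + l) * \<tau> + (d + e)) + cos (of_int (k - l) * \<tau> + (d - e))) / 2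
      = cos (of_int k * \<tau> + d) * cos (of_int l * \<tau> + e)" for \<tau> :: real
  proof -
    have "of_int (k + l) * \<tau> + (d + e) = (of_int k * \<tau> + d) + (of_int l * \<tau> + e)"
      "of_int (k - l) * \<tau> + (d - e) = (of_int k * \<tau> + d) - (of_int l * \<tau> + e)"
      by (auto simp: algebra_simps)
    then show ?thesis by (simp only: cos_add cos_diff) simp
  qed
  moreover have "((if k + l = 0 then 2 * pi * cos (d + e) else 0) + (if k - l = 0 then 2 * pi * cos (d - e) else 0)) / 2
    = pi * ((if k + l = 0 then cos (d + e) else 0) + (if k = l then cos (d - e) else 0))"
    by (auto simp: field_simps)
  ultimately show ?thesis by (simp only:)
qed

lemma mean_trig: "mean (\<lambda>_. trig n d) s = (if n = 0 then 2 * pi * cos d else 0)"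
  using has_integral_cos_period[of "int n" d s] unfolding mean_def trig_def
  by (intro integral_unique) simp

lemma prim_eq:
  assumes "s \<le> t" "\<And>x. x \<in> {s..t} \<Longrightarrow> (f has_real_derivative w s x) (at x)"
  shows "prim w s t = f t - f s"
  unfolding prim_def using assms
  by (intro integral_unique fundamental_theorem_of_calculus)
    (auto simp: has_real_derivative_iff_has_vector_derivative[symmetric] intro: has_field_derivative_at_within)

text \<open>For equal frequencies this is antisymmetric in the two phases; that is how Lie brackets
  arise from sums over ordered pairs.\<close>

definition trig_coeff2 :: "nat \<Rightarrow> real \<Rightarrow> nat \<Rightarrow> real \<Rightarrow> real" where
  "trig_coeff2 n d m e = (if n = m then pi / real n * sin (d - e) else 0)"

text \<open>
  If \<open>n = m\<close> then the second summand vanishes because of \<open>x / 0 = 0\<close>; in this case the phases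
  are supposed to agree, so that the resonant term it stands for is indeed absent.
\<close>

definition trig_coeff3 :: "nat \<Rightarrow> real \<Rightarrow> nat \<Rightarrow> real \<Rightarrow> nat \<Rightarrow> real \<Rightarrow> real" where
  "trig_coeff3 n d m e l f = - pi / (2 * real n) *
     ((if n + m = l then cos (d + e - f) else 0) / (real n + real m) +
      ((if n = m + l then cos (d - e - f) else 0) + (if m = n + l then cos (d - e + f) else 0)) / (real n - real m))"

lemma prim_trig:
  assumes "n > 0" "s \<le> t"
  shows "prim (\<lambda>_. trig n d) s t = (cos (real n * t + (d - pi / 2)) - sin (real n * s + d)) / real n"
proof -
  have "prim (\<lambda>_. trig n d) s t = sin (real n * t + d) / real n - sin (real n * s + d) / real n"
    using assms by (intro prim_eq) (auto simp: trig_def intro!: derivative_eq_intros)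
  moreover have "sin (real n * t + d) = cos (real n * t + (d - pi / 2))"
    using cos_diff[of "real n * t + d" "pi / 2"] by (simp add: algebra_simps)
  ultimately show ?thesis by (simp add: diff_divide_distrib)
qed

text \<open>The constant of integration depends on the start \<open>s\<close>, but it multiplies a
  cosine of mean zero. Hence the value is the same for every period.\<close>

lemma mean_trig2:
  assumes n: "n > 0" and m: "m > 0"
  shows "mean (\<lambda>\<tau>0 \<tau>. prim (\<lambda>_. trig n d) \<tau>0 \<tau> * trig m e \<tau>) s = trig_coeff2 n d m e"
proof -
  define S where "S = sin (real n * s + d)"
  have "((\<lambda>\<tau>. 1 / real n * (cos (of_int (int n) * \<tau> + (d - pi / 2)) * cos (of_int (int m) * \<tau> + e))
        - S / real n * cos (of_int (int m) * \<tau> + e)) has_integral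
      1 / real n * (pi * ((if int n + int m = 0 then cos (d - pi / 2 + e) else 0)
         + (if int n = int m then cos (d - pi / 2 - e) else 0)))
      - S / real n * (if int m = 0 then 2 * pi * cos e else 0)) {s..s + 2 * pi}"
    by (intro has_integral_diff has_integral_mult_right has_integral_cos_cos has_integral_cos_period)
  moreover have "cos (d - pi / 2 - e) = sin (d - e)"
    using cos_diff[of "d - e" "pi / 2"] by (simp add: algebra_simps)
  ultimately have "((\<lambda>\<tau>. 1 / real n * (cos (real n * \<tau> + (d - pi / 2)) * cos (real m * \<tau> + e))
        - S / real n * cos (real m * \<tau> + e)) has_integral trig_coeff2 n d m e) {s..s + 2 * pi}"
    using n m by (cases "n = m") (simp_all add: trig_coeff2_def)
  then have "((\<lambda>\<tau>. prim (\<lambda>_. trig n d) s \<tau> * trig m e \<tau>) has_integral trig_coeff2 n d m e) {s..s + 2 * pi}"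
    by (rule has_integral_eq[rotated])
      (use n in \<open>simp add: prim_trig S_def[symmetric] trig_def diff_divide_distrib left_diff_distrib\<close>)
  then show ?thesis by (simp add: mean_def integral_unique)
qed

text \<open>All dependence on the start \<open>s\<close> must disappear. The constant
  \<open>\<Phi> s\<close> meets a cosine of mean zero; the term with \<open>S\<close> can resonate
  only for \<open>m = l\<close>, and there equal phases turn its coefficient into the cosine of a
  right angle. Equal phases for \<open>n = m\<close> keep the mean of the inner product zero, so
  that its primitive is periodic.\<close>

lemma mean_trig3:
  assumes n: "n > 0" and m: "m > 0" and l: "l > 0"
    and nm: "n = m \<Longrightarrow> d = e" and ml: "m = l \<Longrightarrow> e = f"
  shows "mean (\<lambda>\<tau>0 \<tau>. prim (\<lambda>\<tau>0 \<tau>. prim (\<lambda>_. trig n d) \<tau>0 \<tau> * trig m e \<tau>) \<tau>0 \<tau> * trig l f \<tau>) s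
    = trig_coeff3 n d m e l f"
proof -
  define S where "S = sin (real n * s + d)"
  define \<Phi> where "\<Phi> \<tau> = - 1 / (2 * real n * (real n + real m)) * cos (of_int (int n + int m) * \<tau> + (d + e))
      - 1 / (2 * real n * (real n - real m)) * cos (of_int (int n - int m) * \<tau> + (d - e))
      - S / (real n * real m) * cos (of_int (int m) * \<tau> + (e - pi / 2))" for \<tau>
  have deriv: "(\<Phi> has_real_derivative prim (\<lambda>_. trig n d) s \<tau> * trig m e \<tau>) (at \<tau>)" if "s \<le> \<tau>" for \<tau>
  proof -
    let ?a = "real n * \<tau> + d" and ?b = "real m * \<tau> + e"
    have "(\<Phi> has_real_derivative
        1 / (2 * real n * (real n + real m)) * (sin (of_int (int n + int m) * \<tau> + (d + e)) * of_int (int n + int m))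
      + 1 / (2 * real n * (real n - real m)) * (sin (of_int (int n - int m) * \<tau> + (d - e)) * of_int (int n - int m))
      + S / (real n * real m) * (sin (of_int (int m) * \<tau> + (e - pi / 2)) * of_int (int m))) (at \<tau>)"
      unfolding \<Phi>_def by (rule derivative_eq_intros refl | simp)+
    moreover have "sin (of_int (int n + int m) * \<tau> + (d + e)) = sin (?a + ?b)"
      "sin (of_int (int n - int m) * \<tau> + (d - e)) = sin (?a - ?b)"
      by (simp_all add: algebra_simps)
    moreover have "sin (of_int (int m) * \<tau> + (e - pi / 2)) = - cos ?b"
      using sin_diff[of ?b "pi / 2"] by (simp add: algebra_simps)
    moreover have "1 / (2 * real n * (real n + real m)) * (sin (?a + ?b) * of_int (int n + int m)) = sin (?a + ?b) / (2 * real n)"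
      using n m by (simp add: add_eq_0_iff_both_eq_0)
    \<comment> \<open>For \<open>n = m\<close> both sides are zero: the left one by division by
      zero, the right one because equal phases give \<open>?a = ?b\<close>.\<close>
    moreover have "1 / (2 * real n * (real n - real m)) * (sin (?a - ?b) * of_int (int n - int m)) = sin (?a - ?b) / (2 * real n)"
      using nm by (cases "n = m") simp_all
    moreover have "S / (real n * real m) * (- cos ?b * of_int (int m)) = - S / real n * cos ?b"
      using n m by simp
    ultimately have "(\<Phi> has_real_derivative sin (?a + ?b) / (2 * real n) + sin (?a - ?b) / (2 * real n) + - S / real n * cos ?b) (at \<tau>)"
      by (simp only:)
    moreover have "sin (?a + ?b) / (2 * real n) + sin (?a - ?b) / (2 * real n) + - S / real n * cos ?b
        = (sin ?a - S) / real n * cos ?b"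
      using n unfolding sin_add sin_diff by (simp add: field_simps)
    moreover have "sin ?a = cos (real n * \<tau> + (d - pi / 2))"
      using cos_diff[of ?a "pi / 2"] by (simp add: algebra_simps)
    ultimately show ?thesis using prim_trig[OF n that, of d] by (simp add: S_def trig_def)
  qed
  have prim: "prim (\<lambda>\<tau>0 \<tau>. prim (\<lambda>_. trig n d) \<tau>0 \<tau> * trig m e \<tau>) s \<tau> = \<Phi> \<tau> - \<Phi> s" if "s \<le> \<tau>" for \<tau>
    by (rule prim_eq[OF that]) (use deriv in auto)
  have "((\<lambda>\<tau>. - 1 / (2 * real n * (real n + real m)) * (cos (of_int (int n + int m) * \<tau> + (d + e)) * cos (of_int (int l) * \<tau> + f))
      - 1 / (2 * real n * (real n - real m)) * (cos (of_int (int n - int m) * \<tau> + (d - e)) * cos (of_int (int l) * \<tau> + f))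
      - S / (real n * real m) * (cos (of_int (int m) * \<tau> + (e - pi / 2)) * cos (of_int (int l) * \<tau> + f))
      - \<Phi> s * cos (of_int (int l) * \<tau> + f)) has_integral
    - 1 / (2 * real n * (real n + real m)) * (pi * ((if int n + int m + int l = 0 then cos (d + e + f) else 0)
        + (if int n + int m = int l then cos (d + e - f) else 0)))
    - 1 / (2 * real n * (real n - real m)) * (pi * ((if int n - int m + int l = 0 then cos (d - e + f) else 0)
        + (if int n - int m = int l then cos (d - e - f) else 0)))
    - S / (real n * real m) * (pi * ((if int m + int l = 0 then cos (e - pi / 2 + f) else 0)
        + (if int m = int l then cos (e - pi / 2 - f) else 0)))
    - \<Phi> s * (if int l = 0 then 2 * pi * cos f else 0)) {s..s + 2 * pi}"
    by (intro has_integral_diff has_integral_mult_right has_integral_cos_cos has_integral_cos_period)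
  moreover have "- 1 / (2 * real n * (real n + real m)) * (pi * ((if int n + int m + int l = 0 then cos (d + e + f) else 0)
        + (if int n + int m = int l then cos (d + e - f) else 0)))
    - 1 / (2 * real n * (real n - real m)) * (pi * ((if int n - int m + int l = 0 then cos (d - e + f) else 0)
        + (if int n - int m = int l then cos (d - e - f) else 0)))
    - S / (real n * real m) * (pi * ((if int m + int l = 0 then cos (e - pi / 2 + f) else 0)
        + (if int m = int l then cos (e - pi / 2 - f) else 0)))
    - \<Phi> s * (if int l = 0 then 2 * pi * cos f else 0) = trig_coeff3 n d m e l f"
  proof -
    have "(int n + int m + int l = 0) = False" "(int m + int l = 0) = False" "(int l = 0) = False"
      "(int n + int m = int l) = (n + m = l)" "(int n - int m + int l = 0) = (m = n + l)"
      "(int n - int m = int l) = (n = m + l)" "(int m = int l) = (m = l)"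
      using n m l by auto
    moreover have "(if m = l then cos (e - pi / 2 - f) else 0) = 0"
      using ml by simp
    ultimately show ?thesis
      by (simp add: trig_coeff3_def divide_simps) (simp add: algebra_simps)
  qed
  moreover have "- 1 / (2 * real n * (real n + real m)) * (cos (of_int (int n + int m) * \<tau> + (d + e)) * cos (of_int (int l) * \<tau> + f))
      - 1 / (2 * real n * (real n - real m)) * (cos (of_int (int n - int m) * \<tau> + (d - e)) * cos (of_int (int l) * \<tau> + f))
      - S / (real n * real m) * (cos (of_int (int m) * \<tau> + (e - pi / 2)) * cos (of_int (int l) * \<tau> + f))
      - \<Phi> s * cos (of_int (int l) * \<tau> + f) = (\<Phi> \<tau> - \<Phi> s) * trig l f \<tau>" for \<tau>
    unfolding trig_def \<Phi>_def[of \<tau>] by (simp add: left_diff_distrib mult.assoc)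
  ultimately have "((\<lambda>\<tau>. (\<Phi> \<tau> - \<Phi> s) * trig l f \<tau>) has_integral trig_coeff3 n d m e l f) {s..s + 2 * pi}"
    by (simp only:)
  then have "((\<lambda>\<tau>. prim (\<lambda>\<tau>0 \<tau>. prim (\<lambda>_. trig n d) \<tau>0 \<tau> * trig m e \<tau>) s \<tau> * trig l f \<tau>) has_integral
      trig_coeff3 n d m e l f) {s..s + 2 * pi}"
    by (rule has_integral_eq[rotated]) (simp add: prim)
  then show ?thesis by (simp add: mean_def integral_unique)
qed

text \<open>The coefficient vector is the sum of the unit vectors at \<open>a\<close> and
  \<open>b\<close> minus the one at \<open>c\<close>. Positivity keeps \<open>c\<close> apart from
  both, so the absolute values add up to 3 even if \<open>a = b\<close>. Only the imposed relations
  remain, and they have no coefficient 2.\<close>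

lemma resonant_triple:
  fixes \<nu> :: "'n::finite \<Rightarrow> nat \<Rightarrow> nat"
  assumes nr: "non_resonant \<kappa> \<nu>" and pos: "\<And>i s. s \<in> {1..4} \<Longrightarrow> \<nu> i s > 0"
    and a: "a \<in> UNIV \<times> {1..4}" and b: "b \<in> UNIV \<times> {1..4}" and c: "c \<in> UNIV \<times> {1..4}"
    and eq: "case_prod \<nu> a + case_prod \<nu> b = case_prod \<nu> c"
  shows "(\<exists>i. c = (i, 3) \<and> (a = (i, 1) \<and> b = (i, 2) \<or> a = (i, 2) \<and> b = (i, 1))) \<or>
    (\<exists>i. c = (i, 2) \<and> (a = (i, 1) \<and> b = (i, 4) \<or> a = (i, 4) \<and> b = (i, 1)))"
proof -
  let ?A = "UNIV \<times> {1..4} :: ('n \<times> nat) set"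
  define m :: "'n \<times> nat \<Rightarrow> int" where "m s = of_bool (s = a) + of_bool (s = b) - of_bool (s = c)" for s
  have pa: "case_prod \<nu> a > 0" and pb: "case_prod \<nu> b > 0" using pos a b by auto
  have ca: "c \<noteq> a" and cb: "c \<noteq> b" using eq pa pb by auto
  have delta: "(\<Sum>s\<in>?A. of_bool (s = t) * f s) = f t" if "t \<in> ?A" for t and f :: "'n \<times> nat \<Rightarrow> int"
  proof -
    have "(\<Sum>s\<in>?A. of_bool (s = t) * f s) = (\<Sum>s\<in>?A. if s = t then f s else 0)"
      by (rule sum.cong) auto
    then show ?thesis using that by (simp add: sum.delta)
  qed
  have "third_order_resonance ?A (\<lambda>(i, s). \<nu> i s) m"
    unfolding third_order_resonance_def
  proof (intro conjI)
    have "(\<Sum>s\<in>?A. m s * int (case_prod \<nu> s)) = int (case_prod \<nu> a) + int (case_prod \<nu> b) - int (case_prod \<nu> c)"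
      unfolding m_def left_diff_distrib distrib_right sum_subtractf sum.distrib
      by (simp only: delta[OF a, of "\<lambda>s. int (case_prod \<nu> s)"] delta[OF b, of "\<lambda>s. int (case_prod \<nu> s)"]
          delta[OF c, of "\<lambda>s. int (case_prod \<nu> s)"])
    then show "(\<Sum>s\<in>?A. m s * int (case s of (i, s) \<Rightarrow> \<nu> i s)) = 0" using eq by simp
    show "\<exists>s\<in>?A. m s \<noteq> 0" using c ca cb by (intro bexI[of _ c]) (auto simp: m_def)
    have "(\<Sum>s\<in>?A. \<bar>m s\<bar>) = (\<Sum>s\<in>?A. of_bool (s = a) * 1 + of_bool (s = b) * 1 + of_bool (s = c) * 1)"
      using ca cb by (intro sum.cong) (auto simp: m_def)
    then show "(\<Sum>s\<in>?A. \<bar>m s\<bar>) = 3"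
      unfolding sum.distrib using delta[OF a, of "\<lambda>_. 1"] delta[OF b, of "\<lambda>_. 1"] delta[OF c, of "\<lambda>_. 1"] by simp
  qed
  then have "imposed_relation m" using nr by (auto simp: non_resonant_def)
  then obtain i k where k: "k = 1 \<or> k = - 1" and imposed:
    "(\<forall>p\<in>?A. m p = (if p = (i, 3) then k else if p \<in> {(i, 1), (i, 2)} then - k else 0)) \<or>
     (\<forall>p\<in>?A. m p = (if p \<in> {(i, 4), (i, 1)} then k else if p = (i, 2) then - k else 0))"
    unfolding imposed_relation_def by blast
  from imposed show ?thesis
  proof
    assume *: "\<forall>p\<in>?A. m p = (if p = (i, 3) then k else if p \<in> {(i, 1), (i, 2)} then - k else 0)"
    have "m (i, 1) = - k" "m (i, 2) = - k" "m (i, 3) = k" using * by auto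
    \<comment> \<open>\<open>m\<close> is negative at \<open>c\<close> only, whereas the relation
      has the value \<open>- k\<close> at two places.\<close>
    moreover from this have "k = - 1"
      using k ca cb by (auto simp: m_def of_bool_def split: if_splits)
    ultimately show ?thesis using ca cb by (auto simp: m_def of_bool_def split: if_splits)
  next
    assume *: "\<forall>p\<in>?A. m p = (if p \<in> {(i, 4), (i, 1)} then k else if p = (i, 2) then - k else 0)"
    have "m (i, 1) = k" "m (i, 4) = k" "m (i, 2) = - k" using * by auto
    moreover from this have "k = 1"
      using k ca cb by (auto simp: m_def of_bool_def split: if_splits)
    ultimately show ?thesis using ca cb by (auto simp: m_def of_bool_def split: if_splits)
  qed
qed

lemma small_parameter:
  fixes \<mu>0 :: real
  assumes "\<mu>0 > 0"
  shows "\<exists>\<omega>0>0. \<forall>\<omega>>\<omega>0. 0 < \<omega> powr (- 1 / 6) \<and> \<omega> powr (- 1 / 6) < \<mu>0"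
proof -
  have "\<omega> powr (- 1 / 6) < \<mu>0" if "\<omega> > \<mu>0 powr - 6" for \<omega>
    using powr_less_mono2_neg[of "- 1 / 6" "\<mu>0 powr - 6" \<omega>] assms that by (simp add: powr_powr)
  moreover have "0 < \<omega> powr (- 1 / 6)" if "\<omega> > \<mu>0 powr - 6" for \<omega>
    using assms that by (auto dest: less_trans[rotated])
  ultimately show ?thesis using assms by (intro exI[of _ "\<mu>0 powr - 6"]) simp
qed

section \<open>From fast time back to the original time\<close>

context oscillating_system
begin

lemma osc_field_continuous: "continuous_on (UNIV \<times> K) (\<lambda>(t, z). osc_field \<mu> (\<omega> * t) z)"
proof -
  have "continuous_on (UNIV \<times> K) (\<lambda>x. u a (\<omega> * fst x))" if "a \<in> I" for a
    by (rule continuous_on_compose2[OF u_cont[OF that]]) (auto intro!: continuous_intros)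
  moreover have "continuous_on (UNIV \<times> K) (\<lambda>x. g a (snd x))" if "a \<in> I" for a
    by (rule continuous_on_compose2[OF g_continuous[OF that]])
      (use K_sub in \<open>auto intro!: continuous_on_snd continuous_on_id\<close>)
  ultimately show ?thesis
    unfolding osc_field_def case_prod_unfold
    by (intro continuous_on_sum continuous_on_scaleR continuous_on_mult continuous_on_const)
qed

lemma osc_field_lipschitz:
  assumes "convex K" "0 \<le> \<mu>"
  shows "\<exists>L. \<forall>\<tau>. \<forall>x\<in>K. \<forall>y\<in>K. norm (osc_field \<mu> \<tau> x - osc_field \<mu> \<tau> y) \<le> L * norm (x - y)"
proof -
  have "\<exists>L\<ge>0. \<forall>x\<in>K. \<forall>y\<in>K. \<bar>g a x \<bullet> e - g a y \<bullet> e\<bar> \<le> L * norm (x - y)"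
    if "a \<in> I" "e \<in> Basis" for a e
    using Ck_on_imp_lipschitz[OF open_\<Omega> g_Ck[OF that, folded Suc_1] compact_K assms(1) K_sub] by metis
  then obtain L where L: "\<And>a e. a \<in> I \<Longrightarrow> e \<in> Basis \<Longrightarrow> L a e \<ge> 0"
      "\<And>a e x y. a \<in> I \<Longrightarrow> e \<in> Basis \<Longrightarrow> x \<in> K \<Longrightarrow> y \<in> K \<Longrightarrow> \<bar>g a x \<bullet> e - g a y \<bullet> e\<bar> \<le> L a e * norm (x - y)"
    by metis
  have "norm (osc_field \<mu> \<tau> x - osc_field \<mu> \<tau> y) \<le> (\<Sum>a\<in>I. \<mu> ^ p a * (\<Sum>e\<in>Basis. L a e)) * norm (x - y)"
    if "x \<in> K" "y \<in> K" for \<tau> x y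
  proof -
    have "norm (osc_field \<mu> \<tau> x - osc_field \<mu> \<tau> y) = norm (\<Sum>a\<in>I. (\<mu> ^ p a * u a \<tau>) *\<^sub>R (g a x - g a y))"
      by (simp add: osc_field_def sum_subtractf scaleR_diff_right)
    also have "\<dots> \<le> (\<Sum>a\<in>I. \<mu> ^ p a * (\<Sum>e\<in>Basis. L a e) * norm (x - y))"
    proof (rule sum_norm_le)
      fix a assume a: "a \<in> I"
      have "norm (g a x - g a y) \<le> (\<Sum>e\<in>Basis. \<bar>(g a x - g a y) \<bullet> e\<bar>)" by (rule norm_le_l1)
      also have "\<dots> \<le> (\<Sum>e\<in>Basis. L a e * norm (x - y))"
        using L(2)[OF a _ that] by (intro sum_mono) (auto simp: inner_diff_left)
      finally have "norm (g a x - g a y) \<le> (\<Sum>e\<in>Basis. L a e) * norm (x - y)"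
        by (simp add: sum_distrib_right)
      moreover have "\<mu> ^ p a * \<bar>u a \<tau>\<bar> \<le> \<mu> ^ p a * 1"
        using u_le[OF a] assms(2) by (intro mult_left_mono) auto
      ultimately have "(\<mu> ^ p a * \<bar>u a \<tau>\<bar>) * norm (g a x - g a y) \<le> (\<mu> ^ p a * 1) * ((\<Sum>e\<in>Basis. L a e) * norm (x - y))"
        using assms(2) u_le[OF a] by (intro mult_mono) auto
      then show "norm ((\<mu> ^ p a * u a \<tau>) *\<^sub>R (g a x - g a y)) \<le> \<mu> ^ p a * (\<Sum>e\<in>Basis. L a e) * norm (x - y)"
        using assms(2) by (simp add: abs_mult mult.assoc)
    qed
    finally show ?thesis by (simp add: sum_distrib_right)
  qed
  then show ?thesis by blast
qed

text \<open>Under \<open>\<tau> = \<omega> * t\<close> a period of length \<open>2 * pi\<close>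
  becomes one of length \<open>2 * pi / \<omega>\<close>, and
  \<open>\<mu> ^ 6 = 1 / \<omega>\<close> turns the averaging error into a small multiple of that
  length. The factor \<open>2 * pi\<close> in front of \<open>G\<close> appears because
  \<open>averaged\<close> is an integral over the period, not a mean value.\<close>

lemma averaged_lyapunovI:
  assumes K: "K = cball c R" "R > 0"
    and F: "\<And>\<omega> t z. \<omega> > 0 \<Longrightarrow> z \<in> K \<Longrightarrow> F \<omega> t z = \<omega> *\<^sub>R osc_field (\<omega> powr (- 1 / 6)) (\<omega> * t) z"
    and m1: "\<And>a \<tau>0. a \<in> I \<Longrightarrow> mean (\<lambda>_. u a) \<tau>0 = (if p a = 6 then c1 a else 0)"
    and m2: "\<And>a b \<tau>0. a \<in> I \<Longrightarrow> b \<in> I \<Longrightarrow> p a + p b \<le> 6 \<Longrightarrow>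
      mean (u2 a b) \<tau>0 = (if p a + p b = 6 then c2 a b else 0)"
    and m3: "\<And>a b c \<tau>0. a \<in> I \<Longrightarrow> b \<in> I \<Longrightarrow> c \<in> I \<Longrightarrow> p a + p b + p c = 6 \<Longrightarrow>
      mean (u3 a b c) \<tau>0 = c3 a b c"
    and G: "\<And>e z. e \<in> Basis \<Longrightarrow> z \<in> K \<Longrightarrow> (2 * pi) *\<^sub>R G z \<bullet> e = averaged c1 c2 c3 e z"
    and G_cont: "continuous_on K G"
    and V: "\<And>x. x \<in> K \<Longrightarrow> (V has_derivative (\<lambda>h. V' x \<bullet> h)) (at x)" "continuous_on K V'"
      "V c = 0" "\<And>x. x \<in> K - {c} \<Longrightarrow> V x > 0" "\<And>x. x \<in> K - {c} \<Longrightarrow> V' x \<bullet> G x < 0"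
  shows "averaged_lyapunov F G V V' c R"
proof
  show "continuous_on (UNIV \<times> cball c R) (\<lambda>(t, x). F \<omega> t x)" if "\<omega> > 0" for \<omega>
  proof -
    have "continuous_on (UNIV \<times> K) (\<lambda>x. \<omega> *\<^sub>R (case x of (t, z) \<Rightarrow> osc_field (\<omega> powr (- 1 / 6)) (\<omega> * t) z))"
      by (intro continuous_on_scaleR continuous_on_const osc_field_continuous)
    then show ?thesis
      unfolding K(1)[symmetric] by (rule continuous_on_eq) (auto simp: F[OF that])
  qed
  show "\<exists>L. \<forall>t. \<forall>x\<in>cball c R. \<forall>y\<in>cball c R. norm (F \<omega> t x - F \<omega> t y) \<le> L * norm (x - y)"
    if "\<omega> > 0" for \<omega>
  proof -
    have "convex K" using K(1) by simp
    then obtain L where L: "\<And>\<tau> x y. x \<in> K \<Longrightarrow> y \<in> K \<Longrightarrow>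
        norm (osc_field (\<omega> powr (- 1 / 6)) \<tau> x - osc_field (\<omega> powr (- 1 / 6)) \<tau> y) \<le> L * norm (x - y)"
      using osc_field_lipschitz[OF _ powr_ge_zero, of \<omega> "- 1 / 6"] by blast
    have "norm (F \<omega> t x - F \<omega> t y) \<le> \<omega> * L * norm (x - y)" if xy: "x \<in> K" "y \<in> K" for t x y
      using mult_left_mono[OF L[OF xy, of "\<omega> * t"], of \<omega>] \<open>\<omega> > 0\<close>
      by (simp add: F xy scaleR_diff_right[symmetric] mult.assoc)
    then show ?thesis unfolding K(1)[symmetric] by blast
  qed
  show "\<exists>\<omega>0>0. \<forall>\<omega>>\<omega>0. \<forall>t. \<forall>x\<in>cball c R. norm (F \<omega> t x) * (2 * pi / \<omega>) \<le> \<eta>" if "\<eta> > 0" for \<eta>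
  proof -
    obtain C where C: "C > 0"
      "\<And>\<mu> \<tau> z. 0 \<le> \<mu> \<Longrightarrow> \<mu> \<le> 1 \<Longrightarrow> z \<in> K \<Longrightarrow> norm (osc_field \<mu> \<tau> z) \<le> C * \<mu>\<^sup>2"
      using osc_field_bound by blast
    have "min 1 (\<eta> / (2 * pi * C)) > 0" using C(1) that by simp
    from small_parameter[OF this] obtain \<omega>0 where \<omega>0: "\<omega>0 > 0" "\<And>\<omega>. \<omega> > \<omega>0 \<Longrightarrow>
        0 < \<omega> powr (- 1 / 6) \<and> \<omega> powr (- 1 / 6) < min 1 (\<eta> / (2 * pi * C))" by blast
    have "norm (F \<omega> t x) * (2 * pi / \<omega>) \<le> \<eta>" if "\<omega> > \<omega>0" "x \<in> K" for \<omega> t x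
    proof -
      define \<mu> where "\<mu> = \<omega> powr (- 1 / 6)"
      have \<mu>: "0 < \<mu>" "\<mu> < 1" "\<mu> < \<eta> / (2 * pi * C)" using \<omega>0(2)[OF that(1)] by (auto simp: \<mu>_def)
      have "norm (F \<omega> t x) * (2 * pi / \<omega>) = norm (osc_field \<mu> (\<omega> * t) x) * (2 * pi)"
        using F[of \<omega> x t] that \<omega>0(1) by (simp add: \<mu>_def)
      also have "\<dots> \<le> (C * \<mu>\<^sup>2) * (2 * pi)" using C(2)[of \<mu> x] \<mu> that by (intro mult_right_mono) auto
      also have "\<dots> \<le> (C * \<mu>) * (2 * pi)"
        using \<mu> C(1) by (intro mult_right_mono mult_left_mono) (auto simp: power2_eq_square)
      also have "\<dots> \<le> \<eta>" using \<mu>(3) C(1) by (simp add: field_simps)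
      finally show ?thesis .
    qed
    then show ?thesis unfolding K(1)[symmetric] using \<omega>0(1) by blast
  qed
  show "\<exists>\<omega>0>0. \<forall>\<omega>>\<omega>0. \<forall>s q. solves_on (F \<omega>) (cball c R) {s..s + 2 * pi / \<omega>} q \<longrightarrow>
      norm (q (s + 2 * pi / \<omega>) - q s - (2 * pi / \<omega>) *\<^sub>R G (q s)) \<le> \<eta> * (2 * pi / \<omega>)" if "\<eta> > 0" for \<eta>
  proof -
    have "2 * pi * \<eta> > 0" using that by simp
    from averaging[of c1 c2 c3 "\<lambda>z. (2 * pi) *\<^sub>R G z", OF m1 m2 m3 G this]
    obtain \<mu>0 where \<mu>0: "\<mu>0 > 0" "\<And>\<mu> \<tau>0 z. 0 < \<mu> \<Longrightarrow> \<mu> < \<mu>0 \<Longrightarrow> sol \<mu> \<tau>0 z \<Longrightarrow>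
        norm (z (\<tau>0 + 2 * pi) - z \<tau>0 - \<mu> ^ 6 *\<^sub>R ((2 * pi) *\<^sub>R G (z \<tau>0))) \<le> (2 * pi * \<eta>) * \<mu> ^ 6"
      by blast
    obtain \<omega>0 where \<omega>0: "\<omega>0 > 0" "\<And>\<omega>. \<omega> > \<omega>0 \<Longrightarrow> 0 < \<omega> powr (- 1 / 6) \<and> \<omega> powr (- 1 / 6) < \<mu>0"
      using small_parameter[OF \<mu>0(1)] by blast
    have "norm (q (s + 2 * pi / \<omega>) - q s - (2 * pi / \<omega>) *\<^sub>R G (q s)) \<le> \<eta> * (2 * pi / \<omega>)"
      if \<omega>: "\<omega> > \<omega>0" and q: "solves_on (F \<omega>) K {s..s + 2 * pi / \<omega>} q" for \<omega> s q
    proof -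
      define \<mu> where "\<mu> = \<omega> powr (- 1 / 6)"
      have \<mu>: "0 < \<mu>" "\<mu> < \<mu>0" using \<omega>0(2)[OF \<omega>] by (auto simp: \<mu>_def)
      have "\<omega> > 0" using \<omega> \<omega>0(1) by simp
      then have \<mu>6: "\<mu> ^ 6 = 1 / \<omega>"
        using powr_power[of \<omega> "- 1 / 6" 6] by (simp add: \<mu>_def powr_minus_divide)
      define z where "z \<tau> = q (\<tau> / \<omega>)" for \<tau>
      have "sol \<mu> (\<omega> * s) z"
        unfolding sol_def solves_on_def
      proof (intro ballI conjI)
        fix \<tau> assume \<tau>: "\<tau> \<in> {\<omega> * s..\<omega> * s + 2 * pi}"
        have mem: "r / \<omega> \<in> {s..s + 2 * pi / \<omega>}" if "r \<in> {\<omega> * s..\<omega> * s + 2 * pi}" for r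
          using that \<open>\<omega> > 0\<close> by (simp add: field_simps)
        show "z \<tau> \<in> K" using q mem[OF \<tau>] by (auto simp: z_def solves_on_def)
        have "(q has_vector_derivative F \<omega> (\<tau> / \<omega>) (q (\<tau> / \<omega>))) (at (\<tau> / \<omega>) within {s..s + 2 * pi / \<omega>})"
          using q mem[OF \<tau>] by (auto simp: solves_on_def)
        then have dq: "(q has_vector_derivative F \<omega> (\<tau> / \<omega>) (q (\<tau> / \<omega>)))
            (at (\<tau> / \<omega>) within (\<lambda>\<tau>. \<tau> / \<omega>) ` {\<omega> * s..\<omega> * s + 2 * pi})"
          by (rule has_vector_derivative_within_subset) (use mem in blast)
        have "((\<lambda>\<tau>. \<tau> / \<omega>) has_vector_derivative 1 / \<omega>) (at \<tau> within {\<omega> * s..\<omega> * s + 2 * pi})"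
          unfolding has_real_derivative_iff_has_vector_derivative[symmetric]
          using \<open>\<omega> > 0\<close> by (auto intro!: derivative_eq_intros)
        from vector_diff_chain_within[OF this dq]
        have "(z has_vector_derivative (1 / \<omega>) *\<^sub>R F \<omega> (\<tau> / \<omega>) (z \<tau>)) (at \<tau> within {\<omega> * s..\<omega> * s + 2 * pi})"
          by (simp add: z_def[abs_def] o_def)
        moreover have "(1 / \<omega>) *\<^sub>R F \<omega> (\<tau> / \<omega>) (z \<tau>) = osc_field \<mu> \<tau> (z \<tau>)"
          using F[OF \<open>\<omega> > 0\<close> \<open>z \<tau> \<in> K\<close>, of "\<tau> / \<omega>"] \<open>\<omega> > 0\<close> by (simp add: \<mu>_def)
        ultimately show "(z has_vector_derivative osc_field \<mu> \<tau> (z \<tau>)) (at \<tau> within {\<omega> * s..\<omega> * s + 2 * pi})"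
          by simp
      qed
      from \<mu>0(2)[OF \<mu> this] have "norm (z (\<omega> * s + 2 * pi) - z (\<omega> * s) - (1 / \<omega>) *\<^sub>R ((2 * pi) *\<^sub>R G (z (\<omega> * s))))
          \<le> (2 * pi * \<eta>) * (1 / \<omega>)"
        unfolding \<mu>6 .
      moreover have "z (\<omega> * s + 2 * pi) = q (s + 2 * pi / \<omega>)" "z (\<omega> * s) = q s"
        using \<open>\<omega> > 0\<close> by (auto simp: z_def add_divide_distrib)
      ultimately show ?thesis by (simp add: mult_ac)
    qed
    then show ?thesis unfolding K(1)[symmetric] using \<omega>0(1) by blast
  qed
qed (use K G_cont V in auto)

end

section \<open>The extremum seeking system\<close>

text \<open>Formulas for Lie derivatives hold only on an open set; this allows them to be
  differentiated once more.\<close>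

lemma lie_cong:
  assumes "open S" "z \<in> S" "\<And>z. z \<in> S \<Longrightarrow> h z = h' z"
  shows "lie g h z = lie g h' z"
proof -
  have "(h has_derivative D) (at z) \<longleftrightarrow> (h' has_derivative D) (at z)" for D
    using has_derivative_transform_within_open[OF _ assms(1,2)] assms(3) by metis
  then show ?thesis by (simp add: lie_def frechet_derivative_def)
qed

lemma lie_scale:
  assumes "Ck_on (Suc k) h S" "z \<in> S"
  shows "lie g (\<lambda>z. h z * c) z = lie g h z * c"
proof -
  have "(h has_derivative frechet_derivative h (at z)) (at z)"
    using Ck_on_has_derivative[OF assms] .
  then have "((\<lambda>z. h z * c) has_derivative (\<lambda>w. frechet_derivative h (at z) w * c)) (at z)"
    by (rule has_derivative_mult_left)
  from lie_eq[OF this, of g] show ?thesis by (simp only: lie_def)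
qed

lemma sum_over_grid:
  fixes f :: "'n::finite \<times> nat \<Rightarrow> 'b::comm_monoid_add"
  shows "(\<Sum>a\<in>UNIV \<times> {0..6}. f a) =
    (\<Sum>i\<in>UNIV. f (i, 0) + f (i, 1) + f (i, 2) + f (i, 3) + f (i, 4) + f (i, 5) + f (i, 6))"
proof -
  have "{0..6} = {0, 1, 2, 3, 4, 5, 6::nat}" by auto
  then have "(\<Sum>s\<in>{0..6}. h s) = h 0 + h 1 + h 2 + h 3 + h 4 + h 5 + h (6::nat)" for h :: "nat \<Rightarrow> 'b"
    by (simp add: add.assoc)
  moreover have "(\<Sum>a\<in>UNIV \<times> {0..6}. f a) = (\<Sum>i\<in>UNIV. \<Sum>s\<in>{0..6}. f (i, s))"
    by (simp add: sum.cartesian_product)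
  ultimately show ?thesis by simp
qed

lemma sum_single:
  assumes "finite I" "b \<in> I" "\<And>a. a \<in> I \<Longrightarrow> a \<noteq> b \<Longrightarrow> f a = 0"
  shows "sum f I = f b"
  using assms by (simp add: sum.remove sum.neutral)

lemma sum_axis: "(\<Sum>i\<in>UNIV. axis i (f i)) = (\<chi> i. (f i :: real))"
  by (simp add: vec_eq_iff axis_def sum.delta)

text \<open>Since \<open>2 * v * p\<^sup>2 \<le> v\<^sup>2 + p\<^sup>2 * p\<^sup>2\<close>, the
  mixed term costs half of the damping \<open>2 * b * v\<^sup>2\<close> and at most
  \<open>b * B * p\<^sup>2\<close>. The gradient term provides at least
  \<open>(b * B + 1) * p\<^sup>2\<close>.\<close>

lemma lyapunov_decrease:
  fixes p v P :: real
  assumes "M * a * w \<ge> b * B + 1" "w \<le> P" "M \<ge> 0" "a > 0" "b > 0" "p\<^sup>2 \<le> B"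
  shows "M * p * (- a * p * P) + 2 * v * (- b * v + b * p\<^sup>2) \<le> - (p\<^sup>2 + b * v\<^sup>2)"
proof -
  have "(b * B + 1) * p\<^sup>2 \<le> (M * a * P) * p\<^sup>2"
    using assms by (intro mult_right_mono order_trans[OF assms(1)] mult_left_mono) auto
  moreover have "b * (2 * v * p\<^sup>2) \<le> b * (v\<^sup>2 + B * p\<^sup>2)"
  proof (rule mult_left_mono)
    have "2 * v * p\<^sup>2 \<le> v\<^sup>2 + p\<^sup>2 * p\<^sup>2"
      using zero_le_power2[of "v - p\<^sup>2"] by (simp add: power2_eq_square algebra_simps)
    also have "p\<^sup>2 * p\<^sup>2 \<le> B * p\<^sup>2" using assms(6) by (intro mult_right_mono) auto
    finally show "2 * v * p\<^sup>2 \<le> v\<^sup>2 + B * p\<^sup>2" by simp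
  qed (use assms in simp)
  ultimately show ?thesis by (simp add: power2_eq_square algebra_simps)
qed

locale extremum_seeking =
  fixes D :: "(real^'n) set" and xs :: "real^'n" and J :: "real^'n \<Rightarrow> real"
    and \<phi>1 \<phi>2 \<psi>1 \<psi>2 :: "real \<Rightarrow> real"
    and \<epsilon> :: real and \<alpha> \<beta> :: "'n \<Rightarrow> real"
    and \<kappa> :: "'n \<Rightarrow> nat" and \<nu> :: "'n \<Rightarrow> nat \<Rightarrow> nat"
  assumes open_D: "open D" and xs: "xs \<in> D"
    and J_C2: "C2_on J D"
    and J_min: "\<And>x. x \<in> D - {xs} \<Longrightarrow> J x > J xs"
    and J_crit: "\<And>x. x \<in> D \<Longrightarrow> (GDERIV J x :> 0) \<longleftrightarrow> x = xs"
    and \<phi>_C2: "C2_on \<phi>1 UNIV" "C2_on \<phi>2 UNIV" and \<psi>_C2: "C2_on \<psi>1 UNIV" "C2_on \<psi>2 UNIV"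
    and \<phi>_bracket: "\<And>y. lie_bracket \<phi>1 \<phi>2 y = - 1"
    and \<psi>_bracket: "\<And>z. lie_bracket \<psi>1 \<psi>2 z = 1"
    and \<epsilon>: "\<epsilon> > 0" and \<alpha>: "\<And>i. \<alpha> i > 0" and \<beta>: "\<And>i. \<beta> i > 0"
    and \<kappa>: "\<And>i. \<kappa> i > 0" and \<nu>1: "\<And>i. \<nu> i 1 > 0" and \<nu>2: "\<And>i. \<nu> i 2 > 0"
    and \<nu>3: "\<And>i. \<nu> i 3 = \<nu> i 1 + \<nu> i 2"
    and \<nu>4: "\<And>i. int (\<nu> i 4) = int (\<nu> i 2) - int (\<nu> i 1)" "\<And>i. \<nu> i 4 > 0"
    and nr: "non_resonant \<kappa> \<nu>"
begin

definition \<Omega> :: "((real^'n) \<times> (real^'n)) set" where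
  "\<Omega> = {(x, v). x \<in> D \<and> (\<forall>i. v $ i > - \<epsilon>)}"

text \<open>
  The pairs \<open>(i, s)\<close> enumerate the vector fields: \<open>s = 0\<close> is the drift, \<open>s = 1, 2\<close> are the fields
  built from \<open>\<psi>1, \<psi>2\<close>, \<open>s = 3, 4\<close> arise from
  \<open>cos (\<nu> i 1 * \<tau>) * sin (\<nu> i 2 * \<tau>) = (sin (\<nu> i 3 * \<tau>) + sin (\<nu> i 4 * \<tau>)) / 2\<close>, and
  \<open>s = 5, 6\<close> are built from \<open>\<phi>1, \<phi>2\<close>.
\<close>

definition pw :: "'n \<times> nat \<Rightarrow> nat" where
  "pw a = (if snd a = 0 then 6 else if snd a \<le> 4 then 2 else 3)"

definition fr :: "'n \<times> nat \<Rightarrow> nat" where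
  "fr a = (if snd a = 0 then 0 else if snd a \<le> 4 then \<nu> (fst a) (snd a) else \<kappa> (fst a))"

text \<open>The listed indices are those whose time factor is a sine.\<close>

definition ph :: "'n \<times> nat \<Rightarrow> real" where
  "ph a = (if snd a \<in> {2, 3, 4, 6} then - (pi / 2) else 0)"

definition \<sigma> :: "'n \<Rightarrow> real" where
  "\<sigma> i = sqrt (4 * \<beta> i * ((real (\<nu> i 2))\<^sup>2 - (real (\<nu> i 1))\<^sup>2))"

definition \<rho> :: "'n \<Rightarrow> real" where
  "\<rho> i = sqrt (2 * \<alpha> i * real (\<kappa> i))"

definition A :: "'n \<times> nat \<Rightarrow> real^'n \<Rightarrow> real" where
  "A a x = (if snd a = 1 then \<sigma> (fst a) * \<psi>1 (J x) else if snd a = 2 then \<sigma> (fst a) * \<psi>2 (J x) else 1 / 2 * J x)"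

text \<open>Each field is this scalar times the constant direction \<open>dir\<close>, so iterated
  Lie derivatives act on scalars only. The power \<open>- 1 / 2\<close> stands for the reciprocal
  square root, since powers are closed under differentiation.\<close>

definition amp :: "'n \<times> nat \<Rightarrow> (real^'n) \<times> (real^'n) \<Rightarrow> real" where
  "amp a z = (if snd a = 0 then - \<beta> (fst a) * snd z $ fst a
     else if snd a \<le> 4 then A a (fst z)
     else \<rho> (fst a) * (if snd a = 5 then \<phi>1 else \<phi>2) (J (fst z) * (snd z $ fst a + \<epsilon>) powr (- 1 / 2)))"

definition dir :: "'n \<times> nat \<Rightarrow> (real^'n) \<times> (real^'n)" where
  "dir a = (if snd a \<in> {0, 3, 4} then (0, axis (fst a) 1) else (axis (fst a) 1, 0))"

definition g :: "'n \<times> nat \<Rightarrow> (real^'n) \<times> (real^'n) \<Rightarrow> (real^'n) \<times> (real^'n)" where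
  "g a z = amp a z *\<^sub>R dir a"

definition pd :: "'n \<Rightarrow> (real^'n \<Rightarrow> real) \<Rightarrow> real^'n \<Rightarrow> real" where
  "pd i f x = frechet_derivative f (at x) (axis i 1)"

section \<open>Regularity of the fields and the oscillating form of the system\<close>

lemma open_\<Omega>: "open \<Omega>"
proof -
  have "\<Omega> = D \<times> (\<Inter>i. {v. v $ i > - \<epsilon>})" by (auto simp: \<Omega>_def)
  moreover have "open (\<Inter>i. {v::real^'n. v $ i > - \<epsilon>})"
    by (intro open_INT ballI open_Collect_less continuous_intros) auto
  ultimately show ?thesis using open_D by (simp add: open_Times)
qed

lemma fst_\<Omega>: "fst ` \<Omega> \<subseteq> D" "z \<in> \<Omega> \<Longrightarrow> fst z \<in> D" "z \<in> \<Omega> \<Longrightarrow> snd z $ i + \<epsilon> > 0"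
proof -
  show "fst ` \<Omega> \<subseteq> D" "z \<in> \<Omega> \<Longrightarrow> fst z \<in> D" by (auto simp: \<Omega>_def)
  assume "z \<in> \<Omega>"
  then have "- \<epsilon> < snd z $ i" by (auto simp: \<Omega>_def)
  then show "snd z $ i + \<epsilon> > 0" by linarith
qed

lemma J_Ck: "Ck_on 2 J D" using C2_on_imp_Ck_on[OF J_C2] .

lemma A_Ck: "Ck_on 2 (A a) D"
proof -
  have "Ck_on 2 (\<lambda>x. \<psi>1 (J x)) D" "Ck_on 2 (\<lambda>x. \<psi>2 (J x)) D"
    using Ck_on_compose_real[OF C2_on_imp_Ck_on[OF \<psi>_C2(1)] J_Ck]
      Ck_on_compose_real[OF C2_on_imp_Ck_on[OF \<psi>_C2(2)] J_Ck] by simp_all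
  moreover have c: "Ck_on 2 (\<lambda>x. c * f x) D" if "Ck_on 2 f D" for c f
    by (rule Ck_on_mult[OF Ck_on_const that])
  ultimately have "Ck_on 2 (\<lambda>x. \<sigma> (fst a) * \<psi>1 (J x)) D" "Ck_on 2 (\<lambda>x. \<sigma> (fst a) * \<psi>2 (J x)) D"
    by blast+
  then show ?thesis
    unfolding A_def using c[OF J_Ck, of "1 / 2"] by (cases "snd a = 1"; cases "snd a = 2") simp_all
qed

lemma amp_Ck: "Ck_on 2 (amp a) \<Omega>"
proof -
  have v: "bounded_linear (\<lambda>z. snd z $ i :: real)" for i :: 'n
    using bounded_linear_compose[OF bounded_linear_vec_nth bounded_linear_snd] .
  have "Ck_on 2 (\<lambda>z. J (fst z)) \<Omega>"
    by (rule Ck_on_compose_linear[OF J_Ck bounded_linear_fst fst_\<Omega>(1)])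
  moreover have "Ck_on 2 (\<lambda>z. (snd z $ fst a + \<epsilon>) powr (- 1 / 2)) \<Omega>"
    by (rule Ck_on_compose_real[OF Ck_on_powr Ck_on_add[OF Ck_on_linear[OF v] Ck_on_const]])
      (use fst_\<Omega>(3) in auto)
  ultimately have h: "Ck_on 2 (\<lambda>z. J (fst z) * (snd z $ fst a + \<epsilon>) powr (- 1 / 2)) \<Omega>"
    by (rule Ck_on_mult)
  have "Ck_on 2 (if snd a = 5 then \<phi>1 else \<phi>2) UNIV"
    using C2_on_imp_Ck_on[OF \<phi>_C2(1)] C2_on_imp_Ck_on[OF \<phi>_C2(2)] by simp
  from Ck_on_compose_real[OF this h]
  have "Ck_on 2 (\<lambda>z. \<rho> (fst a) * (if snd a = 5 then \<phi>1 else \<phi>2) (J (fst z) * (snd z $ fst a + \<epsilon>) powr (- 1 / 2))) \<Omega>"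
    by (intro Ck_on_mult[OF Ck_on_const]) auto
  moreover have "Ck_on 2 (\<lambda>z. - \<beta> (fst a) * snd z $ fst a) \<Omega>"
    by (intro Ck_on_mult[OF Ck_on_const] Ck_on_linear v)
  moreover have "Ck_on 2 (\<lambda>z. A a (fst z)) \<Omega>"
    by (rule Ck_on_compose_linear[OF A_Ck bounded_linear_fst fst_\<Omega>(1)])
  ultimately show ?thesis
    unfolding amp_def by (cases "snd a = 0"; cases "snd a \<le> 4") simp_all
qed

lemma oscillating:
  assumes "compact K" "K \<subseteq> \<Omega>"
  shows "oscillating_system (UNIV \<times> {0..6}) pw (\<lambda>a. trig (fr a) (ph a)) g \<Omega> K"
proof
  show "Ck_on 2 (\<lambda>z. g a z \<bullet> e) \<Omega>" for a e
    unfolding g_def inner_scaleR_left by (intro Ck_on_mult amp_Ck Ck_on_const)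
  show "continuous_on UNIV (trig (fr a) (ph a))" for a
    unfolding trig_def by (intro continuous_intros)
qed (use assms open_\<Omega> in \<open>auto simp: pw_def trig_def\<close>)

text \<open>Multiplied by \<open>\<omega>\<close>, the powers 2, 3 and 6 of \<open>\<mu>\<close>
  become \<open>\<omega> powr (2 / 3)\<close>, \<open>sqrt \<omega>\<close> and 1. The product of
  cosine and sine is split so that every coefficient is a single harmonic.\<close>

lemma es_field_eq:
  assumes "\<omega> > 0" "\<And>i. v $ i > - \<epsilon>"
  shows "es_field J \<phi>1 \<phi>2 \<psi>1 \<psi>2 \<epsilon> \<alpha> \<beta> \<kappa> \<nu> \<omega> t (x, v) = \<omega> *\<^sub>R
    (\<Sum>a\<in>UNIV \<times> {0..6}. ((\<omega> powr (- 1 / 6)) ^ pw a * trig (fr a) (ph a) (\<omega> * t)) *\<^sub>R g a (x, v))"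
proof -
  define \<mu> where "\<mu> = \<omega> powr (- 1 / 6)"
  have \<mu>6: "\<omega> * \<mu> ^ 6 = 1"
    using assms(1) powr_power[of \<omega> "- 1 / 6" 6] by (simp add: \<mu>_def powr_minus_divide)
  have \<mu>2: "\<omega> * \<mu>\<^sup>2 = \<omega> powr (2 / 3)"
    using assms(1) powr_power[of \<omega> "- 1 / 6" 2] powr_add[of \<omega> 1 "- 1 / 3"] by (simp add: \<mu>_def)
  have \<mu>3: "\<omega> * \<mu> ^ 3 = sqrt \<omega>"
    using assms(1) powr_power[of \<omega> "- 1 / 6" 3] powr_add[of \<omega> 1 "- 1 / 2"]
    by (simp add: \<mu>_def powr_half_sqrt)
  have sq: "y / sqrt (v $ i + \<epsilon>) = y * (v $ i + \<epsilon>) powr (- 1 / 2)" for y i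
    using assms(2)[of i] by (simp add: powr_minus_divide powr_half_sqrt)
  have c: "cos (\<theta> - pi / 2) = sin \<theta>" for \<theta> :: real
    by (simp add: cos_diff)
  have n4: "real (\<nu> i 4) = real (\<nu> i 2) - real (\<nu> i 1)" for i
    using \<nu>4(1)[of i] by linarith
  have prod: "cos (real (\<nu> i 1) * \<omega> * t) * sin (real (\<nu> i 2) * \<omega> * t)
      = (sin (real (\<nu> i 3) * (\<omega> * t)) + sin (real (\<nu> i 4) * (\<omega> * t))) / 2" for i
    unfolding \<nu>3 n4 of_nat_add distrib_right left_diff_distrib sin_add sin_diff by (simp add: mult.assoc)
  let ?T = "\<lambda>a. (\<omega> * (\<mu> ^ pw a * trig (fr a) (ph a) (\<omega> * t)) * amp a (x, v)) *\<^sub>R dir a"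
  have "\<omega> *\<^sub>R (\<Sum>a\<in>UNIV \<times> {0..6}. (\<mu> ^ pw a * trig (fr a) (ph a) (\<omega> * t)) *\<^sub>R g a (x, v))
      = (\<Sum>a\<in>UNIV \<times> {0..6}. ?T a)"
    unfolding g_def scaleR_sum_right by (simp add: mult.assoc)
  also have "\<dots> = (\<Sum>i\<in>UNIV. ?T (i, 0) + ?T (i, 1) + ?T (i, 2) + ?T (i, 3) + ?T (i, 4) + ?T (i, 5) + ?T (i, 6))"
    by (rule sum_over_grid)
  also have "\<dots> = (\<Sum>i\<in>UNIV.
      (axis i (fst (es_field J \<phi>1 \<phi>2 \<psi>1 \<psi>2 \<epsilon> \<alpha> \<beta> \<kappa> \<nu> \<omega> t (x, v)) $ i),
       axis i (snd (es_field J \<phi>1 \<phi>2 \<psi>1 \<psi>2 \<epsilon> \<alpha> \<beta> \<kappa> \<nu> \<omega> t (x, v)) $ i)))"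
  proof (rule sum.cong[OF refl])
    fix i :: 'n
    have ax: "r *\<^sub>R axis i (1::real) = axis i r" for r
      by (simp add: vec_eq_iff axis_def)
    have axa: "axis i a + axis i b = axis i (a + b :: real)" for a b
      by (simp add: vec_eq_iff axis_def)
    have T0: "?T (i, 0) = (0, axis i (- \<beta> i * v $ i))"
      using \<mu>6 by (simp add: pw_def fr_def ph_def amp_def dir_def trig_def ax flip: mult.assoc)
    have T1: "?T (i, 1) = (axis i (\<omega> powr (2 / 3) * cos (real (\<nu> i 1) * \<omega> * t) * (\<sigma> i * \<psi>1 (J x))), 0)"
      using \<mu>2 by (simp add: pw_def fr_def ph_def amp_def A_def dir_def trig_def ax flip: mult.assoc)
    have T2: "?T (i, 2) = (axis i (\<omega> powr (2 / 3) * sin (real (\<nu> i 2) * \<omega> * t) * (\<sigma> i * \<psi>2 (J x))), 0)"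
      using \<mu>2 by (simp add: pw_def fr_def ph_def amp_def A_def dir_def trig_def ax c flip: mult.assoc)
    have T3: "?T (i, 3) = (0, axis i (\<omega> powr (2 / 3) * sin (real (\<nu> i 3) * (\<omega> * t)) * (1 / 2 * J x)))"
      using \<mu>2 by (simp add: pw_def fr_def ph_def amp_def A_def dir_def trig_def ax c flip: mult.assoc)
    have T4: "?T (i, 4) = (0, axis i (\<omega> powr (2 / 3) * sin (real (\<nu> i 4) * (\<omega> * t)) * (1 / 2 * J x)))"
      using \<mu>2 by (simp add: pw_def fr_def ph_def amp_def A_def dir_def trig_def ax c flip: mult.assoc)
    have T5: "?T (i, 5) = (axis i (sqrt \<omega> * cos (real (\<kappa> i) * \<omega> * t) * (\<rho> i * \<phi>1 (J x / sqrt (v $ i + \<epsilon>)))), 0)"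
      using \<mu>3 by (simp add: pw_def fr_def ph_def amp_def dir_def trig_def ax sq flip: mult.assoc)
    have T6: "?T (i, 6) = (axis i (sqrt \<omega> * sin (real (\<kappa> i) * \<omega> * t) * (\<rho> i * \<phi>2 (J x / sqrt (v $ i + \<epsilon>)))), 0)"
      using \<mu>3 by (simp add: pw_def fr_def ph_def amp_def dir_def trig_def ax sq c flip: mult.assoc)
    have E1: "fst (es_field J \<phi>1 \<phi>2 \<psi>1 \<psi>2 \<epsilon> \<alpha> \<beta> \<kappa> \<nu> \<omega> t (x, v)) $ i =
        \<omega> powr (2 / 3) * cos (real (\<nu> i 1) * \<omega> * t) * (\<sigma> i * \<psi>1 (J x))
        + \<omega> powr (2 / 3) * sin (real (\<nu> i 2) * \<omega> * t) * (\<sigma> i * \<psi>2 (J x))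
        + sqrt \<omega> * cos (real (\<kappa> i) * \<omega> * t) * (\<rho> i * \<phi>1 (J x / sqrt (v $ i + \<epsilon>)))
        + sqrt \<omega> * sin (real (\<kappa> i) * \<omega> * t) * (\<rho> i * \<phi>2 (J x / sqrt (v $ i + \<epsilon>)))"
    proof -
      have "sqrt (2 * \<alpha> i * real (\<kappa> i) * \<omega>) = \<rho> i * sqrt \<omega>"
        by (simp add: \<rho>_def real_sqrt_mult)
      then have "fst (es_field J \<phi>1 \<phi>2 \<psi>1 \<psi>2 \<epsilon> \<alpha> \<beta> \<kappa> \<nu> \<omega> t (x, v)) $ i =
          \<rho> i * sqrt \<omega> * (\<phi>1 (J x / sqrt (v $ i + \<epsilon>)) * cos (real (\<kappa> i) * \<omega> * t)
            + \<phi>2 (J x / sqrt (v $ i + \<epsilon>)) * sin (real (\<kappa> i) * \<omega> * t))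
          + \<sigma> i * \<omega> powr (2 / 3) * (\<psi>1 (J x) * cos (real (\<nu> i 1) * \<omega> * t) + \<psi>2 (J x) * sin (real (\<nu> i 2) * \<omega> * t))"
        by (simp add: es_field_def \<sigma>_def)
      then show ?thesis by (simp only: distrib_left mult_ac add_ac)
    qed
    have "\<omega> powr (2 / 3) * J x * cos (real (\<nu> i 1) * \<omega> * t) * sin (real (\<nu> i 2) * \<omega> * t)
        = \<omega> powr (2 / 3) * J x * (cos (real (\<nu> i 1) * \<omega> * t) * sin (real (\<nu> i 2) * \<omega> * t))" by simp
    then have E2: "snd (es_field J \<phi>1 \<phi>2 \<psi>1 \<psi>2 \<epsilon> \<alpha> \<beta> \<kappa> \<nu> \<omega> t (x, v)) $ i = - \<beta> i * v $ i
        + \<omega> powr (2 / 3) * sin (real (\<nu> i 3) * (\<omega> * t)) * (1 / 2 * J x)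
        + \<omega> powr (2 / 3) * sin (real (\<nu> i 4) * (\<omega> * t)) * (1 / 2 * J x)"
      unfolding prod by (simp add: es_field_def field_simps)
    show "?T (i, 0) + ?T (i, 1) + ?T (i, 2) + ?T (i, 3) + ?T (i, 4) + ?T (i, 5) + ?T (i, 6) =
      (axis i (fst (es_field J \<phi>1 \<phi>2 \<psi>1 \<psi>2 \<epsilon> \<alpha> \<beta> \<kappa> \<nu> \<omega> t (x, v)) $ i),
       axis i (snd (es_field J \<phi>1 \<phi>2 \<psi>1 \<psi>2 \<epsilon> \<alpha> \<beta> \<kappa> \<nu> \<omega> t (x, v)) $ i))"
      unfolding T0 T1 T2 T3 T4 T5 T6 E1 E2 by (simp add: axa)
  qed
  also have "\<dots> = es_field J \<phi>1 \<phi>2 \<psi>1 \<psi>2 \<epsilon> \<alpha> \<beta> \<kappa> \<nu> \<omega> t (x, v)"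
    by (simp add: sum_prod sum_axis)
  finally show ?thesis by (simp add: \<mu>_def)
qed

end

section \<open>Computation of the averaged field\<close>

context extremum_seeking
begin

abbreviation idx :: "('n \<times> nat) set" where "idx \<equiv> UNIV \<times> {0..6}"
abbreviation osc_idx :: "('n \<times> nat) set" where "osc_idx \<equiv> UNIV \<times> {1..4}"

abbreviation C2 :: "'n \<times> nat \<Rightarrow> 'n \<times> nat \<Rightarrow> real" where
  "C2 a b \<equiv> trig_coeff2 (fr a) (ph a) (fr b) (ph b)"

abbreviation C3 :: "'n \<times> nat \<Rightarrow> 'n \<times> nat \<Rightarrow> 'n \<times> nat \<Rightarrow> real" where
  "C3 a b c \<equiv> trig_coeff3 (fr a) (ph a) (fr b) (ph b) (fr c) (ph c)"

text \<open>The summand of \<open>averaged\<close> for \<open>a\<close> with the constant direction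
  factored out, the field being replaced by its amplitude.\<close>

definition coef :: "'n \<times> nat \<Rightarrow> (real^'n) \<times> (real^'n) \<Rightarrow> real" where
  "coef a z = (if pw a = 6 then 2 * pi * amp a z else
     - (\<Sum>b\<in>idx. if pw a + pw b \<ge> 6
         then if pw a + pw b = 6 then C2 a b * lie (g b) (amp a) z else 0
         else - (\<Sum>c\<in>idx. if pw a + pw b + pw c = 6
                   then C3 a b c * lie (g c) (lie (g b) (amp a)) z else 0)))"

lemma nu_rel: "\<nu> i 2 = \<nu> i 1 + \<nu> i 4"
  using \<nu>4(1)[of i] by linarith

lemma nu_pos: "s \<in> {1..4} \<Longrightarrow> \<nu> i s > 0"
  using \<nu>1[of i] \<nu>2[of i] \<nu>3[of i] \<nu>4(2)[of i]
  by (cases "s = 1"; cases "s = 2"; cases "s = 3"; cases "s = 4") auto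

lemma fr_pos: "a \<in> idx \<Longrightarrow> pw a \<noteq> 6 \<Longrightarrow> fr a > 0"
  using nu_pos[of "snd a" "fst a"] \<kappa>[of "fst a"] by (cases "snd a = 0") (auto simp: fr_def pw_def)

lemma fr_osc: "a \<in> osc_idx \<Longrightarrow> fr a = case_prod \<nu> a"
  by (auto simp: fr_def)

lemma fr_inj_osc:
  assumes "a \<in> osc_idx" "b \<in> osc_idx" "fr a = fr b"
  shows "a = b"
proof -
  have "inj_on (\<lambda>(i, s). \<nu> i s) osc_idx" using nr unfolding non_resonant_def by blast
  then show ?thesis
    using assms(3) unfolding fr_osc[OF assms(1)] fr_osc[OF assms(2)] by (rule inj_onD) (use assms in auto)
qed

text \<open>Different frequencies do not interact. Equal frequencies occur for equal indices, where
  the phases coincide and the sine vanishes, and for the two \<open>\<phi>\<close> fields sharing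
  \<open>\<kappa> i\<close>, the excluded case.\<close>

lemma C2_eq_0:
  assumes "a \<in> idx" "b \<in> idx" "pw a \<noteq> 6" "pw b \<noteq> 6"
    and "\<not> (\<exists>i. a = (i, 5) \<and> b = (i, 6) \<or> a = (i, 6) \<and> b = (i, 5))"
  shows "C2 a b = 0"
proof (cases "fr a = fr b")
  case True
  obtain i s where a: "a = (i, s)" "1 \<le> s" "s \<le> 6" using assms(1,3) by (auto simp: pw_def split: if_splits)
  obtain j r where b: "b = (j, r)" "1 \<le> r" "r \<le> 6" using assms(2,4) by (auto simp: pw_def split: if_splits)
  have "a = b"
  proof (cases "s \<le> 4")
    case s: True
    show ?thesis
    proof (cases "r \<le> 4")
      case True
      then show ?thesis using fr_inj_osc[OF _ _ \<open>fr a = fr b\<close>] a b s by auto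
    next
      case False
      then have "\<kappa> j = \<nu> i s" using \<open>fr a = fr b\<close> a b s by (simp add: fr_def)
      then show ?thesis using nr s a(2) unfolding non_resonant_def by auto
    qed
  next
    case s: False
    show ?thesis
    proof (cases "r \<le> 4")
      case True
      then have "\<kappa> i = \<nu> j r" using \<open>fr a = fr b\<close> a b s by (simp add: fr_def)
      then show ?thesis using nr True b(2) unfolding non_resonant_def by auto
    next
      case False
      then have "\<kappa> i = \<kappa> j" using \<open>fr a = fr b\<close> a b s by (simp add: fr_def)
      then have "i = j" using nr unfolding non_resonant_def by (simp add: inj_eq)
      moreover have "s = 5 \<or> s = 6" "r = 5 \<or> r = 6" using s False a b by auto
      ultimately show ?thesis using assms(5) a(1) b(1) by auto
    qed
  qed
  then show ?thesis by (simp add: trig_coeff2_def)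
qed (simp add: trig_coeff2_def)

text \<open>A nonzero value forces one frequency to be the sum of the other two. Both imposed
  relations involve the indices 1 and 2 of one \<open>i\<close> and one of 3, 4; with
  \<open>b\<close> and \<open>c\<close> confined to 1 and 2, the index of \<open>a\<close> must be 3
  or 4. The confinement is natural: amplitudes of oscillating fields depend on \<open>x\<close>
  alone, and among these fields only 1 and 2 move \<open>x\<close>.\<close>

lemma C3_support:
  assumes a: "a \<in> osc_idx" and b: "b \<in> osc_idx" "snd b \<in> {1, 2}" and c: "c \<in> osc_idx" "snd c \<in> {1, 2}"
    and nz: "C3 a b c \<noteq> 0"
  shows "\<exists>i. (a = (i, 3) \<or> a = (i, 4)) \<and> (b = (i, 1) \<and> c = (i, 2) \<or> b = (i, 2) \<and> c = (i, 1))"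
proof -
  have "fr a + fr b = fr c \<or> fr a = fr b + fr c \<or> fr b = fr a + fr c"
    using nz unfolding trig_coeff3_def by (auto split: if_splits)
  then consider "fr a + fr b = fr c" | "fr b + fr c = fr a" | "fr a + fr c = fr b" by auto
  then show ?thesis
  proof cases
    case 1
    then show ?thesis
      using resonant_triple[OF nr nu_pos a b(1) c(1)] a b c by (auto simp: fr_osc)
  next
    case 2
    then show ?thesis
      using resonant_triple[OF nr nu_pos b(1) c(1) a] a b c by (auto simp: fr_osc)
  next
    case 3
    then show ?thesis
      using resonant_triple[OF nr nu_pos a c(1) b(1)] a b c by (auto simp: fr_osc)
  qed
qed

lemma lie_fst:
  assumes "Ck_on (Suc k) f D" "z \<in> \<Omega>"
  shows "lie (g b) (\<lambda>z. f (fst z)) z =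
    (if snd b \<in> {0, 3, 4} then 0 else amp b z * pd (fst b) f (fst z))"
proof -
  have d: "(f has_derivative frechet_derivative f (at (fst z))) (at (fst z))"
    using Ck_on_has_derivative[OF assms(1)] fst_\<Omega>(2)[OF assms(2)] by blast
  interpret linear "frechet_derivative f (at (fst z))"
    using d by (rule has_derivative_linear)
  have "lie (g b) (\<lambda>z. f (fst z)) z = frechet_derivative f (at (fst z)) (fst (g b z))"
    by (rule lie_eq[OF has_derivative_compose[OF bounded_linear_imp_has_derivative[OF bounded_linear_fst] d]])
  then show ?thesis
    by (simp add: g_def dir_def pd_def scale zero)
qed

lemma pd_eq: "(f has_derivative f') (at x) \<Longrightarrow> pd i f x = f' (axis i 1)"
  by (simp add: pd_def frechet_derivative_at[symmetric])

lemma pd_Ck: "Ck_on (Suc k) f D \<Longrightarrow> Ck_on k (pd i f) D"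
  unfolding pd_def[abs_def] by (rule Ck_on_frechet_derivative[OF open_D])

text \<open>The Lie derivative of the amplitude of \<open>a\<close> along the field
  \<open>b\<close>, as a function of \<open>x\<close> so that it can be differentiated
  again.\<close>

definition A2 :: "'n \<times> nat \<Rightarrow> 'n \<times> nat \<Rightarrow> real^'n \<Rightarrow> real" where
  "A2 a b x = (if snd b \<in> {1, 2} then A b x * pd (fst b) (A a) x else 0)"

lemma amp_osc: "a \<in> osc_idx \<Longrightarrow> amp a = (\<lambda>z. A a (fst z))"
  by (auto simp: amp_def fun_eq_iff)

lemma lie_osc:
  assumes "a \<in> osc_idx" "b \<in> osc_idx" "z \<in> \<Omega>"
  shows "lie (g b) (amp a) z = A2 a b (fst z)"
  using assms lie_fst[OF A_Ck[of a, folded Suc_1] assms(3), of b] amp_osc[OF assms(1)] amp_osc[OF assms(2)]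
  by (auto simp: A2_def)

lemma A2_Ck: "Ck_on (Suc 0) (A2 a b) D"
proof -
  have "Ck_on (Suc 0) (pd i (A a)) D" for i
    using A_Ck[of a] by (intro pd_Ck) (simp add: numeral_2_eq_2)
  moreover have "Ck_on (Suc 0) (A b) D"
    by (rule Ck_on_Suc_imp) (use A_Ck[of b] in \<open>simp add: numeral_2_eq_2\<close>)
  ultimately show ?thesis
    unfolding A2_def using Ck_on_const by (cases "snd b \<in> {1, 2}") (simp_all add: Ck_on_mult)
qed

lemma lie_lie_osc:
  assumes "a \<in> osc_idx" "b \<in> osc_idx" "c \<in> osc_idx" "z \<in> \<Omega>"
  shows "lie (g c) (lie (g b) (amp a)) z =
    (if snd b \<in> {1, 2} \<and> snd c \<in> {1, 2} then A c (fst z) * pd (fst c) (A2 a b) (fst z) else 0)"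
proof -
  have "lie (g c) (lie (g b) (amp a)) z = lie (g c) (\<lambda>z. A2 a b (fst z)) z"
    by (rule lie_cong[OF open_\<Omega> assms(4)]) (rule lie_osc[OF assms(1,2)])
  also have "\<dots> = (if snd c \<in> {1, 2} then A c (fst z) * pd (fst c) (A2 a b) (fst z) else 0)"
    using assms(3) lie_fst[OF A2_Ck[of a b] assms(4), of c] amp_osc[OF assms(3)] by auto
  also have "\<dots> = (if snd b \<in> {1, 2} \<and> snd c \<in> {1, 2} then A c (fst z) * pd (fst c) (A2 a b) (fst z) else 0)"
  proof (cases "snd b \<in> {1, 2}")
    case False
    then have "A2 a b = (\<lambda>x. 0)" by (auto simp: A2_def)
    then have "pd i (A2 a b) x = 0" for i x
      using pd_eq[OF has_derivative_const] by simp
    then show ?thesis by simp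
  qed simp
  finally show ?thesis .
qed

text \<open>Starting from power 2, the only way to hit 6 is 2 + 2 + 2. A factor of power 3 leads to
  5 and then past 6, or directly from 4 to 7.\<close>

lemma coef_osc:
  assumes a: "a \<in> osc_idx"
  shows "coef a z = (\<Sum>b\<in>osc_idx. \<Sum>c\<in>osc_idx. C3 a b c * lie (g c) (lie (g b) (amp a)) z)"
proof -
  let ?F = "\<lambda>b. if pw a + pw b \<ge> 6
         then if pw a + pw b = 6 then C2 a b * lie (g b) (amp a) z else 0
         else - (\<Sum>c\<in>idx. if pw a + pw b + pw c = 6
                   then C3 a b c * lie (g c) (lie (g b) (amp a)) z else 0)"
  have pa: "pw a = 2" using a by (auto simp: pw_def)
  have osc_sub: "osc_idx \<subseteq> idx" by auto
  have pw_osc: "pw b = 2" if "b \<in> osc_idx" for b using that by (auto simp: pw_def)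
  have pw_other: "pw b \<noteq> 2" if "b \<in> idx - osc_idx" for b using that by (auto simp: pw_def)
  have pw_vals: "pw b \<in> {2, 3, 6}" for b by (auto simp: pw_def)
  have inner: "(\<Sum>c\<in>idx. if pw a + pw b + pw c = 6 then F c else 0) = (\<Sum>c\<in>osc_idx. F c)"
    if "pw b = 2" for b and F :: "'n \<times> nat \<Rightarrow> real"
    using pw_osc pw_other that pa by (intro sum.mono_neutral_cong_right) auto
  have "(\<Sum>b\<in>idx. ?F b)
    = (\<Sum>b\<in>osc_idx. - (\<Sum>c\<in>osc_idx. C3 a b c * lie (g c) (lie (g b) (amp a)) z))"
  proof (rule sum.mono_neutral_cong_right)
    show "\<forall>b\<in>idx - osc_idx. ?F b = 0"
    proof
      fix b assume "b \<in> idx - osc_idx"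
      then have pb: "pw b = 3 \<or> pw b = 6" using pw_vals[of b] pw_other[of b] by auto
      moreover have "(\<Sum>c\<in>idx. if pw a + pw b + pw c = 6
                   then C3 a b c * lie (g c) (lie (g b) (amp a)) z else 0) = 0" if "pw b = 3"
      proof -
        have "pw a + pw b + pw c \<noteq> 6" for c using pw_vals[of c] that pa by auto
        then show ?thesis by simp
      qed
      ultimately show "?F b = 0"
        using pa by auto
    qed
    show "?F b
       = - (\<Sum>c\<in>osc_idx. C3 a b c * lie (g c) (lie (g b) (amp a)) z)" if "b \<in> osc_idx" for b
      using inner[OF pw_osc[OF that]] pw_osc[OF that] pa by simp
  qed (use osc_sub in auto)
  then show ?thesis unfolding coef_def using pa by (simp add: sum_negf)
qed

text \<open>Every surviving triple starts with a field acting on \<open>v\<close>; so the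
  \<open>\<psi>\<close> fields leave no trace in the averaged equation for \<open>x\<close>.\<close>

lemma coef_psi:
  assumes "s \<in> {1, 2}" "z \<in> \<Omega>"
  shows "coef (i, s) z = 0"
proof -
  have a: "(i, s) \<in> osc_idx" using assms by auto
  show ?thesis
    unfolding coef_osc[OF a]
  proof (intro sum.neutral ballI)
    fix b c assume b: "b \<in> osc_idx" and c: "c \<in> osc_idx"
    show "C3 (i, s) b c * lie (g c) (lie (g b) (amp (i, s))) z = 0"
      using C3_support[OF a b _ c] assms(1) unfolding lie_lie_osc[OF a b c assms(2)] by auto
  qed
qed

text \<open>Only the two orders of the \<open>\<psi>\<close> fields with the same \<open>i\<close>
  survive. The amplitudes for 3 and 4 are both \<open>J / 2\<close>, so \<open>s\<close> enters
  through the weights alone.\<close>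

lemma coef_v:
  assumes "s \<in> {3, 4}" "z \<in> \<Omega>"
  shows "coef (i, s) z =
    C3 (i, s) (i, 1) (i, 2) * (A (i, 2) (fst z) * pd i (A2 (i, 3) (i, 1)) (fst z)) +
    C3 (i, s) (i, 2) (i, 1) * (A (i, 1) (fst z) * pd i (A2 (i, 3) (i, 2)) (fst z))"
proof -
  have a: "(i, s) \<in> osc_idx" using assms by auto
  have A_eq: "A2 (i, s) b = A2 (i, 3) b" for b
  proof -
    have "A (i, s) = A (i, 3)" using assms(1) by (auto simp: A_def fun_eq_iff)
    then show ?thesis by (intro ext) (simp only: A2_def)
  qed
  define T where "T b c = C3 (i, s) b c * lie (g c) (lie (g b) (amp (i, s))) z" for b c
  have T0: "T b c = 0" if "b \<in> osc_idx" "c \<in> osc_idx"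
    "\<not> (b = (i, 1) \<and> c = (i, 2) \<or> b = (i, 2) \<and> c = (i, 1))" for b c
    using C3_support[OF a that(1) _ that(2)] that(3)
    unfolding T_def lie_lie_osc[OF a that(1,2) assms(2)] by auto
  have i12: "(i, 1) \<in> osc_idx" "(i, 2) \<in> osc_idx" by auto
  have "coef (i, s) z = (\<Sum>b\<in>osc_idx. \<Sum>c\<in>osc_idx. T b c)"
    unfolding coef_osc[OF a] T_def ..
  also have "\<dots> = (\<Sum>b\<in>{(i, 1), (i, 2)}. \<Sum>c\<in>osc_idx. T b c)"
    using i12 T0 by (intro sum.mono_neutral_right) (auto intro!: sum.neutral)
  also have "\<dots> = (\<Sum>c\<in>osc_idx. T (i, 1) c) + (\<Sum>c\<in>osc_idx. T (i, 2) c)" by simp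
  also have "(\<Sum>c\<in>osc_idx. T (i, 1) c) = T (i, 1) (i, 2)"
    using i12 T0 by (intro sum_single) auto
  also have "(\<Sum>c\<in>osc_idx. T (i, 2) c) = T (i, 2) (i, 1)"
    using i12 T0 by (intro sum_single) auto
  finally show ?thesis
    unfolding T_def lie_lie_osc[OF a i12(1,2) assms(2)] lie_lie_osc[OF a i12(2,1) assms(2)] A_eq by simp
qed

lemma real_derivative:
  fixes f :: "real \<Rightarrow> real"
  assumes "C2_on f UNIV"
  shows "(f has_derivative (\<lambda>t. deriv f y * t)) (at y)"
proof -
  have "f differentiable at y"
    using Ck_on_has_derivative[OF C2_on_imp_Ck_on[OF assms, folded Suc_1], of y]
    by (auto simp: differentiable_def)
  then show ?thesis
    by (simp add: DERIV_deriv_iff_real_differentiable[symmetric] has_field_derivative_def)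
qed

lemma pd_A2:
  assumes \<psi>: "C2_on \<psi> UNIV" and b: "b \<in> {(i, 1), (i, 2)}" and A: "\<And>x. A b x = \<sigma> i * \<psi> (J x)" and x: "x \<in> D"
  shows "pd i (A2 (i, 3) b) x =
    \<sigma> i / 2 * (deriv \<psi> (J x) * (pd i J x)\<^sup>2 + \<psi> (J x) * pd i (pd i J) x)"
proof -
  have dJ: "(J has_derivative frechet_derivative J (at x)) (at x)" if "x \<in> D" for x
    using Ck_on_has_derivative[OF J_Ck[folded Suc_1] that] .
  have dp: "(pd i J has_derivative frechet_derivative (pd i J) (at x)) (at x)"
    using Ck_on_has_derivative[OF pd_Ck x] J_Ck[unfolded numeral_2_eq_2] by blast
  have half: "pd i (A (i, 3)) x = 1 / 2 * pd i J x" if "x \<in> D" for x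
  proof -
    have "A (i, 3) = (\<lambda>x. 1 / 2 * J x)" by (simp add: A_def fun_eq_iff)
    then have "(A (i, 3) has_derivative (\<lambda>h. 1 / 2 * frechet_derivative J (at x) h)) (at x)"
      using has_derivative_mult_right[OF dJ[OF that], of "1 / 2"] by simp
    from pd_eq[OF this, of i] show ?thesis by (simp only: pd_def)
  qed
  have "((\<lambda>x. (\<sigma> i * \<psi> (J x)) * (1 / 2 * pd i J x)) has_derivative
      (\<lambda>h. (\<sigma> i * \<psi> (J x)) * (1 / 2 * frechet_derivative (pd i J) (at x) h)
        + (\<sigma> i * (deriv \<psi> (J x) * frechet_derivative J (at x) h)) * (1 / 2 * pd i J x))) (at x)"
    by (intro has_derivative_mult has_derivative_mult_right dp has_derivative_compose[OF dJ[OF x] real_derivative[OF \<psi>]])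
  then have "(A2 (i, 3) b has_derivative
      (\<lambda>h. (\<sigma> i * \<psi> (J x)) * (1 / 2 * frechet_derivative (pd i J) (at x) h)
        + (\<sigma> i * (deriv \<psi> (J x) * frechet_derivative J (at x) h)) * (1 / 2 * pd i J x))) (at x)"
    by (rule has_derivative_transform_within_open[OF _ open_D x]) (use b half A in \<open>auto simp: A2_def\<close>)
  from pd_eq[OF this, of i] show ?thesis
    unfolding pd_def[of i "pd i J" x, symmetric] pd_def[of i J x, symmetric]
    by (simp add: power2_eq_square algebra_simps)
qed

text \<open>Only after adding the sum and the difference frequency are the weights of the two orders
  opposite. The common denominator arises as \<open>\<nu> i 3 * \<nu> i 4\<close>, the product of
  sum and difference.\<close>

lemma C3_values:
  "C3 (i, 3) (i, 1) (i, 2) + C3 (i, 4) (i, 1) (i, 2) = - pi / ((real (\<nu> i 2))\<^sup>2 - (real (\<nu> i 1))\<^sup>2)"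
  "C3 (i, 3) (i, 2) (i, 1) + C3 (i, 4) (i, 2) (i, 1) = pi / ((real (\<nu> i 2))\<^sup>2 - (real (\<nu> i 1))\<^sup>2)"
proof -
  \<comment> \<open>In these two positive parameters all four frequencies are sums, and each
    resonance condition is decided by positivity.\<close>
  define a b where "a = \<nu> i 1" and "b = \<nu> i 4"
  have ab: "a > 0" "b > 0" using \<nu>1[of i] \<nu>4(2)[of i] by (auto simp: a_def b_def)
  have n: "\<nu> i 1 = a" "\<nu> i (Suc 0) = a" "\<nu> i 2 = a + b" "\<nu> i 3 = 2 * a + b" "\<nu> i 4 = b"
    using \<nu>3[of i] nu_rel[of i] by (auto simp: a_def b_def)
  have p: "real a > 0" "real b > 0" "2 * real a + real b > 0" "real a + real b > 0" using ab by auto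
  have sq: "(real (a + b))\<^sup>2 - (real a)\<^sup>2 = real b * (2 * real a + real b)"
    by (simp add: power2_eq_square algebra_simps)
  have v: "C3 (i, 3) (i, 1) (i, 2) = - pi / (2 * (2 * real a + real b)) * (1 / (real a + real b))"
    "C3 (i, 4) (i, 1) (i, 2) = - pi / (2 * real b) * (1 / (real a + real b))"
    "C3 (i, 3) (i, 2) (i, 1) = - pi / (2 * (2 * real a + real b)) * (1 / real a)"
    "C3 (i, 4) (i, 2) (i, 1) = - pi / (2 * real b) * (1 / (- real a))"
    using ab by (simp_all add: trig_coeff3_def fr_def ph_def n add.commute)
  show "C3 (i, 3) (i, 1) (i, 2) + C3 (i, 4) (i, 1) (i, 2) = - pi / ((real (\<nu> i 2))\<^sup>2 - (real (\<nu> i 1))\<^sup>2)"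
    unfolding v n sq using p by (simp add: divide_simps) (simp add: algebra_simps)
  show "C3 (i, 3) (i, 2) (i, 1) + C3 (i, 4) (i, 2) (i, 1) = pi / ((real (\<nu> i 2))\<^sup>2 - (real (\<nu> i 1))\<^sup>2)"
    unfolding v n sq using p by (simp add: divide_simps) (simp add: algebra_simps)
qed

text \<open>In \<open>Y - X\<close> the terms \<open>\<psi>1 * \<psi>2\<close> with the second
  derivative of \<open>J\<close> cancel and the bracket of \<open>\<psi>1\<close>,
  \<open>\<psi>2\<close> is left. The choice of \<open>\<sigma>\<close> compensates the denominator
  of the weights and leaves exactly \<open>\<beta> i\<close>.\<close>

lemma coef_v_sum:
  assumes "z \<in> \<Omega>"
  shows "coef (i, 3) z + coef (i, 4) z = 2 * pi * (\<beta> i * (pd i J (fst z))\<^sup>2)"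
proof -
  define N where "N = (real (\<nu> i 2))\<^sup>2 - (real (\<nu> i 1))\<^sup>2"
  define y where "y = J (fst z)"
  define p where "p = pd i J (fst z)"
  define q where "q = pd i (pd i J) (fst z)"
  have N: "N > 0"
    using \<nu>4(2)[of i] nu_rel[of i] by (simp add: N_def power_strict_mono)
  have \<sigma>2: "\<sigma> i * \<sigma> i = 4 * \<beta> i * N"
    using N \<beta>[of i] unfolding \<sigma>_def N_def[symmetric] by simp
  have A: "A (i, 1) x = \<sigma> i * \<psi>1 (J x)" "A (i, 2) x = \<sigma> i * \<psi>2 (J x)" for x
    by (auto simp: A_def)
  have x: "fst z \<in> D" using fst_\<Omega>(2)[OF assms] .
  have pd1: "pd i (A2 (i, 3) (i, 1)) (fst z) = \<sigma> i / 2 * (deriv \<psi>1 y * p\<^sup>2 + \<psi>1 y * q)"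
    unfolding y_def p_def q_def by (rule pd_A2[OF \<psi>_C2(1) _ A(1) x]) simp
  have pd2: "pd i (A2 (i, 3) (i, 2)) (fst z) = \<sigma> i / 2 * (deriv \<psi>2 y * p\<^sup>2 + \<psi>2 y * q)"
    unfolding y_def p_def q_def by (rule pd_A2[OF \<psi>_C2(2) _ A(2) x]) simp
  define X where "X = A (i, 2) (fst z) * pd i (A2 (i, 3) (i, 1)) (fst z)"
  define Y where "Y = A (i, 1) (fst z) * pd i (A2 (i, 3) (i, 2)) (fst z)"
  have "coef (i, 3) z + coef (i, 4) z =
      (C3 (i, 3) (i, 1) (i, 2) + C3 (i, 4) (i, 1) (i, 2)) * X + (C3 (i, 3) (i, 2) (i, 1) + C3 (i, 4) (i, 2) (i, 1)) * Y"
  proof -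
    have "coef (i, s) z = C3 (i, s) (i, 1) (i, 2) * X + C3 (i, s) (i, 2) (i, 1) * Y" if "s \<in> {3, 4}" for s
      unfolding X_def Y_def by (rule coef_v[OF that assms])
    from this[of 3] this[of 4] show ?thesis by (simp add: distrib_right)
  qed
  also have "\<dots> = pi / N * (Y - X)"
    unfolding C3_values N_def[symmetric] by (simp add: algebra_simps diff_divide_distrib)
  also have "Y - X = (\<sigma> i * \<sigma> i) / 2 * (p\<^sup>2 * (\<psi>1 y * deriv \<psi>2 y - deriv \<psi>1 y * \<psi>2 y))"
    unfolding X_def Y_def A pd1 pd2 y_def[symmetric] by (simp add: algebra_simps)
  also have "\<psi>1 y * deriv \<psi>2 y - deriv \<psi>1 y * \<psi>2 y = 1"
    using \<psi>_bracket[of y] by (simp add: lie_bracket_def)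
  finally show ?thesis using N by (simp add: \<sigma>2 p_def)
qed

text \<open>From power 3 only a second field of power 3 hits 6; with power 2 the sum is 5, and every
  further field exceeds 6. Non-resonance leaves only the companion field of the same
  \<open>i\<close>.\<close>

lemma coef_phi:
  assumes s: "s = 5 \<and> r = 6 \<or> s = 6 \<and> r = 5"
  shows "coef (i, s) z = - (C2 (i, s) (i, r) * lie (g (i, r)) (amp (i, s)) z)"
proof -
  let ?F = "\<lambda>b. if pw (i, s) + pw b \<ge> 6
         then if pw (i, s) + pw b = 6 then C2 (i, s) b * lie (g b) (amp (i, s)) z else 0
         else - (\<Sum>c\<in>idx. if pw (i, s) + pw b + pw c = 6
                   then C3 (i, s) b c * lie (g c) (lie (g b) (amp (i, s))) z else 0)"
  have pa: "pw (i, s) = 3" using s by (auto simp: pw_def)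
  have pw_vals: "pw b \<in> {2, 3, 6}" for b by (auto simp: pw_def)
  have "(\<Sum>b\<in>idx. ?F b)
    = ?F (i, r)"
  proof (rule sum_single)
    fix b assume b: "b \<in> idx" "b \<noteq> (i, r)"
    have "\<not> (\<exists>j. (i, s) = (j, 5) \<and> b = (j, 6) \<or> (i, s) = (j, 6) \<and> b = (j, 5))"
      using b(2) s by auto
    then have "C2 (i, s) b = 0" if "pw b = 3"
      using C2_eq_0[of "(i, s)" b] b(1) s that pa by auto
    moreover have "(\<Sum>c\<in>idx. if pw (i, s) + pw b + pw c = 6
                   then C3 (i, s) b c * lie (g c) (lie (g b) (amp (i, s))) z else 0) = 0" if "pw b = 2"
    proof -
      have "pw (i, s) + pw b + pw c \<noteq> 6" for c using pw_vals[of c] that pa by auto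
      then show ?thesis by simp
    qed
    ultimately show "?F b = 0"
      using pw_vals[of b] pa by auto
  qed (use s in auto)
  moreover have "pw (i, r) = 3" using s by (auto simp: pw_def)
  ultimately show ?thesis unfolding coef_def using pa by simp
qed

text \<open>The amplitude depends on \<open>v\<close>, but the \<open>\<phi>\<close> fields move
  only \<open>x\<close>. The derivative \<open>P\<close> of the power is therefore evaluated at 0
  and its formula is irrelevant.\<close>

lemma lie_phi:
  assumes \<phi>: "C2_on \<phi> UNIV" and z: "z \<in> \<Omega>" and s: "s = 5 \<or> s = 6" and r: "r = 5 \<or> r = 6"
    and amp: "amp (i, s) = (\<lambda>z. \<rho> i * \<phi> (J (fst z) * (snd z $ i + \<epsilon>) powr (- 1 / 2)))"
  shows "lie (g (i, r)) (amp (i, s)) z = \<rho> i * (deriv \<phi> (J (fst z) * (snd z $ i + \<epsilon>) powr (- 1 / 2)) *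
    (amp (i, r) z * pd i J (fst z) * (snd z $ i + \<epsilon>) powr (- 1 / 2)))"
proof -
  define P where "P = frechet_derivative (\<lambda>s. s powr (- 1 / 2)) (at (snd z $ i + \<epsilon>))"
  have P: "((\<lambda>s::real. s powr (- 1 / 2)) has_derivative P) (at (snd z $ i + \<epsilon>))"
    unfolding P_def by (rule Ck_on_has_derivative[OF Ck_on_powr[of "Suc 0"]]) (use fst_\<Omega>(3)[OF z] in simp)
  have "bounded_linear (\<lambda>z. snd z $ i :: real)"
    using bounded_linear_compose[OF bounded_linear_vec_nth bounded_linear_snd] .
  from has_derivative_add[OF bounded_linear_imp_has_derivative[OF this] has_derivative_const]
  have v: "((\<lambda>z. snd z $ i + \<epsilon>) has_derivative (\<lambda>w. snd w $ i)) (at z)" by simp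
  have dJ: "((\<lambda>z. J (fst z)) has_derivative (\<lambda>w. frechet_derivative J (at (fst z)) (fst w))) (at z)"
    by (rule has_derivative_compose[OF bounded_linear_imp_has_derivative[OF bounded_linear_fst]
          Ck_on_has_derivative[OF J_Ck[folded Suc_1] fst_\<Omega>(2)[OF z]]])
  have "(amp (i, s) has_derivative (\<lambda>w. \<rho> i * (deriv \<phi> (J (fst z) * (snd z $ i + \<epsilon>) powr (- 1 / 2)) *
      (J (fst z) * P (snd w $ i) + frechet_derivative J (at (fst z)) (fst w) * (snd z $ i + \<epsilon>) powr (- 1 / 2))))) (at z)"
    unfolding amp
    by (intro has_derivative_mult_right
        has_derivative_compose[OF has_derivative_mult[OF dJ has_derivative_compose[OF v P]] real_derivative[OF \<phi>]])
  from lie_eq[OF this, of "g (i, r)"]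
  have "lie (g (i, r)) (amp (i, s)) z = \<rho> i * (deriv \<phi> (J (fst z) * (snd z $ i + \<epsilon>) powr (- 1 / 2)) *
      (J (fst z) * P (snd (g (i, r) z) $ i) +
       frechet_derivative J (at (fst z)) (fst (g (i, r) z)) * (snd z $ i + \<epsilon>) powr (- 1 / 2)))" .
  moreover have "P 0 = 0" using linear_0[OF has_derivative_linear[OF P]] .
  moreover have "snd (g (i, r) z) = 0" "fst (g (i, r) z) = amp (i, r) z *\<^sub>R axis i 1"
    using r by (auto simp: g_def dir_def)
  moreover have "frechet_derivative J (at (fst z)) (amp (i, r) z *\<^sub>R axis i 1) = amp (i, r) z * pd i J (fst z)"
    using linear_scale[OF has_derivative_linear[OF Ck_on_has_derivative[OF J_Ck[folded Suc_1] fst_\<Omega>(2)[OF z]]]]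
    by (simp add: pd_def)
  ultimately show ?thesis by simp
qed

text \<open>The weights of the two orders are opposite, which produces the bracket of
  \<open>\<phi>1\<close>, \<open>\<phi>2\<close>. Differentiating the argument \<open>J * w\<close>
  gives a single factor \<open>w\<close>, and \<open>\<rho> i * \<rho> i\<close> cancels the
  frequency in the weights.\<close>

lemma coef_phi_sum:
  assumes z: "z \<in> \<Omega>"
  shows "coef (i, 5) z + coef (i, 6) z =
    2 * pi * (- \<alpha> i * pd i J (fst z) * (snd z $ i + \<epsilon>) powr (- 1 / 2))"
proof -
  define w where "w = (snd z $ i + \<epsilon>) powr (- 1 / 2)"
  define y where "y = J (fst z) * w"
  define p where "p = pd i J (fst z)"
  have amp: "amp (i, 5) = (\<lambda>z. \<rho> i * \<phi>1 (J (fst z) * (snd z $ i + \<epsilon>) powr (- 1 / 2)))"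
    "amp (i, 6) = (\<lambda>z. \<rho> i * \<phi>2 (J (fst z) * (snd z $ i + \<epsilon>) powr (- 1 / 2)))"
    by (auto simp: amp_def fun_eq_iff)
  have ampz: "amp (i, 5) z = \<rho> i * \<phi>1 y" "amp (i, 6) z = \<rho> i * \<phi>2 y"
    by (auto simp: amp y_def w_def)
  have l5: "lie (g (i, 6)) (amp (i, 5)) z = \<rho> i * (deriv \<phi>1 y * (amp (i, 6) z * p * w))"
    unfolding y_def p_def w_def by (rule lie_phi[OF \<phi>_C2(1) z _ _ amp(1)]) auto
  have l6: "lie (g (i, 5)) (amp (i, 6)) z = \<rho> i * (deriv \<phi>2 y * (amp (i, 5) z * p * w))"
    unfolding y_def p_def w_def by (rule lie_phi[OF \<phi>_C2(2) z _ _ amp(2)]) auto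
  have c: "C2 (i, 5) (i, 6) = pi / real (\<kappa> i)" "C2 (i, 6) (i, 5) = - pi / real (\<kappa> i)"
    by (simp_all add: trig_coeff2_def fr_def ph_def)
  have \<rho>2: "\<rho> i * \<rho> i = 2 * \<alpha> i * real (\<kappa> i)"
    using \<alpha>[of i] by (simp add: \<rho>_def)
  have "coef (i, 5) z + coef (i, 6) z =
      pi / real (\<kappa> i) * ((\<rho> i * \<rho> i) * ((\<phi>1 y * deriv \<phi>2 y - deriv \<phi>1 y * \<phi>2 y) * p * w))"
    using coef_phi[of 5 6 i z] coef_phi[of 6 5 i z] unfolding l5 l6 c ampz by (simp add: algebra_simps)
  also have "\<phi>1 y * deriv \<phi>2 y - deriv \<phi>1 y * \<phi>2 y = - 1"
    using \<phi>_bracket[of y] by (simp add: lie_bracket_def)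
  finally show ?thesis
    unfolding \<rho>2 using \<kappa>[of i] by (simp add: w_def p_def)
qed

definition G :: "(real^'n) \<times> (real^'n) \<Rightarrow> (real^'n) \<times> (real^'n)" where
  "G z = (\<chi> i. - \<alpha> i * pd i J (fst z) * (snd z $ i + \<epsilon>) powr (- 1 / 2),
          \<chi> i. - \<beta> i * snd z $ i + \<beta> i * (pd i J (fst z))\<^sup>2)"

lemma sum_coef:
  assumes z: "z \<in> \<Omega>"
  shows "(\<Sum>a\<in>idx. coef a z *\<^sub>R dir a) = (2 * pi) *\<^sub>R G z"
proof -
  have ax: "r *\<^sub>R axis i (1::real) = axis i r" for r and i :: 'n
    by (simp add: vec_eq_iff axis_def)
  have axa: "axis i a + axis i b = axis i (a + b :: real)" for a b and i :: 'n
    by (simp add: vec_eq_iff axis_def)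
  have c0: "coef (i, 0) z = 2 * pi * (- \<beta> i * snd z $ i)" for i
    by (simp add: coef_def pw_def amp_def)
  have "(\<Sum>a\<in>idx. coef a z *\<^sub>R dir a) = (\<Sum>i\<in>UNIV.
      (axis i (coef (i, 1) z + coef (i, 2) z + (coef (i, 5) z + coef (i, 6) z)),
       axis i (coef (i, 0) z + (coef (i, 3) z + coef (i, 4) z))))"
    unfolding sum_over_grid by (intro sum.cong) (simp_all add: dir_def ax axa add.assoc)
  also have "\<dots> = (2 * pi) *\<^sub>R G z"
    using coef_psi[OF _ z] coef_v_sum[OF z] coef_phi_sum[OF z]
    by (simp add: sum_prod sum_axis G_def vec_eq_iff c0 distrib_left right_diff_distrib)
  finally show ?thesis .
qed

section \<open>The gradient and the choice of the Lyapunov function\<close>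

definition gr :: "real^'n \<Rightarrow> real^'n" where
  "gr x = (\<chi> i. pd i J x)"

lemma gr_deriv: "x \<in> D \<Longrightarrow> (J has_derivative (\<lambda>h. gr x \<bullet> h)) (at x)"
proof -
  assume x: "x \<in> D"
  let ?J' = "frechet_derivative J (at x)"
  have d: "(J has_derivative ?J') (at x)"
    using Ck_on_has_derivative[OF J_Ck[folded Suc_1] x] .
  interpret linear ?J' using d by (rule has_derivative_linear)
  have "?J' h = gr x \<bullet> h" for h
  proof -
    have "?J' h = ?J' (\<Sum>i\<in>UNIV. (h $ i) *\<^sub>R axis i 1)"
      using basis_expansion[of h] by (simp add: scalar_mult_eq_scaleR)
    also have "\<dots> = gr x \<bullet> h"
      by (simp add: sum scale inner_vec_def gr_def pd_def mult.commute)
    finally show ?thesis .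
  qed
  then have "?J' = (\<lambda>h. gr x \<bullet> h)" by (rule ext)
  with d show ?thesis by simp
qed

lemma gr_zero: "x \<in> D \<Longrightarrow> gr x = 0 \<Longrightarrow> x = xs"
  using gr_deriv[of x] J_crit[of x] by (simp add: gderiv_def)

lemma pd_continuous: "continuous_on \<Omega> (\<lambda>z. pd i J (fst z))"
  using Ck_on_imp_continuous_on[OF pd_Ck[OF J_Ck[folded Suc_1]]] fst_\<Omega>(1)
  by (intro continuous_on_compose2[OF _ continuous_on_fst[OF continuous_on_id]]) auto

theorem asymptotically_stable:
  "practically_uniformly_asymptotically_stable
     (es_field J \<phi>1 \<phi>2 \<psi>1 \<psi>2 \<epsilon> \<alpha> \<beta> \<kappa> \<nu>) \<Omega> S (xs, 0)"
proof -
  have c\<Omega>: "(xs, 0) \<in> \<Omega>" using xs \<epsilon> by (simp add: \<Omega>_def)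
  then obtain R where R: "R > 0" "cball (xs, 0) R \<subseteq> \<Omega>"
    using open_\<Omega> open_contains_cball by blast
  note ball_sub = R(2)
  let ?K = "cball (xs, 0 :: real^'n) R"
  interpret oscillating_system idx pw "\<lambda>a. trig (fr a) (ph a)" g \<Omega> ?K
    by (rule oscillating[OF compact_cball R(2)])
  have pw_vals: "pw b \<in> {2, 3, 6}" for b by (auto simp: pw_def)
  \<comment> \<open>Power 6 marks the drift, whose weight has frequency 0 and is constantly
    1.\<close>
  have m1: "mean (\<lambda>_. trig (fr a) (ph a)) \<tau>0 = (if pw a = 6 then 2 * pi else 0)" if "a \<in> idx" for a \<tau>0
    using fr_pos[OF that] by (auto simp: mean_trig fr_def ph_def pw_def)
  have m2: "mean (\<lambda>\<tau>0 \<tau>. prim (\<lambda>_. trig (fr a) (ph a)) \<tau>0 \<tau> * trig (fr b) (ph b) \<tau>) \<tau>0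
      = (if pw a + pw b = 6 then C2 a b else 0)"
    if a: "a \<in> idx" and b: "b \<in> idx" and le: "pw a + pw b \<le> 6" for a b \<tau>0
  proof -
    have ne: "pw a \<noteq> 6" "pw b \<noteq> 6" using le pw_vals[of a] pw_vals[of b] by auto
    have "C2 a b = 0" if "pw a + pw b \<noteq> 6"
      by (rule C2_eq_0[OF a b ne]) (use that in \<open>auto simp: pw_def\<close>)
    then show ?thesis using mean_trig2[OF fr_pos[OF a ne(1)] fr_pos[OF b ne(2)]] by simp
  qed
  have m3: "mean (\<lambda>\<tau>0 \<tau>. prim (\<lambda>\<tau>0 \<tau>. prim (\<lambda>_. trig (fr a) (ph a)) \<tau>0 \<tau> * trig (fr b) (ph b) \<tau>) \<tau>0 \<tau>
        * trig (fr c) (ph c) \<tau>) \<tau>0 = C3 a b c"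
    if abc: "a \<in> idx" "b \<in> idx" "c \<in> idx" and eq: "pw a + pw b + pw c = 6" for a b c \<tau>0
  proof -
    have "pw a = 2" "pw b = 2" "pw c = 2"
      using eq pw_vals[of a] pw_vals[of b] pw_vals[of c] by auto
    then have osc: "a \<in> osc_idx" "b \<in> osc_idx" "c \<in> osc_idx"
      using abc by (auto simp: pw_def split: if_splits)
    show ?thesis
    proof (rule mean_trig3)
      show "fr a > 0" "fr b > 0" "fr c > 0"
        using fr_pos abc \<open>pw a = 2\<close> \<open>pw b = 2\<close> \<open>pw c = 2\<close> by auto
      \<comment> \<open>Distinct oscillating indices have distinct frequencies, so equal frequencies
        mean equal indices.\<close>
      show "ph a = ph b" if "fr a = fr b" using fr_inj_osc[OF osc(1,2) that] by simp
      show "ph b = ph c" if "fr b = fr c" using fr_inj_osc[OF osc(2,3) that] by simp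
    qed
  qed
  have avg: "(2 * pi) *\<^sub>R G z \<bullet> e = averaged (\<lambda>_. 2 * pi) C2 C3 e z" if z: "z \<in> ?K" for e z
  proof -
    have z\<Omega>: "z \<in> \<Omega>" using R(2) z by blast
    have l1: "lie (g b) (\<lambda>z. g a z \<bullet> e) z = lie (g b) (amp a) z * (dir a \<bullet> e)" if "z \<in> \<Omega>" for a b z
      unfolding g_def[of a] inner_scaleR_left
      by (rule lie_scale[OF amp_Ck[folded Suc_1] that])
    have l2: "lie (g c) (lie (g b) (\<lambda>z. g a z \<bullet> e)) z = lie (g c) (lie (g b) (amp a)) z * (dir a \<bullet> e)"
      if "b \<in> idx" for a b c
    proof -
      have "Ck_on 1 (\<lambda>z. g b z \<bullet> e) \<Omega>" for e
        unfolding g_def inner_scaleR_left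
        by (rule Ck_on_Suc_imp, rule Ck_on_mult[OF _ Ck_on_const]) (use amp_Ck[of b] in \<open>simp add: numeral_2_eq_2\<close>)
      then have Ck: "Ck_on (Suc 0) (lie (g b) (amp a)) \<Omega>"
        using Ck_on_lie[OF open_\<Omega>, of "Suc 0" "amp a" "g b"] amp_Ck[of a] by (simp add: numeral_2_eq_2)
      have "lie (g c) (lie (g b) (\<lambda>z. g a z \<bullet> e)) z = lie (g c) (\<lambda>z. lie (g b) (amp a) z * (dir a \<bullet> e)) z"
        by (rule lie_cong[OF open_\<Omega> z\<Omega>]) (rule l1)
      also have "\<dots> = lie (g c) (lie (g b) (amp a)) z * (dir a \<bullet> e)"
        by (rule lie_scale[OF Ck z\<Omega>])
      finally show ?thesis .
    qed
    have "averaged (\<lambda>_. 2 * pi) C2 C3 e z = (\<Sum>a\<in>idx. coef a z * (dir a \<bullet> e))"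
      unfolding averaged_def
    proof (rule sum.cong[OF refl])
      fix a assume "a \<in> idx"
      have inner: "(\<Sum>c\<in>idx. if pw a + pw b + pw c = 6
            then C3 a b c * lie (g c) (lie (g b) (\<lambda>z. g a z \<bullet> e)) z else 0)
          = (\<Sum>c\<in>idx. if pw a + pw b + pw c = 6
            then C3 a b c * lie (g c) (lie (g b) (amp a)) z else 0) * (dir a \<bullet> e)" if "b \<in> idx" for b
        unfolding sum_distrib_right l2[OF that] by (intro sum.cong) auto
      have "(\<Sum>b\<in>idx. if pw a + pw b \<ge> 6
            then if pw a + pw b = 6 then C2 a b * lie (g b) (\<lambda>z. g a z \<bullet> e) z else 0
            else - (\<Sum>c\<in>idx. if pw a + pw b + pw c = 6
                   then C3 a b c * lie (g c) (lie (g b) (\<lambda>z. g a z \<bullet> e)) z else 0))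
          = (\<Sum>b\<in>idx. if pw a + pw b \<ge> 6
            then if pw a + pw b = 6 then C2 a b * lie (g b) (amp a) z else 0
            else - (\<Sum>c\<in>idx. if pw a + pw b + pw c = 6
                   then C3 a b c * lie (g c) (lie (g b) (amp a)) z else 0)) * (dir a \<bullet> e)"
        unfolding sum_distrib_right[of _ idx "dir a \<bullet> e"] l1[OF z\<Omega>]
        by (intro sum.cong refl) (simp add: inner)
      then show "(if pw a = 6 then 2 * pi * (g a z \<bullet> e) else
          - (\<Sum>b\<in>idx. if pw a + pw b \<ge> 6
            then if pw a + pw b = 6 then C2 a b * lie (g b) (\<lambda>z. g a z \<bullet> e) z else 0
            else - (\<Sum>c\<in>idx. if pw a + pw b + pw c = 6
                   then C3 a b c * lie (g c) (lie (g b) (\<lambda>z. g a z \<bullet> e)) z else 0)))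
          = coef a z * (dir a \<bullet> e)"
        unfolding coef_def by (simp add: g_def)
    qed
    also have "\<dots> = (\<Sum>a\<in>idx. coef a z *\<^sub>R dir a) \<bullet> e"
      by (simp add: inner_sum_left)
    finally show ?thesis unfolding sum_coef[OF z\<Omega>] by simp
  qed
  have gr_cont: "continuous_on ?K (\<lambda>z. gr (fst z))"
    unfolding gr_def using continuous_on_subset[OF pd_continuous R(2)] by (intro continuous_on_vec_lambda)
  have G_cont: "continuous_on ?K G"
  proof -
    have ne: "\<forall>z\<in>?K. snd z $ i + \<epsilon> \<noteq> 0" for i
      using fst_\<Omega>(3)[of _ i] R(2) by fastforce
    show ?thesis
      unfolding G_def[abs_def] using continuous_on_subset[OF pd_continuous R(2)]
      by (intro continuous_on_Pair continuous_on_vec_lambda continuous_intros ne)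
  qed
  obtain B where B: "B > 0" "\<And>z. z \<in> ?K \<Longrightarrow> norm (gr (fst z)) \<le> B"
    using compact_imp_bounded[OF compact_continuous_image[OF gr_cont compact_cball]]
    unfolding bounded_pos by blast
  \<comment> \<open>A lower bound for the gain of the gradient term on the ball, where each
    component of \<open>v\<close> is at most \<open>R\<close>.\<close>
  define w where "w = (R + \<epsilon>) powr (- 1 / 2)"
  have w: "w > 0" using R \<epsilon> by (simp add: w_def)
  \<comment> \<open>The summands are the thresholds required by \<open>lyapunov_decrease\<close> for
    the single coordinates; being positive, their sum exceeds each of them.\<close>
  define M where "M = (\<Sum>i\<in>UNIV. (\<beta> i * B\<^sup>2 + 1) / (\<alpha> i * w))"
  have term_pos: "(\<beta> i * B\<^sup>2 + 1) / (\<alpha> i * w) > 0" for i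
    using \<alpha>[of i] \<beta>[of i] w by (intro divide_pos_pos add_nonneg_pos mult_pos_pos) auto
  have M: "M > 0" unfolding M_def by (intro sum_pos term_pos) auto
  have M_ge: "M * \<alpha> i * w \<ge> \<beta> i * B\<^sup>2 + 1" for i
  proof -
    have "(\<beta> i * B\<^sup>2 + 1) / (\<alpha> i * w) \<le> M"
      unfolding M_def using term_pos by (intro member_le_sum) (auto intro: less_imp_le)
    then show ?thesis using \<alpha>[of i] w by (simp add: pos_divide_le_eq mult.assoc)
  qed
  define V where "V z = M * (J (fst z) - J xs) + snd z \<bullet> snd z" for z :: "(real^'n) \<times> (real^'n)"
  define V' where "V' z = (M *\<^sub>R gr (fst z), 2 *\<^sub>R snd z)" for z :: "(real^'n) \<times> (real^'n)"
  interpret averaged_lyapunov "es_field J \<phi>1 \<phi>2 \<psi>1 \<psi>2 \<epsilon> \<alpha> \<beta> \<kappa> \<nu>" G V V' "(xs, 0)" R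
  proof (rule averaged_lyapunovI[OF refl R(1) _ m1 m2 m3 avg G_cont])
    show "es_field J \<phi>1 \<phi>2 \<psi>1 \<psi>2 \<epsilon> \<alpha> \<beta> \<kappa> \<nu> \<omega> t z =
        \<omega> *\<^sub>R osc_field (\<omega> powr (- 1 / 6)) (\<omega> * t) z" if "\<omega> > 0" "z \<in> ?K" for \<omega> t z
    proof -
      have "z \<in> \<Omega>" using that R(2) by blast
      then show ?thesis
        using es_field_eq[OF that(1), of "snd z" t "fst z"] by (auto simp: \<Omega>_def osc_field_def)
    qed
    show "(V has_derivative (\<lambda>h. V' z \<bullet> h)) (at z)" if "z \<in> ?K" for z
    proof -
      have z: "z \<in> \<Omega>" using that R(2) by blast
      have "((\<lambda>z. J (fst z)) has_derivative (\<lambda>h. gr (fst z) \<bullet> fst h)) (at z)"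
        by (rule has_derivative_compose[OF bounded_linear_imp_has_derivative[OF bounded_linear_fst]
              gr_deriv[OF fst_\<Omega>(2)[OF z]]])
      moreover have "(snd has_derivative snd) (at z)"
        by (rule bounded_linear_imp_has_derivative[OF bounded_linear_snd])
      ultimately have "(V has_derivative (\<lambda>h. M * (gr (fst z) \<bullet> fst h - 0) + (snd z \<bullet> snd h + snd h \<bullet> snd z))) (at z)"
        unfolding V_def[abs_def]
        by (intro has_derivative_add has_derivative_mult_right has_derivative_diff has_derivative_const has_derivative_inner)
      then show ?thesis
        by (rule has_derivative_eq_rhs) (simp add: V'_def inner_prod_def fun_eq_iff inner_commute)
    qed
    show "continuous_on ?K V'"
      unfolding V'_def[abs_def] by (intro continuous_intros gr_cont)
    show "V (xs, 0) = 0" by (simp add: V_def)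
    show "V z > 0" if "z \<in> ?K - {(xs, 0)}" for z
    proof (cases "fst z = xs")
      case True
      then have "snd z \<noteq> 0" using that by (auto simp: prod_eq_iff)
      then show ?thesis using True by (simp add: V_def)
    next
      case False
      have "fst z \<in> D" using that R(2) fst_\<Omega>(2)[of z] by blast
      then show ?thesis using J_min[of "fst z"] False M by (simp add: V_def add_pos_nonneg)
    qed
    show "V' z \<bullet> G z < 0" if z: "z \<in> ?K - {(xs, 0)}" for z
    proof -
      have z\<Omega>: "z \<in> \<Omega>" using z R(2) by blast
      let ?p = "\<lambda>i. pd i J (fst z)" and ?v = "\<lambda>i. snd z $ i"
      have "V' z \<bullet> G z = (\<Sum>i\<in>UNIV. M * ?p i * (- \<alpha> i * ?p i * (?v i + \<epsilon>) powr (- 1 / 2))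
          + 2 * ?v i * (- \<beta> i * ?v i + \<beta> i * (?p i)\<^sup>2))"
        unfolding V'_def G_def inner_prod_def fst_conv snd_conv inner_vec_def sum.distrib[symmetric]
        by (simp add: gr_def)
      also have "\<dots> \<le> (\<Sum>i\<in>UNIV. - ((?p i)\<^sup>2 + \<beta> i * (?v i)\<^sup>2))"
      proof (rule sum_mono, rule lyapunov_decrease[OF M_ge])
        fix i :: 'n
        have "norm (snd z) \<le> norm (z - (xs, 0))"
          using norm_snd_le[of "snd z" "fst z - xs"] by (cases z) simp
        also have "\<dots> \<le> R" using z by (simp add: dist_norm norm_minus_commute)
        finally have "?v i \<le> R" using component_le_norm_cart[of "snd z" i] by linarith
        then show "w \<le> (?v i + \<epsilon>) powr (- 1 / 2)"
          unfolding w_def using fst_\<Omega>(3)[OF z\<Omega>, of i] by (intro powr_mono2') auto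
        have "\<bar>?p i\<bar> \<le> B"
          using component_le_norm_cart[of "gr (fst z)" i] B(2)[of z] z by (simp add: gr_def)
        then have "\<bar>?p i\<bar>\<^sup>2 \<le> B\<^sup>2" by (intro power_mono) auto
        then show "(?p i)\<^sup>2 \<le> B\<^sup>2" by simp
      qed (use M \<alpha> \<beta> in \<open>auto intro: less_imp_le\<close>)
      also have "\<dots> < 0"
      proof -
        \<comment> \<open>Otherwise the gradient and \<open>v\<close> both vanish, and the only
          critical point of \<open>J\<close> is \<open>xs\<close>.\<close>
        have "\<exists>i. ?p i \<noteq> 0 \<or> ?v i \<noteq> 0"
        proof (rule ccontr)
          assume "\<not> (\<exists>i. ?p i \<noteq> 0 \<or> ?v i \<noteq> 0)"
          then have "gr (fst z) = 0" "snd z = 0" by (auto simp: gr_def vec_eq_iff)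
          then have "z = (xs, 0)"
            using gr_zero[OF fst_\<Omega>(2)[OF z\<Omega>]] by (simp add: prod_eq_iff)
          then show False using z by simp
        qed
        then obtain i where i: "?p i \<noteq> 0 \<or> ?v i \<noteq> 0" by blast
        have "0 < (?p i)\<^sup>2 + \<beta> i * (?v i)\<^sup>2"
          using i \<beta>[of i] by (auto intro: add_pos_nonneg add_nonneg_pos)
        moreover have "0 \<le> (?p i)\<^sup>2 + \<beta> i * (?v i)\<^sup>2" for i
          using \<beta>[of i] by (auto intro!: add_nonneg_nonneg mult_nonneg_nonneg less_imp_le)
        ultimately have "0 < (\<Sum>i\<in>UNIV. (?p i)\<^sup>2 + \<beta> i * (?v i)\<^sup>2)"
          by (intro sum_pos2[of UNIV i]) auto
        then show ?thesis unfolding sum_negf by simp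
      qed
      finally show ?thesis .
    qed
  qed
  show ?thesis by (rule practical_asymptotic_stability[OF ball_sub])
qed

end

theorem theorem2:
  fixes D :: "(real^'n) set" and xs :: "real^'n" and J :: "real^'n \<Rightarrow> real"
    and \<phi>1 \<phi>2 \<psi>1 \<psi>2 :: "real \<Rightarrow> real"
    and \<epsilon> :: real and \<alpha> \<beta> :: "'n \<Rightarrow> real"
    and \<kappa> :: "'n \<Rightarrow> nat" and \<nu> :: "'n \<Rightarrow> nat \<Rightarrow> nat"
  assumes "open D" and "connected D" and "xs \<in> D"
    and "C2_on J D"
    and "\<And>x. x \<in> D - {xs} \<Longrightarrow> J x > J xs"
    and "\<And>x. x \<in> D \<Longrightarrow> (GDERIV J x :> 0) \<longleftrightarrow> x = xs"
    and "C2_on \<phi>1 UNIV" and "C2_on \<phi>2 UNIV" and "C2_on \<psi>1 UNIV" and "C2_on \<psi>2 UNIV"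
    and "\<And>y. lie_bracket \<phi>1 \<phi>2 y = - 1"
    and "\<And>z. lie_bracket \<psi>1 \<psi>2 z = 1"
    and "\<epsilon> > 0" and "\<And>i. \<alpha> i > 0" and "\<And>i. \<beta> i > 0"
    and "\<And>i. \<kappa> i > 0" and "\<And>i. \<nu> i 1 > 0" and "\<And>i. \<nu> i 2 > 0"
    and "\<And>i. \<nu> i 3 = \<nu> i 1 + \<nu> i 2"
    and "\<And>i. int (\<nu> i 4) = int (\<nu> i 2) - int (\<nu> i 1)" and "\<And>i. \<nu> i 4 > 0"
    and "non_resonant \<kappa> \<nu>"
  shows "practically_uniformly_asymptotically_stable
           (es_field J \<phi>1 \<phi>2 \<psi>1 \<psi>2 \<epsilon> \<alpha> \<beta> \<kappa> \<nu>)
           {(x, v). x \<in> D \<and> (\<forall>i. v $ i > - \<epsilon>)}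
           {(x, v). \<forall>i. v $ i \<ge> 0}
           (xs, 0)"
proof -
  interpret extremum_seeking D xs J \<phi>1 \<phi>2 \<psi>1 \<psi>2 \<epsilon> \<alpha> \<beta> \<kappa> \<nu>
    by unfold_locales (use assms in blast)+
  show ?thesis using asymptotically_stable unfolding \<Omega>_def .
qed

end
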